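(* Let $\mathcal F\subseteq\mathsf{FO}$ be an order-stable fragment such that no formula in $\mathcal F$ contains any of the predicates $\mathsf{suc}$, $\mathsf{min}$, $\mathsf{max}$, $\mathsf{empty}$. For all $\pi$-terms $s,t\in T_\Lambda$ the following are equivalent: (1) The identity $s=t$ holds in the syntactic monoid of every language definable in $\mathcal F$ (i.e., of every language $L_A(\varphi)$ with $A\subseteq\Lambda$ a finite alphabet and $\varphi\in\mathcal F$ a sentence). (2) Duplicator has winning strategies in the $\mathcal F$-games on $([\![s]\!]_\varrho,[\![t]\!]_\varrho)$ and on $([\![t]\!]_\varrho,[\![s]\!]_\varrho)$.
   Context: Fix a countably infinite set $\Lambda$ of letters and a countably infinite set $\mathbb V$ of first-order variables. $\pi$-terms. A $\pi$-algebra is a set with an associative binary operation (written as juxtaposition) and a unary operation $u\mapsto u^\pi$. $T_\Lambda$ is the free $\pi$-algebra generated by $\Lambda$; its elements are the $\pi$-terms. For a finite monoid $M$, the idempotency algebra on $M$ is the $\pi$-algebra on $M$ in which $u^\pi$ is the unique idempotent in $\{u^k\mid k\ge1\}$. An identity $s=t$ of $\pi$-terms holds in $M$ if $h(s)=h(t)$ for every $\pi$-algebra morphism $h$ from $T_\Lambda$ into the idempotency algebra on $M$. Words. A (generalized) word $u$ is a (possibly empty) linear order $(\mathrm{dom}(u),\le_u)$ with a labeling $\mathrm{dom}(u)\to\Lambda$, $p\mapsto u(p)$; isomorphic words are identified. $\Lambda^{\mathsf{LO}}$ is the set of countable words; finite words $\Lambda^*$ are regarded as words with domain $\{1,\dots,n\}$.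 $uv$ is concatenation (all positions of $u$ before those of $v$). For a countable order type $\tau$ represented by $(T,\le_T)$, $u^\tau$ has domain $\mathrm{dom}(u)\times T$, $(p,t)\le(p',t')$ iff $t<_Tt'$, or $t=t'$ and $p\le_u p'$, and label $u(p)$ at $(p,t)$ (i.e. $\tau$ copies of $u$). $[\![\cdot]\!]_\tau:T_\Lambda\to\Lambda^{\mathsf{LO}}$ is the unique $\pi$-algebra morphism sending each $a\in\Lambda$ to the one-position word labeled $a$, where $\Lambda^{\mathsf{LO}}$ carries concatenation and $u^\pi=u^\tau$. Let $\varrho=\omega+\zeta\cdot\eta+\omega^*$, where $\omega,\zeta,\eta,\omega^*$ are the order types of $\mathbb N,\mathbb Z,\mathbb Q,\mathbb Z_{<0}$ and $\zeta\cdot\eta$ denotes $\eta$ copies of $\zeta$. Logic. $\mathsf{FO}$ is the set of formulae built from the atoms $\top,\bot,\mathsf{empty},x=y,\lambda(x)=a,x<y,x\le y,\mathsf{suc}(x,y),\mathsf{min}(x),\mathsf{max}(x)$ ($x,y\in\mathbb V$, $a\in\Lambda$) by $\neg,\vee,\wedge,\exists x,\forall x$. $\mathrm{FV}(\varphi)$ is the set of free variables; a sentence has none; a literal is an atom or a negated atom. For finite $\mathbb X\subseteq\mathbb V$, an $\mathbb X$-valuation $\langle u,\alpha\rangle$ is a word $u\in\Lambda^{\mathsf{LO}}$ with a map $\alpha:\mathbb X\to\mathrm{dom}(u)$; $\langle u,\alpha\rangle\models\varphi$ (for $\mathrm{FV}(\varphi)\subseteq\mathbb X$) is the usual semantics: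 variables range over positions, $\lambda$ is the labeling, $\mathsf{empty}$ says the domain is empty, $\mathsf{suc}(x,y)$ says $y$ is the immediate successor of $x$, $\mathsf{min}(x)$/$\mathsf{max}(x)$ say $x$ is the least/greatest position. A word $u$ is identified with the $\emptyset$-valuation on $u$. For finite $A\subseteq\Lambda$ and a sentence $\varphi$, $L_A(\varphi)=\{w\in A^*\mid w\models\varphi\}$; this is always a regular language. For $L\subseteq A^*$, $u\equiv_Lv$ iff for all $x,y\in A^*$: $xuy\in L\Leftrightarrow xvy\in L$; the syntactic monoid of $L$ is $A^*/{\equiv_L}$ (finite if $L$ is regular). Fragments. A context $\mu$ is a formula with a unique occurrence of an extra constant predicate $\circ$; $\mu(\varphi)$ is the result of replacing $\circ$ by $\varphi$. A fragment is a non-empty set $\mathcal F\subseteq\mathsf{FO}$ such that for all contexts $\mu$, $\varphi,\psi\in\mathsf{FO}$, $a\in\Lambda$, $x,y\in\mathbb V$: (i) if $\mu(\varphi)\in\mathcal F$ then $\mu(\top),\mu(\bot),\mu(\lambda(x)=a)\in\mathcal F$; (ii) $\mu(\varphi\vee\psi)\in\mathcal F$ iff $\mu(\varphi),\mu(\psi)\in\mathcal F$; (iii) $\mu(\varphi\wedge\psi)\in\mathcal F$ iff $\mu(\varphi),\mu(\psi)\in\mathcal F$; (iv) $\mu(\neg\neg\varphi)\in\mathcal F$ implies $\mu(\varphi)\in\mathcal F$; (v) if $\mu(\exists x\,\varphi)\in\mathcal F$ and $x\notin\mathrm{FV}(\varphi)$ then $\mu(\varphi)\in\mathcal F$; (vi)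 if $\mu(\forall x\,\varphi)\in\mathcal F$ and $x\notin\mathrm{FV}(\varphi)$ then $\mu(\varphi)\in\mathcal F$. It is order-stable if for all $\mu,x,y$: $\mu(x<y)\in\mathcal F$ iff $\mu(x\le y)\in\mathcal F$. Game. Let $\mathcal Q=\{\exists,\forall,\neg\exists,\neg\forall\}$. For $\mathsf Q\in\mathcal Q$ and $x\in\mathbb V$ the reduct is $\mathcal F/\mathsf Qx=\{\varphi\in\mathsf{FO}\mid\mathsf Qx\,\varphi\in\mathcal F\}$ (a fragment whenever non-empty). A configuration is a triple $(\mathcal G,\langle u,\alpha\rangle,\langle v,\beta\rangle)$ with $\mathcal G$ a fragment and $\langle u,\alpha\rangle,\langle v,\beta\rangle$ $\mathbb X$-valuations for the same finite $\mathbb X\subseteq\mathbb V$. If there is a literal $\varphi\in\mathcal G$ with $\mathrm{FV}(\varphi)\subseteq\mathbb X$, $\langle u,\alpha\rangle\models\varphi$ and $\langle v,\beta\rangle\not\models\varphi$, the game stops and Spoiler wins. Otherwise a round is played: Spoiler chooses $\mathsf Q\in\mathcal Q$ and $x\in\mathbb V$ with $\mathcal G/\mathsf Qx\ne\emptyset$, and then a position $q$, in $\mathrm{dom}(u)$ if $\mathsf Q\in\{\exists,\neg\forall\}$ and in $\mathrm{dom}(v)$ if $\mathsf Q\in\{\forall,\neg\exists\}$; Duplicator chooses a position $r$ in the domain of the other word. With $\alpha[x/p]$ denoting $\alpha$ with the value at $x$ set (or reset) to $p$, the next configuration is, for $\exists$: $(\mathcal G/\exists x,\langle u,\alpha[x/q]\rangle,\langle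 v,\beta[x/r]\rangle)$; for $\forall$: $(\mathcal G/\forall x,\langle u,\alpha[x/r]\rangle,\langle v,\beta[x/q]\rangle)$; for $\neg\exists$: $(\mathcal G/\neg\exists x,\langle v,\beta[x/q]\rangle,\langle u,\alpha[x/r]\rangle)$; for $\neg\forall$: $(\mathcal G/\neg\forall x,\langle v,\beta[x/r]\rangle,\langle u,\alpha[x/q]\rangle)$. A player unable to make a required choice loses immediately. Duplicator wins all infinite plays. The $\mathcal F$-game on $(u,v)$ starts in the configuration $(\mathcal F,u,v)$ with $\mathbb X=\emptyset$. *)

theory Defs
  imports "HOL-Library.Countable" "HOL-Library.Infinite_Typeclass" "HOL-Algebra.Group"
begin

section \<open>Terms over the free algebra with a product and a power\<close>

datatype 'a raw_piterm = RLetter 'a | RMult "'a raw_piterm" "'a raw_piterm" | RPi "'a raw_piterm"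

inductive assoc_eq :: "'a raw_piterm \<Rightarrow> 'a raw_piterm \<Rightarrow> bool" where
  ae_refl: "assoc_eq s s"
| ae_sym: "assoc_eq s t \<Longrightarrow> assoc_eq t s"
| ae_trans: "assoc_eq r s \<Longrightarrow> assoc_eq s t \<Longrightarrow> assoc_eq r t"
| ae_assoc: "assoc_eq (RMult (RMult r s) t) (RMult r (RMult s t))"
| ae_mult: "assoc_eq s s' \<Longrightarrow> assoc_eq t t' \<Longrightarrow> assoc_eq (RMult s t) (RMult s' t')"
| ae_pi: "assoc_eq s s' \<Longrightarrow> assoc_eq (RPi s) (RPi s')"

quotient_type 'a piterm = "'a raw_piterm" / assoc_eq
  by (rule equivpI) (auto simp: reflp_def symp_def transp_def intro: assoc_eq.intros)

lift_definition Letter :: "'a \<Rightarrow> 'a piterm" is RLetter .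
lift_definition Mult :: "'a piterm \<Rightarrow> 'a piterm \<Rightarrow> 'a piterm" is RMult by (rule ae_mult)
lift_definition Pi_pow :: "'a piterm \<Rightarrow> 'a piterm" is RPi by (rule ae_pi)

lemma Mult_assoc: "Mult (Mult r s) t = Mult r (Mult s t)"
  by transfer (rule ae_assoc)

lemma piterm_induct [case_names Letter Mult Pi_pow, induct type: piterm]:
  assumes "\<And>a. P (Letter a)"
    and "\<And>s t. P s \<Longrightarrow> P t \<Longrightarrow> P (Mult s t)"
    and "\<And>s. P s \<Longrightarrow> P (Pi_pow s)"
  shows "P t"
  using assms
proof transfer
  fix P :: "'a raw_piterm \<Rightarrow> bool" and t
  assume "\<And>a. P (RLetter a)" "\<And>s t. P s \<Longrightarrow> P t \<Longrightarrow> P (RMult s t)" "\<And>s. P s \<Longrightarrow> P (RPi s)"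
  then show "P t" by (induction t) auto
qed

definition pi_algebra :: "'b set \<Rightarrow> ('b \<Rightarrow> 'b \<Rightarrow> 'b) \<Rightarrow> ('b \<Rightarrow> 'b) \<Rightarrow> bool" where
  "pi_algebra C mul pw \<longleftrightarrow>
     (\<forall>x\<in>C. \<forall>y\<in>C. mul x y \<in> C) \<and>
     (\<forall>x\<in>C. \<forall>y\<in>C. \<forall>z\<in>C. mul (mul x y) z = mul x (mul y z)) \<and>
     (\<forall>x\<in>C. pw x \<in> C)"

definition pi_morphism ::
  "'b set \<Rightarrow> ('b \<Rightarrow> 'b \<Rightarrow> 'b) \<Rightarrow> ('b \<Rightarrow> 'b) \<Rightarrow> ('a piterm \<Rightarrow> 'b) \<Rightarrow> bool" where
  "pi_morphism C mul pw h \<longleftrightarrow>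
     (\<forall>t. h t \<in> C) \<and>
     (\<forall>s t. h (Mult s t) = mul (h s) (h t)) \<and>
     (\<forall>t. h (Pi_pow t) = pw (h t))"

lemma pi_morphism_unique:
  assumes "pi_morphism C mul pw h" "pi_morphism C mul pw h'" "\<And>a. h (Letter a) = h' (Letter a)"
  shows "h = h'"
proof
  fix t show "h t = h' t"
    using assms by (induction t) (auto simp: pi_morphism_def)
qed

primrec raw_ext :: "('b \<Rightarrow> 'b \<Rightarrow> 'b) \<Rightarrow> ('b \<Rightarrow> 'b) \<Rightarrow> ('a \<Rightarrow> 'b) \<Rightarrow> 'a raw_piterm \<Rightarrow> 'b" where
  "raw_ext mul pw f (RLetter a) = f a"
| "raw_ext mul pw f (RMult s t) = mul (raw_ext mul pw f s) (raw_ext mul pw f t)"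
| "raw_ext mul pw f (RPi s) = pw (raw_ext mul pw f s)"

lemma piterm_free:
  assumes "pi_algebra C mul pw" and f: "\<And>a. f a \<in> C"
  shows "\<exists>!h. pi_morphism C mul pw h \<and> (\<forall>a. h (Letter a) = f a)"
proof (rule ex_ex1I)
  let ?e = "raw_ext mul pw f"
  have C: "?e t \<in> C" for t
    using assms by (induction t) (auto simp: pi_algebra_def)
  have eq: "assoc_eq s t \<Longrightarrow> ?e s = ?e t" for s t
    by (induction rule: assoc_eq.induct) (use assms C in \<open>auto simp: pi_algebra_def\<close>)
  define h where "h t = ?e (rep_piterm t)" for t
  have h: "h (abs_piterm t) = ?e t" for t
    unfolding h_def by (intro eq) (metis Quotient3_piterm ae_refl rep_abs_rsp_left)
  have ab: "\<exists>s. t = abs_piterm s" for t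
    by (metis Quotient3_abs_rep Quotient3_piterm)
  have "h (Mult s t) = mul (h s) (h t)" for s t
    using ab[of s] ab[of t] by (auto simp: h Mult.abs_eq)
  moreover have "h (Pi_pow t) = pw (h t)" for t
    using ab[of t] by (auto simp: h Pi_pow.abs_eq)
  ultimately have "pi_morphism C mul pw h"
    by (auto simp: pi_morphism_def h_def C)
  moreover have "h (Letter a) = f a" for a by (simp add: Letter.abs_eq h)
  ultimately show "\<exists>h. pi_morphism C mul pw h \<and> (\<forall>a. h (Letter a) = f a)" by blast
next
  fix h h' assume "pi_morphism C mul pw h \<and> (\<forall>a. h (Letter a) = f a)"
    "pi_morphism C mul pw h' \<and> (\<forall>a. h' (Letter a) = f a)"
  then show "h = h'" by (metis pi_morphism_unique)
qed

definition idem_power :: "('m, 'k) monoid_scheme \<Rightarrow> 'm \<Rightarrow> 'm" where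
  "idem_power M x =
     (THE e. e \<in> {x [^]\<^bsub>M\<^esub> k | k :: nat. k \<ge> 1} \<and> e \<otimes>\<^bsub>M\<^esub> e = e)"

text \<open>Meaningful for finite monoids, where the idempotent power exists and is unique.\<close>
definition holds_in :: "('m, 'k) monoid_scheme \<Rightarrow> 'a piterm \<Rightarrow> 'a piterm \<Rightarrow> bool" where
  "holds_in M s t \<longleftrightarrow>
     (\<forall>h. pi_morphism (carrier M) (mult M) (idem_power M) h \<longrightarrow> h s = h t)"


section \<open>Generalized words\<close>

record ('p, 'a) lword =
  positions :: "'p set"
  leq :: "('p \<times> 'p) set"
  label :: "'p \<Rightarrow> 'a"

definition wf_lword :: "('p, 'a) lword \<Rightarrow> bool" where
  "wf_lword u \<longleftrightarrow> linear_order_on (positions u) (leq u)"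

definition is_iso :: "('p \<Rightarrow> 'q) \<Rightarrow> ('p, 'a) lword \<Rightarrow> ('q, 'a) lword \<Rightarrow> bool" where
  "is_iso f u v \<longleftrightarrow>
     bij_betw f (positions u) (positions v) \<and>
     (\<forall>p\<in>positions u. \<forall>q\<in>positions u. (p, q) \<in> leq u \<longleftrightarrow> (f p, f q) \<in> leq v) \<and>
     (\<forall>p\<in>positions u. label v (f p) = label u p)"

definition word_iso :: "('p, 'a) lword \<Rightarrow> ('q, 'a) lword \<Rightarrow> bool" where
  "word_iso u v \<longleftrightarrow> wf_lword u \<and> wf_lword v \<and> (\<exists>f. is_iso f u v)"

lemma word_isoI: "is_iso f u v \<Longrightarrow> wf_lword u \<Longrightarrow> wf_lword v \<Longrightarrow> word_iso u v"
  by (auto simp: word_iso_def)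

lemma word_iso_wf: "word_iso u v \<Longrightarrow> wf_lword u" "word_iso u v \<Longrightarrow> wf_lword v"
  by (auto simp: word_iso_def)

lemma is_iso_id: "is_iso id u u"
  by (auto simp: is_iso_def)

lemma is_iso_inv:
  assumes "is_iso f u v" shows "is_iso (the_inv_into (positions u) f) v u"
proof -
  let ?g = "the_inv_into (positions u) f"
  have b: "bij_betw f (positions u) (positions v)" using assms by (simp add: is_iso_def)
  then have i: "inj_on f (positions u)" by (simp add: bij_betw_def)
  have gb: "bij_betw ?g (positions v) (positions u)" by (rule bij_betw_the_inv_into[OF b])
  have g: "?g q \<in> positions u \<and> f (?g q) = q" if "q \<in> positions v" for q
    using that gb b i by (meson bij_betw_apply f_the_inv_into_f_bij_betw)
  show ?thesis
    unfolding is_iso_def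
  proof (intro conjI ballI gb)
    fix p q assume "p \<in> positions v" "q \<in> positions v"
    then show "(p, q) \<in> leq v \<longleftrightarrow> (?g p, ?g q) \<in> leq u"
      using g[of p] g[of q] assms unfolding is_iso_def by metis
  next
    fix p assume "p \<in> positions v"
    then show "label u (?g p) = label v p"
      using g[of p] assms unfolding is_iso_def by metis
  qed
qed

lemma is_iso_comp: "is_iso f u v \<Longrightarrow> is_iso g v w \<Longrightarrow> is_iso (g \<circ> f) u w"
  unfolding is_iso_def
  by (auto intro: bij_betw_trans simp: bij_betw_apply)

lemma word_iso_sym: "word_iso u v \<Longrightarrow> word_iso v u"
  unfolding word_iso_def using is_iso_inv by blast

lemma word_iso_trans: "word_iso u v \<Longrightarrow> word_iso v w \<Longrightarrow> word_iso u w"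
  unfolding word_iso_def using is_iso_comp by blast

lemma word_iso_refl: "wf_lword u \<Longrightarrow> word_iso u u"
  unfolding word_iso_def using is_iso_id by blast

definition encode :: "('p::countable, 'a) lword \<Rightarrow> (nat, 'a) lword" where
  "encode u = \<lparr>positions = to_nat ` positions u,
               leq = map_prod to_nat to_nat ` leq u,
               label = label u \<circ> from_nat\<rparr>"

lemma encode_iso: "is_iso to_nat u (encode u)"
  by (auto simp: is_iso_def encode_def bij_betw_def)

lemma wf_lwordI:
  assumes "\<And>p q. (p, q) \<in> leq u \<Longrightarrow> p \<in> positions u \<and> q \<in> positions u"
    and "\<And>p. p \<in> positions u \<Longrightarrow> (p, p) \<in> leq u"
    and "\<And>p q r. (p, q) \<in> leq u \<Longrightarrow> (q, r) \<in> leq u \<Longrightarrow> (p, r) \<in> leq u"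
    and "\<And>p q. (p, q) \<in> leq u \<Longrightarrow> (q, p) \<in> leq u \<Longrightarrow> p = q"
    and "\<And>p q. p \<in> positions u \<Longrightarrow> q \<in> positions u \<Longrightarrow> (p, q) \<in> leq u \<or> (q, p) \<in> leq u"
  shows "wf_lword u"
  unfolding wf_lword_def linear_order_on_def partial_order_on_def preorder_on_def
proof (intro conjI)
  show "leq u \<subseteq> positions u \<times> positions u" using assms(1) by (intro subrelI) simp
  show "refl_on (positions u) (leq u)" using assms(2) by (intro refl_onI)
  show "trans (leq u)" using assms(3) by (intro transI)
  show "antisym (leq u)" using assms(4) by (intro antisymI)
  show "total_on (positions u) (leq u)" using assms(5) by (simp add: total_on_def)
qed

lemma wf_lwordD:
  assumes "wf_lword u"
  shows "(p, q) \<in> leq u \<Longrightarrow> p \<in> positions u" "(p, q) \<in> leq u \<Longrightarrow> q \<in> positions u"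
    and "p \<in> positions u \<Longrightarrow> (p, p) \<in> leq u"
    and "(p, q) \<in> leq u \<Longrightarrow> (q, r) \<in> leq u \<Longrightarrow> (p, r) \<in> leq u"
    and "(p, q) \<in> leq u \<Longrightarrow> (q, p) \<in> leq u \<Longrightarrow> p = q"
    and "p \<in> positions u \<Longrightarrow> q \<in> positions u \<Longrightarrow> (p, q) \<in> leq u \<or> (q, p) \<in> leq u"
proof -
  have *: "leq u \<subseteq> positions u \<times> positions u" "refl_on (positions u) (leq u)" "trans (leq u)"
    "antisym (leq u)" "total_on (positions u) (leq u)"
    using assms unfolding wf_lword_def linear_order_on_def partial_order_on_def preorder_on_def
    by simp_all
  show "(p, q) \<in> leq u \<Longrightarrow> p \<in> positions u" "(p, q) \<in> leq u \<Longrightarrow> q \<in> positions u"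
    using *(1) by auto
  show r: "p \<in> positions u \<Longrightarrow> (p, p) \<in> leq u" using *(2) by (rule refl_onD)
  show "(p, q) \<in> leq u \<Longrightarrow> (q, r) \<in> leq u \<Longrightarrow> (p, r) \<in> leq u" using *(3) by (rule transD)
  show "(p, q) \<in> leq u \<Longrightarrow> (q, p) \<in> leq u \<Longrightarrow> p = q" using *(4) by (rule antisymD)
  show "p \<in> positions u \<Longrightarrow> q \<in> positions u \<Longrightarrow> (p, q) \<in> leq u \<or> (q, p) \<in> leq u"
    using *(5) r by (cases "p = q") (auto simp: total_on_def)
qed

lemma encode_wf: assumes "wf_lword u" shows "wf_lword (encode u)"
proof (rule wf_lwordI)
  fix p q assume "p \<in> positions (encode u)" "q \<in> positions (encode u)"
  then obtain p' q' where "p' \<in> positions u" "q' \<in> positions u" "p = to_nat p'" "q = to_nat q'"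
    by (auto simp: encode_def)
  then show "(p, q) \<in> leq (encode u) \<or> (q, p) \<in> leq (encode u)"
    using wf_lwordD(6)[OF assms, of p' q'] by (auto simp: encode_def)
next
  fix p q r assume "(p, q) \<in> leq (encode u)" "(q, r) \<in> leq (encode u)"
  then obtain p' q' r' where "(p', q') \<in> leq u" "(q', r') \<in> leq u" "p = to_nat p'" "r = to_nat r'"
    by (auto simp: encode_def)
  then show "(p, r) \<in> leq (encode u)"
    using wf_lwordD(4)[OF assms, of p' q' r'] by (force simp: encode_def)
qed (auto simp: encode_def dest: wf_lwordD[OF assms])

lemma word_iso_encode: "wf_lword u \<Longrightarrow> word_iso u (encode u)"
  unfolding word_iso_def using encode_wf encode_iso by blast

lemma encode_cong: "word_iso u v \<Longrightarrow> word_iso (encode u) (encode v)"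
  by (meson word_iso_def word_iso_encode word_iso_sym word_iso_trans)

definition lconcat :: "('p, 'a) lword \<Rightarrow> ('q, 'a) lword \<Rightarrow> ('p + 'q, 'a) lword" where
  "lconcat u v = \<lparr>positions = positions u <+> positions v,
     leq = map_prod Inl Inl ` leq u \<union> map_prod Inr Inr ` leq v
           \<union> (Inl ` positions u) \<times> (Inr ` positions v),
     label = case_sum (label u) (label v)\<rparr>"

text \<open>The second argument only provides the index order; its labels are ignored.\<close>
definition lpower :: "('p, 'a) lword \<Rightarrow> ('t, 'b) lword \<Rightarrow> ('p \<times> 't, 'a) lword" where
  "lpower u w = \<lparr>positions = positions u \<times> positions w,
     leq = {((p, t), (p', t')). p \<in> positions u \<and> p' \<in> positions u \<and>
              ((t, t') \<in> leq w \<and> t \<noteq> t' \<or> t \<in> positions w \<and> t = t' \<and> (p, p') \<in> leq u)},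
     label = label u \<circ> fst\<rparr>"

lemma lconcat_sel:
  "Inl p \<in> positions (lconcat u v) \<longleftrightarrow> p \<in> positions u"
  "Inr q \<in> positions (lconcat u v) \<longleftrightarrow> q \<in> positions v"
  "(Inl p, Inl p') \<in> leq (lconcat u v) \<longleftrightarrow> (p, p') \<in> leq u"
  "(Inr q, Inr q') \<in> leq (lconcat u v) \<longleftrightarrow> (q, q') \<in> leq v"
  "(Inl p, Inr q) \<in> leq (lconcat u v) \<longleftrightarrow> p \<in> positions u \<and> q \<in> positions v"
  "(Inr q, Inl p) \<notin> leq (lconcat u v)"
  "label (lconcat u v) (Inl p) = label u p"
  "label (lconcat u v) (Inr q) = label v q"
  by (auto simp: lconcat_def)

lemma lpower_sel:
  "(p, t) \<in> positions (lpower u w) \<longleftrightarrow> p \<in> positions u \<and> t \<in> positions w"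
  "((p, t), (p', t')) \<in> leq (lpower u w) \<longleftrightarrow> p \<in> positions u \<and> p' \<in> positions u \<and>
     ((t, t') \<in> leq w \<and> t \<noteq> t' \<or> t \<in> positions w \<and> t = t' \<and> (p, p') \<in> leq u)"
  "label (lpower u w) (p, t) = label u p"
  by (auto simp: lpower_def)

lemma lconcat_wf:
  assumes "wf_lword u" "wf_lword v" shows "wf_lword (lconcat u v)"
proof (rule wf_lwordI)
  note D = wf_lwordD[OF assms(1)] wf_lwordD[OF assms(2)]
  fix p q r
  show "(p, q) \<in> leq (lconcat u v) \<Longrightarrow> p \<in> positions (lconcat u v) \<and> q \<in> positions (lconcat u v)"
    by (cases p; cases q) (auto simp: lconcat_sel dest: D)
  show "p \<in> positions (lconcat u v) \<Longrightarrow> (p, p) \<in> leq (lconcat u v)"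
    by (cases p) (auto simp: lconcat_sel dest: D)
  show "(p, q) \<in> leq (lconcat u v) \<Longrightarrow> (q, r) \<in> leq (lconcat u v) \<Longrightarrow> (p, r) \<in> leq (lconcat u v)"
    by (cases p; cases q; cases r) (auto simp: lconcat_sel intro: D)
  show "(p, q) \<in> leq (lconcat u v) \<Longrightarrow> (q, p) \<in> leq (lconcat u v) \<Longrightarrow> p = q"
    by (cases p; cases q) (auto simp: lconcat_sel dest: D)
  show "p \<in> positions (lconcat u v) \<Longrightarrow> q \<in> positions (lconcat u v) \<Longrightarrow>
      (p, q) \<in> leq (lconcat u v) \<or> (q, p) \<in> leq (lconcat u v)"
    by (cases p; cases q) (auto simp: lconcat_sel dest: D)
qed

lemma lpower_wf:
  fixes u :: "('a, 'b) lword" and w :: "('c, 'd) lword"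
  assumes "wf_lword u" "wf_lword w" shows "wf_lword (lpower u w)"
proof (rule wf_lwordI)
  note D = wf_lwordD[OF assms(1)] and E = wf_lwordD[OF assms(2)]
  fix x y z :: "'a \<times> 'c"
  obtain p t q t' r t'' where x: "x = (p, t)" "y = (q, t')" "z = (r, t'')"
    by (cases x, cases y, cases z)
  show "(x, y) \<in> leq (lpower u w) \<Longrightarrow> x \<in> positions (lpower u w) \<and> y \<in> positions (lpower u w)"
    unfolding x lpower_sel using E(1,2)[of t t'] by blast
  show "x \<in> positions (lpower u w) \<Longrightarrow> (x, x) \<in> leq (lpower u w)"
    unfolding x lpower_sel using D(3)[of p] by blast
  show "(x, y) \<in> leq (lpower u w) \<Longrightarrow> (y, z) \<in> leq (lpower u w) \<Longrightarrow> (x, z) \<in> leq (lpower u w)"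
    unfolding x lpower_sel using D(4)[of p q r] E(4)[of t t' t''] E(5)[of t t'] by metis
  show "(x, y) \<in> leq (lpower u w) \<Longrightarrow> (y, x) \<in> leq (lpower u w) \<Longrightarrow> x = y"
    unfolding x lpower_sel using D(5)[of p q] E(5)[of t t'] by blast
  show "x \<in> positions (lpower u w) \<Longrightarrow> y \<in> positions (lpower u w) \<Longrightarrow>
      (x, y) \<in> leq (lpower u w) \<or> (y, x) \<in> leq (lpower u w)"
    unfolding x lpower_sel using D(6)[of p q] E(6)[of t t'] by blast
qed

lemma lconcat_cong:
  assumes "word_iso u u'" "word_iso v v'"
  shows "word_iso (lconcat u v) (lconcat u' v')"
proof -
  obtain f g where f: "is_iso f u u'" and g: "is_iso g v v'"
    using assms by (auto simp: word_iso_def)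
  have "is_iso (map_sum f g) (lconcat u v) (lconcat u' v')"
    unfolding is_iso_def
  proof (intro conjI ballI)
    have "inj_on (map_sum f g) (positions (lconcat u v))"
      by (rule inj_onI)
        (use f g in \<open>auto simp: is_iso_def bij_betw_def lconcat_def dest: inj_onD\<close>)
    moreover have "map_sum f g ` positions (lconcat u v) = positions (lconcat u' v')"
      using f g by (simp add: is_iso_def bij_betw_def lconcat_def Plus_def image_Un image_image
          flip: image_image[of Inl f] image_image[of Inr g])
    ultimately show "bij_betw (map_sum f g) (positions (lconcat u v)) (positions (lconcat u' v'))"
      by (simp add: bij_betw_def)
  next
    fix p q assume "p \<in> positions (lconcat u v)" "q \<in> positions (lconcat u v)"
    then show "(p, q) \<in> leq (lconcat u v) \<longleftrightarrow> (map_sum f g p, map_sum f g q) \<in> leq (lconcat u' v')"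
      using f g by (cases p; cases q) (auto simp: is_iso_def lconcat_sel dest: bij_betw_apply)
  next
    fix p assume "p \<in> positions (lconcat u v)"
    then show "label (lconcat u' v') (map_sum f g p) = label (lconcat u v) p"
      using f g by (cases p) (auto simp: is_iso_def lconcat_sel)
  qed
  then show ?thesis
    by (rule word_isoI) (intro lconcat_wf assms[THEN word_iso_wf(1)] assms[THEN word_iso_wf(2)])+
qed

lemma lpower_cong:
  assumes "word_iso u u'" "word_iso w w'"
  shows "word_iso (lpower u w) (lpower u' w')"
proof -
  obtain f g where f: "is_iso f u u'" and g: "is_iso g w w'"
    using assms by (auto simp: word_iso_def)
  have "is_iso (map_prod f g) (lpower u w) (lpower u' w')"
    unfolding is_iso_def
  proof (intro conjI ballI)
    show "bij_betw (map_prod f g) (positions (lpower u w)) (positions (lpower u' w'))"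
      using f g by (auto simp: is_iso_def lpower_def intro: bij_betw_map_prod)
  next
    fix x y assume *: "x \<in> positions (lpower u w)" "y \<in> positions (lpower u w)"
    obtain p t q t' where x: "x = (p, t)" "y = (q, t')" by (cases x, cases y)
    have pos: "p \<in> positions u" "q \<in> positions u" "t \<in> positions w" "t' \<in> positions w"
      using * by (auto simp: x lpower_sel)
    have "f p \<in> positions u'" "f q \<in> positions u'" "g t \<in> positions w'" "g t' \<in> positions w'"
      using pos f g by (auto simp: is_iso_def dest: bij_betw_apply)
    moreover have "(f p, f q) \<in> leq u' \<longleftrightarrow> (p, q) \<in> leq u" "(g t, g t') \<in> leq w' \<longleftrightarrow> (t, t') \<in> leq w"
      using pos f g unfolding is_iso_def by blast+
    moreover have "g t = g t' \<longleftrightarrow> t = t'"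
      using pos g unfolding is_iso_def bij_betw_def inj_on_def by blast
    ultimately show "(x, y) \<in> leq (lpower u w) \<longleftrightarrow>
        (map_prod f g x, map_prod f g y) \<in> leq (lpower u' w')"
      using pos by (simp add: x lpower_sel)
  next
    fix x assume "x \<in> positions (lpower u w)"
    then show "label (lpower u' w') (map_prod f g x) = label (lpower u w) x"
      using f by (cases x) (auto simp: is_iso_def lpower_sel)
  qed
  then show ?thesis
    by (rule word_isoI) (intro lpower_wf assms[THEN word_iso_wf(1)] assms[THEN word_iso_wf(2)])+
qed

text \<open>Every countable linear order has an isomorphic copy with carrier inside \<^typ>\<open>nat\<close>.\<close>
quotient_type 'a gword = "(nat, 'a) lword" / partial: word_iso
proof (rule part_equivpI)
  have "wf_lword \<lparr>positions = {}, leq = {}, label = undefined\<rparr>" by (rule wf_lwordI) auto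
  then show "\<exists>u::(nat, 'a) lword. word_iso u u" using word_iso_refl by blast
qed (auto simp: symp_def transp_def intro: word_iso_sym word_iso_trans)

lift_definition wsingle :: "'a \<Rightarrow> 'a gword" is
  "\<lambda>a. \<lparr>positions = {0}, leq = {(0, 0)}, label = (\<lambda>_. a)\<rparr>"
  by (rule word_iso_refl, rule wf_lwordI) auto

lift_definition wconcat :: "'a gword \<Rightarrow> 'a gword \<Rightarrow> 'a gword" is
  "\<lambda>u v. encode (lconcat u v)"
  by (intro encode_cong lconcat_cong)

lift_definition wpower :: "'a gword \<Rightarrow> 'b gword \<Rightarrow> 'a gword" is
  "\<lambda>u w. encode (lpower u w)"
  by (intro encode_cong lpower_cong)

lemma wconcat_assoc: "wconcat (wconcat u v) w = wconcat u (wconcat v w)"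
proof transfer
  fix u v w :: "(nat, 'a) lword"
  assume uvw: "word_iso u u" "word_iso v v" "word_iso w w"
  then have wf: "wf_lword u" "wf_lword v" "wf_lword w" by (auto simp: word_iso_def)
  let ?f = "\<lambda>x :: (nat + nat) + nat. case x of Inl (Inl p) \<Rightarrow> Inl p
     | Inl (Inr p) \<Rightarrow> Inr (Inl p) | Inr p \<Rightarrow> Inr (Inr p)"
  have "is_iso ?f (lconcat (lconcat u v) w) (lconcat u (lconcat v w))"
    unfolding is_iso_def
  proof (intro conjI)
    show "bij_betw ?f (positions (lconcat (lconcat u v) w)) (positions (lconcat u (lconcat v w)))"
      by (rule bij_betw_byWitness[where f' = "\<lambda>x. case x of Inl p \<Rightarrow> Inl (Inl p)
            | Inr (Inl p) \<Rightarrow> Inl (Inr p) | Inr (Inr p) \<Rightarrow> Inr p"])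
        (auto simp: lconcat_def)
  qed (auto simp: lconcat_sel split: sum.splits)
  then have "word_iso (lconcat (lconcat u v) w) (lconcat u (lconcat v w))"
    by (rule word_isoI) (intro lconcat_wf wf)+
  moreover have "word_iso (lconcat (encode (lconcat u v)) w) (lconcat (lconcat u v) w)"
    "word_iso (lconcat u (lconcat v w)) (lconcat u (encode (lconcat v w)))"
    by (intro lconcat_cong word_iso_sym[OF word_iso_encode] word_iso_encode lconcat_wf wf uvw)+
  ultimately show "word_iso (encode (lconcat (encode (lconcat u v)) w))
      (encode (lconcat u (encode (lconcat v w))))"
    by (meson encode_cong word_iso_trans)
qed

text \<open>Order types are countable linear orders up to isomorphism, that is, words over a
  one-letter alphabet; sums of order types are then concatenations and \<^term>\<open>wpower s t\<close> is
  \<open>t\<close> copies of \<open>s\<close>.\<close>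
type_synonym order_type = "unit gword"

lift_definition order_type_of :: "'t::{countable, linorder} set \<Rightarrow> order_type" is
  "\<lambda>S. encode \<lparr>positions = S, leq = {(p, q). p \<in> S \<and> q \<in> S \<and> p \<le> q}, label = (\<lambda>_. ())\<rparr>"
  by (rule encode_cong, rule word_iso_refl, rule wf_lwordI) auto

definition rho :: order_type where
  "rho = wconcat
           (wconcat (order_type_of (UNIV :: nat set))
                    (wpower (order_type_of (UNIV :: int set)) (order_type_of (UNIV :: rat set))))
           (order_type_of {..<0 :: int})"

definition word_of :: "order_type \<Rightarrow> 'a piterm \<Rightarrow> 'a gword" where
  "word_of \<tau> = (THE h. pi_morphism UNIV wconcat (\<lambda>u. wpower u \<tau>) h \<and> (\<forall>a. h (Letter a) = wsingle a))"

lemma word_of_morphism: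
  fixes \<tau> :: order_type
  shows "pi_morphism UNIV wconcat (\<lambda>u. wpower u \<tau>) (word_of \<tau> :: 'a piterm \<Rightarrow> 'a gword) \<and>
     (\<forall>a::'a. word_of \<tau> (Letter a) = wsingle a)"
proof -
  have "pi_algebra (UNIV :: 'a gword set) wconcat (\<lambda>u. wpower u \<tau>)"
    by (simp add: pi_algebra_def wconcat_assoc)
  then have "\<exists>!h. pi_morphism UNIV wconcat (\<lambda>u. wpower u \<tau>) h \<and> (\<forall>a::'a. h (Letter a) = wsingle a)"
    by (rule piterm_free) simp
  from theI'[OF this] show ?thesis unfolding word_of_def .
qed

definition of_list :: "'a list \<Rightarrow> (nat, 'a) lword" where
  "of_list xs = \<lparr>positions = {1..length xs},
     leq = {(i, j). 1 \<le> i \<and> i \<le> j \<and> j \<le> length xs}, label = (\<lambda>i. xs ! (i - 1))\<rparr>"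


section \<open>First-order logic\<close>

datatype ('a, 'v) fm =
    Top | Bot | IsEmpty
  | Equal 'v 'v | Label 'v 'a | Less 'v 'v | LessEq 'v 'v | Succ 'v 'v | IsMin 'v | IsMax 'v
  | Neg "('a, 'v) fm" | Disj "('a, 'v) fm" "('a, 'v) fm" | Conj "('a, 'v) fm" "('a, 'v) fm"
  | Exists 'v "('a, 'v) fm" | Forall 'v "('a, 'v) fm"

primrec FV :: "('a, 'v) fm \<Rightarrow> 'v set" where
  "FV Top = {}" | "FV Bot = {}" | "FV IsEmpty = {}"
| "FV (Equal x y) = {x, y}" | "FV (Label x a) = {x}"
| "FV (Less x y) = {x, y}" | "FV (LessEq x y) = {x, y}" | "FV (Succ x y) = {x, y}"
| "FV (IsMin x) = {x}" | "FV (IsMax x) = {x}"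
| "FV (Neg \<phi>) = FV \<phi>"
| "FV (Disj \<phi> \<psi>) = FV \<phi> \<union> FV \<psi>" | "FV (Conj \<phi> \<psi>) = FV \<phi> \<union> FV \<psi>"
| "FV (Exists x \<phi>) = FV \<phi> - {x}" | "FV (Forall x \<phi>) = FV \<phi> - {x}"

primrec is_atom :: "('a, 'v) fm \<Rightarrow> bool" where
  "is_atom Top = True" | "is_atom Bot = True" | "is_atom IsEmpty = True"
| "is_atom (Equal x y) = True" | "is_atom (Label x a) = True"
| "is_atom (Less x y) = True" | "is_atom (LessEq x y) = True" | "is_atom (Succ x y) = True"
| "is_atom (IsMin x) = True" | "is_atom (IsMax x) = True"
| "is_atom (Neg \<phi>) = False" | "is_atom (Disj \<phi> \<psi>) = False" | "is_atom (Conj \<phi> \<psi>) = False"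
| "is_atom (Exists x \<phi>) = False" | "is_atom (Forall x \<phi>) = False"

definition is_literal :: "('a, 'v) fm \<Rightarrow> bool" where
  "is_literal \<phi> \<longleftrightarrow> is_atom \<phi> \<or> (\<exists>\<psi>. is_atom \<psi> \<and> \<phi> = Neg \<psi>)"

primrec no_suc_min_max_empty :: "('a, 'v) fm \<Rightarrow> bool" where
  "no_suc_min_max_empty Top = True" | "no_suc_min_max_empty Bot = True"
| "no_suc_min_max_empty IsEmpty = False"
| "no_suc_min_max_empty (Equal x y) = True" | "no_suc_min_max_empty (Label x a) = True"
| "no_suc_min_max_empty (Less x y) = True" | "no_suc_min_max_empty (LessEq x y) = True"
| "no_suc_min_max_empty (Succ x y) = False"
| "no_suc_min_max_empty (IsMin x) = False" | "no_suc_min_max_empty (IsMax x) = False"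
| "no_suc_min_max_empty (Neg \<phi>) = no_suc_min_max_empty \<phi>"
| "no_suc_min_max_empty (Disj \<phi> \<psi>) = (no_suc_min_max_empty \<phi> \<and> no_suc_min_max_empty \<psi>)"
| "no_suc_min_max_empty (Conj \<phi> \<psi>) = (no_suc_min_max_empty \<phi> \<and> no_suc_min_max_empty \<psi>)"
| "no_suc_min_max_empty (Exists x \<phi>) = no_suc_min_max_empty \<phi>"
| "no_suc_min_max_empty (Forall x \<phi>) = no_suc_min_max_empty \<phi>"

text \<open>An \<open>X\<close>-valuation is a word with a partial map of domain \<open>X\<close>. Satisfaction is meaningful when
  the free variables lie in this domain.\<close>
primrec sat :: "('p, 'a) lword \<Rightarrow> ('v \<rightharpoonup> 'p) \<Rightarrow> ('a, 'v) fm \<Rightarrow> bool" where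
  "sat u \<alpha> Top \<longleftrightarrow> True"
| "sat u \<alpha> Bot \<longleftrightarrow> False"
| "sat u \<alpha> IsEmpty \<longleftrightarrow> positions u = {}"
| "sat u \<alpha> (Equal x y) \<longleftrightarrow> the (\<alpha> x) = the (\<alpha> y)"
| "sat u \<alpha> (Label x a) \<longleftrightarrow> label u (the (\<alpha> x)) = a"
| "sat u \<alpha> (Less x y) \<longleftrightarrow> (the (\<alpha> x), the (\<alpha> y)) \<in> leq u \<and> the (\<alpha> x) \<noteq> the (\<alpha> y)"
| "sat u \<alpha> (LessEq x y) \<longleftrightarrow> (the (\<alpha> x), the (\<alpha> y)) \<in> leq u"
| "sat u \<alpha> (Succ x y) \<longleftrightarrow> (the (\<alpha> x), the (\<alpha> y)) \<in> leq u \<and> the (\<alpha> x) \<noteq> the (\<alpha> y) \<and>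
     \<not> (\<exists>p\<in>positions u. p \<noteq> the (\<alpha> x) \<and> p \<noteq> the (\<alpha> y) \<and>
          (the (\<alpha> x), p) \<in> leq u \<and> (p, the (\<alpha> y)) \<in> leq u)"
| "sat u \<alpha> (IsMin x) \<longleftrightarrow> (\<forall>p\<in>positions u. (the (\<alpha> x), p) \<in> leq u)"
| "sat u \<alpha> (IsMax x) \<longleftrightarrow> (\<forall>p\<in>positions u. (p, the (\<alpha> x)) \<in> leq u)"
| "sat u \<alpha> (Neg \<phi>) \<longleftrightarrow> \<not> sat u \<alpha> \<phi>"
| "sat u \<alpha> (Disj \<phi> \<psi>) \<longleftrightarrow> sat u \<alpha> \<phi> \<or> sat u \<alpha> \<psi>"
| "sat u \<alpha> (Conj \<phi> \<psi>) \<longleftrightarrow> sat u \<alpha> \<phi> \<and> sat u \<alpha> \<psi>"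
| "sat u \<alpha> (Exists x \<phi>) \<longleftrightarrow> (\<exists>p\<in>positions u. sat u (\<alpha>(x \<mapsto> p)) \<phi>)"
| "sat u \<alpha> (Forall x \<phi>) \<longleftrightarrow> (\<forall>p\<in>positions u. sat u (\<alpha>(x \<mapsto> p)) \<phi>)"

definition sentence :: "('a, 'v) fm \<Rightarrow> bool" where
  "sentence \<phi> \<longleftrightarrow> FV \<phi> = {}"

definition lang :: "'a set \<Rightarrow> ('a, 'v) fm \<Rightarrow> 'a list set" where
  "lang A \<phi> = {w \<in> lists A. sat (of_list w) Map.empty \<phi>}"


section \<open>Syntactic monoids\<close>

definition synt_eq :: "'a set \<Rightarrow> 'a list set \<Rightarrow> ('a list \<times> 'a list) set" where
  "synt_eq A L = {(u, v). u \<in> lists A \<and> v \<in> lists A \<and>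
     (\<forall>x\<in>lists A. \<forall>y\<in>lists A. x @ u @ y \<in> L \<longleftrightarrow> x @ v @ y \<in> L)}"

definition synt_monoid :: "'a set \<Rightarrow> 'a list set \<Rightarrow> 'a list set monoid" where
  "synt_monoid A L = \<lparr>carrier = lists A // synt_eq A L,
     mult = (\<lambda>U V. \<Union>u\<in>U. \<Union>v\<in>V. synt_eq A L `` {u @ v}),
     one = synt_eq A L `` {[]}\<rparr>"

lemma synt_eq_equiv: "equiv (lists A) (synt_eq A L)"
  by (rule equivI) (auto simp: synt_eq_def refl_on_def sym_def trans_def)

lemma synt_eq_congruent: "(\<lambda>u v. synt_eq A L `` {u @ v}) respects2 synt_eq A L"
proof (rule congruent2I')
  fix u u' v v' assume u: "(u, u') \<in> synt_eq A L" and v: "(v, v') \<in> synt_eq A L"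
  have "x @ (u @ v) @ y \<in> L \<longleftrightarrow> x @ (u' @ v') @ y \<in> L" if "x \<in> lists A" "y \<in> lists A" for x y
  proof -
    have "x @ u @ (v @ y) \<in> L \<longleftrightarrow> x @ u' @ (v @ y) \<in> L"
      using u v that by (simp add: synt_eq_def)
    moreover have "(x @ u') @ v @ y \<in> L \<longleftrightarrow> (x @ u') @ v' @ y \<in> L"
      using u v that append_in_lists_conv[of x u' A] by (simp add: synt_eq_def del: append_assoc)
    ultimately show ?thesis by simp
  qed
  then have "(u @ v, u' @ v') \<in> synt_eq A L"
    using u v unfolding synt_eq_def by auto
  then show "synt_eq A L `` {u @ v} = synt_eq A L `` {u' @ v'}"
    by (rule equiv_class_eq[OF synt_eq_equiv])
qed

lemma synt_mult_class:
  assumes "u \<in> lists A" "v \<in> lists A"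
  shows "synt_eq A L `` {u} \<otimes>\<^bsub>synt_monoid A L\<^esub> synt_eq A L `` {v} = synt_eq A L `` {u @ v}"
  using UN_equiv_class2[OF synt_eq_equiv synt_eq_equiv synt_eq_congruent assms]
  by (simp add: synt_monoid_def)

lemma synt_monoid_monoid: "monoid (synt_monoid A L)"
proof -
  have c: "U \<in> carrier (synt_monoid A L) \<longleftrightarrow> (\<exists>u\<in>lists A. U = synt_eq A L `` {u})" for U
    by (auto simp: synt_monoid_def quotient_def)
  have o: "one (synt_monoid A L) = synt_eq A L `` {[]}"
    by (simp add: synt_monoid_def)
  show ?thesis
  proof (rule monoidI)
    fix U V assume "U \<in> carrier (synt_monoid A L)" "V \<in> carrier (synt_monoid A L)"
    then obtain u v where *: "u \<in> lists A" "v \<in> lists A"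
      "U = synt_eq A L `` {u}" "V = synt_eq A L `` {v}" by (auto simp only: c)
    then have "u @ v \<in> lists A" by (simp only: append_in_lists_conv)
    then show "U \<otimes>\<^bsub>synt_monoid A L\<^esub> V \<in> carrier (synt_monoid A L)"
      unfolding *(3,4) synt_mult_class[OF *(1,2)] c by blast
  next
    show "\<one>\<^bsub>synt_monoid A L\<^esub> \<in> carrier (synt_monoid A L)" unfolding c o by blast
  next
    fix U V W assume "U \<in> carrier (synt_monoid A L)" "V \<in> carrier (synt_monoid A L)"
      "W \<in> carrier (synt_monoid A L)"
    then obtain u v w where *: "u \<in> lists A" "v \<in> lists A" "w \<in> lists A"
      "U = synt_eq A L `` {u}" "V = synt_eq A L `` {v}" "W = synt_eq A L `` {w}"
      by (auto simp only: c)
    then have "u @ v \<in> lists A" "v @ w \<in> lists A" by (simp_all only: append_in_lists_conv)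
    then show "U \<otimes>\<^bsub>synt_monoid A L\<^esub> V \<otimes>\<^bsub>synt_monoid A L\<^esub> W =
        U \<otimes>\<^bsub>synt_monoid A L\<^esub> (V \<otimes>\<^bsub>synt_monoid A L\<^esub> W)"
      using * by (simp only: synt_mult_class append_assoc)
  next
    fix U assume "U \<in> carrier (synt_monoid A L)"
    then obtain u where u: "u \<in> lists A" "U = synt_eq A L `` {u}" by (auto simp only: c)
    show "\<one>\<^bsub>synt_monoid A L\<^esub> \<otimes>\<^bsub>synt_monoid A L\<^esub> U = U"
      unfolding o u(2) using synt_mult_class[OF lists.Nil u(1)] by simp
    show "U \<otimes>\<^bsub>synt_monoid A L\<^esub> \<one>\<^bsub>synt_monoid A L\<^esub> = U"
      unfolding o u(2) using synt_mult_class[OF u(1) lists.Nil] by simp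
  qed
qed


section \<open>Fragments\<close>

text \<open>A formula with exactly one occurrence of the placeholder predicate.\<close>
datatype ('a, 'v) ctxt =
    Hole
  | CNeg "('a, 'v) ctxt"
  | CDisjL "('a, 'v) ctxt" "('a, 'v) fm" | CDisjR "('a, 'v) fm" "('a, 'v) ctxt"
  | CConjL "('a, 'v) ctxt" "('a, 'v) fm" | CConjR "('a, 'v) fm" "('a, 'v) ctxt"
  | CExists 'v "('a, 'v) ctxt" | CForall 'v "('a, 'v) ctxt"

primrec fill :: "('a, 'v) ctxt \<Rightarrow> ('a, 'v) fm \<Rightarrow> ('a, 'v) fm" where
  "fill Hole \<phi> = \<phi>"
| "fill (CNeg \<mu>) \<phi> = Neg (fill \<mu> \<phi>)"
| "fill (CDisjL \<mu> \<psi>) \<phi> = Disj (fill \<mu> \<phi>) \<psi>"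
| "fill (CDisjR \<psi> \<mu>) \<phi> = Disj \<psi> (fill \<mu> \<phi>)"
| "fill (CConjL \<mu> \<psi>) \<phi> = Conj (fill \<mu> \<phi>) \<psi>"
| "fill (CConjR \<psi> \<mu>) \<phi> = Conj \<psi> (fill \<mu> \<phi>)"
| "fill (CExists x \<mu>) \<phi> = Exists x (fill \<mu> \<phi>)"
| "fill (CForall x \<mu>) \<phi> = Forall x (fill \<mu> \<phi>)"

definition fragment :: "('a, 'v) fm set \<Rightarrow> bool" where
  "fragment F \<longleftrightarrow> F \<noteq> {} \<and>
     (\<forall>\<mu> \<phi>. fill \<mu> \<phi> \<in> F \<longrightarrow>
        fill \<mu> Top \<in> F \<and> fill \<mu> Bot \<in> F \<and> (\<forall>x a. fill \<mu> (Label x a) \<in> F)) \<and>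
     (\<forall>\<mu> \<phi> \<psi>. fill \<mu> (Disj \<phi> \<psi>) \<in> F \<longleftrightarrow> fill \<mu> \<phi> \<in> F \<and> fill \<mu> \<psi> \<in> F) \<and>
     (\<forall>\<mu> \<phi> \<psi>. fill \<mu> (Conj \<phi> \<psi>) \<in> F \<longleftrightarrow> fill \<mu> \<phi> \<in> F \<and> fill \<mu> \<psi> \<in> F) \<and>
     (\<forall>\<mu> \<phi>. fill \<mu> (Neg (Neg \<phi>)) \<in> F \<longrightarrow> fill \<mu> \<phi> \<in> F) \<and>
     (\<forall>\<mu> x \<phi>. fill \<mu> (Exists x \<phi>) \<in> F \<longrightarrow> x \<notin> FV \<phi> \<longrightarrow> fill \<mu> \<phi> \<in> F) \<and>
     (\<forall>\<mu> x \<phi>. fill \<mu> (Forall x \<phi>) \<in> F \<longrightarrow> x \<notin> FV \<phi> \<longrightarrow> fill \<mu> \<phi> \<in> F)"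

definition order_stable :: "('a, 'v) fm set \<Rightarrow> bool" where
  "order_stable F \<longleftrightarrow> (\<forall>\<mu> x y. fill \<mu> (Less x y) \<in> F \<longleftrightarrow> fill \<mu> (LessEq x y) \<in> F)"


section \<open>The game\<close>

datatype quantifier = QExists | QForall | QNegExists | QNegForall

fun quantify :: "quantifier \<Rightarrow> 'v \<Rightarrow> ('a, 'v) fm \<Rightarrow> ('a, 'v) fm" where
  "quantify QExists x \<phi> = Exists x \<phi>"
| "quantify QForall x \<phi> = Forall x \<phi>"
| "quantify QNegExists x \<phi> = Neg (Exists x \<phi>)"
| "quantify QNegForall x \<phi> = Neg (Forall x \<phi>)"

definition reduct :: "('a, 'v) fm set \<Rightarrow> quantifier \<Rightarrow> 'v \<Rightarrow> ('a, 'v) fm set" where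
  "reduct F Q x = {\<phi>. quantify Q x \<phi> \<in> F}"

type_synonym ('p, 'a, 'v) valuation = "('p, 'a) lword \<times> ('v \<rightharpoonup> 'p)"
type_synonym ('p, 'a, 'v) config =
  "('a, 'v) fm set \<times> ('p, 'a, 'v) valuation \<times> ('p, 'a, 'v) valuation"
type_synonym ('p, 'v) move = "quantifier \<times> 'v \<times> 'p"

fun spoiler_wins_now :: "('p, 'a, 'v) config \<Rightarrow> bool" where
  "spoiler_wins_now (G, (u, \<alpha>), (v, \<beta>)) \<longleftrightarrow>
     (\<exists>\<phi>\<in>G. is_literal \<phi> \<and> FV \<phi> \<subseteq> dom \<alpha> \<and> FV \<phi> \<subseteq> dom \<beta> \<and> sat u \<alpha> \<phi> \<and> \<not> sat v \<beta> \<phi>)"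

fun spoiler_move :: "('p, 'a, 'v) config \<Rightarrow> ('p, 'v) move \<Rightarrow> bool" where
  "spoiler_move (G, (u, \<alpha>), (v, \<beta>)) (Q, x, q) \<longleftrightarrow>
     reduct G Q x \<noteq> {} \<and>
     q \<in> (if Q \<in> {QExists, QNegForall} then positions u else positions v)"

fun duplicator_move :: "('p, 'a, 'v) config \<Rightarrow> ('p, 'v) move \<Rightarrow> 'p \<Rightarrow> bool" where
  "duplicator_move (G, (u, \<alpha>), (v, \<beta>)) (Q, x, q) r \<longleftrightarrow>
     r \<in> (if Q \<in> {QExists, QNegForall} then positions v else positions u)"

fun next_config :: "('p, 'a, 'v) config \<Rightarrow> ('p, 'v) move \<Rightarrow> 'p \<Rightarrow> ('p, 'a, 'v) config" where
  "next_config (G, (u, \<alpha>), (v, \<beta>)) (Q, x, q) r =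
     (reduct G Q x,
      (case Q of
         QExists \<Rightarrow> ((u, \<alpha>(x \<mapsto> q)), (v, \<beta>(x \<mapsto> r)))
       | QForall \<Rightarrow> ((u, \<alpha>(x \<mapsto> r)), (v, \<beta>(x \<mapsto> q)))
       | QNegExists \<Rightarrow> ((v, \<beta>(x \<mapsto> q)), (u, \<alpha>(x \<mapsto> r)))
       | QNegForall \<Rightarrow> ((v, \<beta>(x \<mapsto> r)), (u, \<alpha>(x \<mapsto> q)))))"

type_synonym ('p, 'v) history = "(('p, 'v) move \<times> 'p) list"
type_synonym ('p, 'v) strategy = "('p, 'v) history \<Rightarrow> ('p, 'v) move \<Rightarrow> 'p"

text \<open>\<open>consistent \<sigma> c\<^sub>0 h c\<close>: starting from \<open>c\<^sub>0\<close>, the rounds \<open>h\<close>, in which Duplicator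
  answers according to \<open>\<sigma>\<close>, can be played and lead to \<open>c\<close>.\<close>
inductive consistent ::
  "('p, 'v) strategy \<Rightarrow> ('p, 'a, 'v) config \<Rightarrow> ('p, 'v) history \<Rightarrow> ('p, 'a, 'v) config \<Rightarrow> bool"
  for \<sigma> c0 where
  start: "consistent \<sigma> c0 [] c0"
| round: "consistent \<sigma> c0 h c \<Longrightarrow> \<not> spoiler_wins_now c \<Longrightarrow> spoiler_move c m \<Longrightarrow>
     duplicator_move c m (\<sigma> h m) \<Longrightarrow>
     consistent \<sigma> c0 (h @ [(m, \<sigma> h m)]) (next_config c m (\<sigma> h m))"

text \<open>Infinite plays, and plays in which Spoiler is stuck, are won by Duplicator. So a strategy is
  winning iff no finite play consistent with it reaches a configuration where Spoiler wins at once
  and it always prescribes a legal answer.\<close>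
definition winning_strategy :: "('p, 'v) strategy \<Rightarrow> ('p, 'a, 'v) config \<Rightarrow> bool" where
  "winning_strategy \<sigma> c0 \<longleftrightarrow>
     (\<forall>h c. consistent \<sigma> c0 h c \<longrightarrow>
        \<not> spoiler_wins_now c \<and>
        (\<forall>m. spoiler_move c m \<longrightarrow> duplicator_move c m (\<sigma> h m)))"

definition duplicator_wins :: "('p, 'a, 'v) config \<Rightarrow> bool" where
  "duplicator_wins c \<longleftrightarrow> (\<exists>\<sigma>. winning_strategy \<sigma> c)"

lemma duplicator_wins_iff:
  "duplicator_wins c0 \<longleftrightarrow>
     (\<exists>W. c0 \<in> W \<and> (\<forall>c\<in>W. \<not> spoiler_wins_now c \<and>
        (\<forall>m. spoiler_move c m \<longrightarrow> (\<exists>r. duplicator_move c m r \<and> next_config c m r \<in> W))))"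
    (is "_ \<longleftrightarrow> (\<exists>W. c0 \<in> W \<and> ?safe W)")
proof
  assume "duplicator_wins c0"
  then obtain \<sigma> where \<sigma>: "winning_strategy \<sigma> c0" by (auto simp: duplicator_wins_def)
  have "c0 \<in> {c. \<exists>h. consistent \<sigma> c0 h c}" using consistent.start by blast
  moreover have "?safe {c. \<exists>h. consistent \<sigma> c0 h c}"
  proof
    fix c assume "c \<in> {c. \<exists>h. consistent \<sigma> c0 h c}"
    then obtain h where h: "consistent \<sigma> c0 h c" by blast
    then have c: "\<not> spoiler_wins_now c" "\<And>m. spoiler_move c m \<Longrightarrow> duplicator_move c m (\<sigma> h m)"
      using \<sigma> unfolding winning_strategy_def by blast+
    then have "consistent \<sigma> c0 (h @ [(m, \<sigma> h m)]) (next_config c m (\<sigma> h m))"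
      if "spoiler_move c m" for m
      using consistent.round[OF h c(1) that] that by simp
    with c show "\<not> spoiler_wins_now c \<and> (\<forall>m. spoiler_move c m \<longrightarrow>
        (\<exists>r. duplicator_move c m r \<and> next_config c m r \<in> {c. \<exists>h. consistent \<sigma> c0 h c}))"
      by blast
  qed
  ultimately show "\<exists>W. c0 \<in> W \<and> ?safe W" by (intro exI conjI)
next
  assume "\<exists>W. c0 \<in> W \<and> ?safe W"
  then obtain W where W: "c0 \<in> W" "?safe W" by blast
  define ans where "ans c m = (SOME r. duplicator_move c m r \<and> next_config c m r \<in> W)" for c m
  have ans: "duplicator_move c m (ans c m) \<and> next_config c m (ans c m) \<in> W"
    if "c \<in> W" "spoiler_move c m" for c m
    unfolding ans_def by (rule someI_ex) (use W that in blast)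
  define cfg where "cfg h = foldl (\<lambda>c (m, r). next_config c m r) c0 h" for h
  define \<sigma> where "\<sigma> h m = ans (cfg h) m" for h m
  have "consistent \<sigma> c0 h c \<Longrightarrow> c = cfg h \<and> c \<in> W" for h c
  proof (induction rule: consistent.induct)
    case start
    show ?case using W by (simp add: cfg_def)
  next
    case (round h c m)
    then have c: "c = cfg h" "c \<in> W" by blast+
    have "next_config c m (\<sigma> h m) = cfg (h @ [(m, \<sigma> h m)])"
      unfolding c(1) cfg_def by simp
    moreover have "next_config c m (\<sigma> h m) \<in> W"
      using ans[OF c(2) round.hyps(3)] unfolding c(1) \<sigma>_def by blast
    ultimately show ?case by simp
  qed
  then have "winning_strategy \<sigma> c0"
    unfolding winning_strategy_def using W ans by (metis \<sigma>_def)
  then show "duplicator_wins c0" by (auto simp: duplicator_wins_def)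
qed

lemma sat_iso:
  assumes f: "is_iso f u v"
  shows "ran \<alpha> \<subseteq> positions u \<Longrightarrow> FV \<phi> \<subseteq> dom \<alpha> \<Longrightarrow> sat v (map_option f \<circ> \<alpha>) \<phi> \<longleftrightarrow> sat u \<alpha> \<phi>"
proof (induction \<phi> arbitrary: \<alpha>)
  have im: "positions v = f ` positions u" and inj: "inj_on f (positions u)"
    using f by (auto simp: is_iso_def bij_betw_def)
  have le: "(f p, f q) \<in> leq v \<longleftrightarrow> (p, q) \<in> leq u" "f p = f q \<longleftrightarrow> p = q"
    if "p \<in> positions u" "q \<in> positions u" for p q
    using f inj that unfolding is_iso_def by (auto dest: inj_onD)
  have lab: "label v (f p) = label u p" if "p \<in> positions u" for p
    using f that unfolding is_iso_def by auto
  have ex: "\<exists>p. \<alpha> x = Some p \<and> p \<in> positions u"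
    if "ran \<alpha> \<subseteq> positions u" "x \<in> dom \<alpha>" for x and \<alpha> :: "'d \<rightharpoonup> 'a"
    using that by (auto simp: ran_def)
  have upd: "map_option f \<circ> \<alpha>(x \<mapsto> p) = (map_option f \<circ> \<alpha>)(x \<mapsto> f p)" for x p and \<alpha> :: "'d \<rightharpoonup> 'a"
    by (auto simp: fun_eq_iff)
  have ran: "ran (\<alpha>(x \<mapsto> p)) \<subseteq> positions u" if "ran \<alpha> \<subseteq> positions u" "p \<in> positions u"
    for x p and \<alpha> :: "'d \<rightharpoonup> 'a"
    using that by (auto simp: ran_def)
  {
    case IsEmpty then show ?case by (simp add: im)
  next
    case (Equal x y) then show ?case using ex[of \<alpha> x] ex[of \<alpha> y] by (auto simp: le)
  next
    case (Label x a) then show ?case using ex[of \<alpha> x] by (auto simp: lab)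
  next
    case (Less x y) then show ?case using ex[of \<alpha> x] ex[of \<alpha> y] by (auto simp: le)
  next
    case (LessEq x y) then show ?case using ex[of \<alpha> x] ex[of \<alpha> y] by (auto simp: le)
  next
    case (Succ x y) then show ?case using ex[of \<alpha> x] ex[of \<alpha> y] by (auto simp: le im)
  next
    case (IsMin x) then show ?case using ex[of \<alpha> x] by (auto simp: le im)
  next
    case (IsMax x) then show ?case using ex[of \<alpha> x] by (auto simp: le im)
  next
    case (Exists x \<phi>)
    have "sat v ((map_option f \<circ> \<alpha>)(x \<mapsto> f p)) \<phi> \<longleftrightarrow> sat u (\<alpha>(x \<mapsto> p)) \<phi>"
      if "p \<in> positions u" for p
      unfolding upd[symmetric] using Exists.prems that by (intro Exists.IH ran) auto
    then show ?case unfolding sat.simps im by blast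
  next
    case (Forall x \<phi>)
    have "sat v ((map_option f \<circ> \<alpha>)(x \<mapsto> f p)) \<phi> \<longleftrightarrow> sat u (\<alpha>(x \<mapsto> p)) \<phi>"
      if "p \<in> positions u" for p
      unfolding upd[symmetric] using Forall.prems that by (intro Forall.IH ran) auto
    then show ?case unfolding sat.simps im by blast
  }
qed auto

lemma duplicator_wins_iso_imp:
  fixes F :: "('a, 'v) fm set" and u v :: "('p, 'a) lword" and u' v' :: "('q, 'a) lword"
  assumes "is_iso f u u'" "is_iso g v v'" "duplicator_wins (F, (u, Map.empty), (v, Map.empty))"
  shows "duplicator_wins (F, (u', Map.empty), (v', Map.empty))"
proof -
  let ?safe = "\<lambda>W. \<forall>c\<in>W. \<not> spoiler_wins_now c \<and>
        (\<forall>m. spoiler_move c m \<longrightarrow> (\<exists>r. duplicator_move c m r \<and> next_config c m r \<in> W))"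
  obtain W where W: "(F, (u, Map.empty), (v, Map.empty)) \<in> W" "?safe W"
    using assms(3) unfolding duplicator_wins_iff by blast
  define W' :: "('q, 'a, 'v) config set" where "W' = {(G, (b, map_option f \<circ> \<alpha>), (d, map_option g \<circ> \<beta>)) | G a \<alpha> c \<beta> b d f g.
     (G, (a, \<alpha>), (c, \<beta>)) \<in> W \<and> is_iso f a b \<and> is_iso g c d \<and>
     ran \<alpha> \<subseteq> positions a \<and> ran \<beta> \<subseteq> positions c}"
  have "(F, (u', Map.empty), (v', Map.empty)) \<in> W'"
    unfolding W'_def using W(1) assms(1,2)
    by (intro CollectI exI[of _ F] exI[of _ u] exI[of _ Map.empty] exI[of _ v] exI[of _ u']
        exI[of _ v'] exI[of _ f] exI[of _ g]) auto
  moreover have "?safe W'"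
  proof
    fix e assume "e \<in> W'"
    then obtain G a \<alpha> c \<beta> b d f g where e: "e = (G, (b, map_option f \<circ> \<alpha>), (d, map_option g \<circ> \<beta>))"
      and in_W: "(G, (a, \<alpha>), (c, \<beta>)) \<in> W" and iso: "is_iso f a b" "is_iso g c d"
      and ran: "ran \<alpha> \<subseteq> positions a" "ran \<beta> \<subseteq> positions c"
      unfolding W'_def by blast
    have im: "positions b = f ` positions a" "positions d = g ` positions c"
      using iso by (auto simp: is_iso_def bij_betw_def)
    have ran': "ran (\<gamma>(x \<mapsto> p)) \<subseteq> S" if "ran \<gamma> \<subseteq> S" "p \<in> S" for x p S and \<gamma> :: "'v \<rightharpoonup> 'p"
      using that by (auto simp: ran_def)
    have W'I: "(H, (b, map_option f \<circ> \<gamma>), (d, map_option g \<circ> \<delta>)) \<in> W'"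
      if "(H, (a, \<gamma>), (c, \<delta>)) \<in> W" "ran \<gamma> \<subseteq> positions a" "ran \<delta> \<subseteq> positions c" for H \<gamma> \<delta>
      unfolding W'_def using that iso by blast
    have W'I': "(H, (d, map_option g \<circ> \<delta>), (b, map_option f \<circ> \<gamma>)) \<in> W'"
      if "(H, (c, \<delta>), (a, \<gamma>)) \<in> W" "ran \<gamma> \<subseteq> positions a" "ran \<delta> \<subseteq> positions c" for H \<gamma> \<delta>
      unfolding W'_def using that iso by blast
    have nw: "\<not> spoiler_wins_now (G, (a, \<alpha>), (c, \<beta>))" using W(2) in_W by blast
    have "\<not> spoiler_wins_now e"
    proof
      assume "spoiler_wins_now e"
      then obtain \<phi> where "\<phi> \<in> G" "is_literal \<phi>" "FV \<phi> \<subseteq> dom \<alpha>" "FV \<phi> \<subseteq> dom \<beta>"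
        "sat b (map_option f \<circ> \<alpha>) \<phi>" "\<not> sat d (map_option g \<circ> \<beta>) \<phi>"
        by (auto simp: e dom_def)
      then show False using nw sat_iso[OF iso(1) ran(1)] sat_iso[OF iso(2) ran(2)] by auto
    qed
    moreover have "\<exists>r. duplicator_move e m r \<and> next_config e m r \<in> W'" if m: "spoiler_move e m" for m
    proof -
      obtain Q x q' where mq: "m = (Q, x, q')" by (cases m)
      let ?left = "Q \<in> {QExists, QNegForall}"
      obtain q where q: "q' = (if ?left then f q else g q)"
        and qpos: "q \<in> (if ?left then positions a else positions c)"
        and ne: "reduct G Q x \<noteq> {}"
        using m unfolding e mq spoiler_move.simps im by (auto split: if_splits)
      have "spoiler_move (G, (a, \<alpha>), (c, \<beta>)) (Q, x, q)" using ne qpos by simp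
      then obtain r where r: "duplicator_move (G, (a, \<alpha>), (c, \<beta>)) (Q, x, q) r"
        "next_config (G, (a, \<alpha>), (c, \<beta>)) (Q, x, q) r \<in> W"
        using W(2) in_W by blast
      let ?r = "if ?left then g r else f r"
      have "duplicator_move e m ?r" using r(1) by (auto simp: e mq im)
      moreover have "next_config e m ?r \<in> W'"
      proof (cases Q)
        case QExists
        then have "next_config e m ?r = (reduct G Q x, (b, map_option f \<circ> \<alpha>(x \<mapsto> q)), (d, map_option g \<circ> \<beta>(x \<mapsto> r)))"
          by (simp add: e mq q fun_eq_iff)
        moreover have "\<dots> \<in> W'"
          by (rule W'I; (rule ran')?) (use r qpos ran QExists in simp_all)
        ultimately show ?thesis by simp
        next
        case QForall
        then have "next_config e m ?r = (reduct G Q x, (b, map_option f \<circ> \<alpha>(x \<mapsto> r)), (d, map_option g \<circ> \<beta>(x \<mapsto> q)))"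
          by (simp add: e mq q fun_eq_iff)
        moreover have "\<dots> \<in> W'"
          by (rule W'I; (rule ran')?) (use r qpos ran QForall in simp_all)
        ultimately show ?thesis by simp
        next
        case QNegExists
        then have "next_config e m ?r = (reduct G Q x, (d, map_option g \<circ> \<beta>(x \<mapsto> q)), (b, map_option f \<circ> \<alpha>(x \<mapsto> r)))"
          by (simp add: e mq q fun_eq_iff)
        moreover have "\<dots> \<in> W'"
          by (rule W'I'; (rule ran')?) (use r qpos ran QNegExists in simp_all)
        ultimately show ?thesis by simp
        next
        case QNegForall
        then have "next_config e m ?r = (reduct G Q x, (d, map_option g \<circ> \<beta>(x \<mapsto> r)), (b, map_option f \<circ> \<alpha>(x \<mapsto> q)))"
          by (simp add: e mq q fun_eq_iff)
        moreover have "\<dots> \<in> W'"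
          by (rule W'I'; (rule ran')?) (use r qpos ran QNegForall in simp_all)
        ultimately show ?thesis by simp
      qed
      ultimately show ?thesis by blast
    qed
    ultimately show "\<not> spoiler_wins_now e \<and>
        (\<forall>m. spoiler_move e m \<longrightarrow> (\<exists>r. duplicator_move e m r \<and> next_config e m r \<in> W'))" by blast
  qed
  ultimately show ?thesis unfolding duplicator_wins_iff by (intro exI conjI)
qed

text \<open>The game on words is played on arbitrary representatives of the isomorphism classes.\<close>
lift_definition duplicator_wins_game :: "('a, 'v) fm set \<Rightarrow> 'a gword \<Rightarrow> 'a gword \<Rightarrow> bool" is
  "\<lambda>F u v. duplicator_wins (F, (u, Map.empty), (v, Map.empty))"
proof (rule iffI)
  fix F :: "('a, 'v) fm set" and u u' v v' :: "(nat, 'a) lword"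
  assume *: "word_iso u u'" "word_iso v v'"
  then obtain f g f' g' where "is_iso f u u'" "is_iso g v v'" "is_iso f' u' u" "is_iso g' v' v"
    using word_iso_sym unfolding word_iso_def by metis
  then show "duplicator_wins (F, (u, Map.empty), (v, Map.empty)) \<Longrightarrow>
      duplicator_wins (F, (u', Map.empty), (v', Map.empty))"
    and "duplicator_wins (F, (u', Map.empty), (v', Map.empty)) \<Longrightarrow>
      duplicator_wins (F, (u, Map.empty), (v, Map.empty))"
    using duplicator_wins_iso_imp by blast+
qed

end

theory Submission
  imports Defs "HOL-Library.Product_Lexorder" "HOL-Library.Infinite_Set"
begin

text \<open>The order type \<open>\<rho>\<close> is that of an open interval of \<open>\<rat> \<times> \<int>\<close> in lexicographic order, and so is
  each finite order type. An Ehrenfeucht--Fraisse argument with truncated distances shows that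
  \<open>\<rho>\<close> and a large \<open>n\<close> agree on all formulas of quantifier depth \<open>k\<close>, and that \<open>\<rho>\<close> is saturated:
  every sequence of positions has a position whose type over finitely many parameters is a limit
  point of the types of the sequence. Both properties pass to the words \<open>[[t]]\<^sub>\<rho>\<close> by composition.

  If the identity holds in the syntactic monoids, then \<open>[[s]]\<^sub>n\<close> and \<open>[[t]]\<^sub>n\<close>, hence \<open>[[s]]\<^sub>\<rho>\<close> and
  \<open>[[t]]\<^sub>\<rho>\<close>, satisfy the same sentences of the fragment, and by saturation Duplicator can preserve
  all formulas of the current fragment forever. Conversely, a syntactic monoid of a definable
  language is aperiodic, so that its power operation is an \<open>n\<close>-th power; a winning strategy lifts
  from \<open>([[s]]\<^sub>\<rho>, [[t]]\<^sub>\<rho>)\<close> to the words obtained by substituting finite words for letters and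
  adding a context. There order-stability is needed to compare positions within one block.\<close>

section \<open>Back-and-forth equivalence\<close>

text \<open>A fragment need not be closed under negation, so the game and its invariants preserve
  truth in one direction only; the symmetric \<open>back_forth\<close> serves to compare words with
  their approximations and types within one word. Agreement on every sentence alone would not win
  the game: the number of rounds is unbounded, and a single answer must serve formulas of every
  depth at once. The shape of rho supplies the required limits explicitly: a sequence drifting away
  from finitely many parameters converges to a point in a copy of the integers strictly between
  theirs, and density of the rationals leaves room for one. The constant \<open>2 ^ k\<close> arises
  because a new point in a gap known up to \<open>2 * m\<close> can be copied with both parts right
  up to \<open>m\<close>, so each round halves the precision. With \<open>k\<close> the quantifier
  depth, the same number is the exponent that makes powers idempotent. Conversely, morphisms send
  letters to arbitrary words, so a game on blocks must decide comparisons of offsets: a strict atom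
  between offsets in one block may call for the weak order of blocks.\<close>

definition part_iso :: "('p, 'a) lword \<Rightarrow> ('q, 'a) lword \<Rightarrow> ('p \<times> 'q) set \<Rightarrow> bool" where
  "part_iso u v P \<longleftrightarrow> P \<subseteq> positions u \<times> positions v \<and>
     (\<forall>(p, q)\<in>P. label u p = label v q \<and>
        (\<forall>(p', q')\<in>P. (p = p' \<longleftrightarrow> q = q') \<and> ((p, p') \<in> leq u \<longleftrightarrow> (q, q') \<in> leq v)))"

text \<open>The Ehrenfeucht-Fraisse game with \<open>k\<close> rounds left. Played positions are
  kept as a set of pairs rather than by variables, so repeated or discarded pairs need no
  bookkeeping. The position types may differ, which lets words encoded over \<open>nat\<close> be
  compared with structured copies.\<close>

primrec back_forth :: "nat \<Rightarrow> ('p, 'a) lword \<Rightarrow> ('q, 'a) lword \<Rightarrow> ('p \<times> 'q) set \<Rightarrow> bool" where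
  "back_forth 0 u v P \<longleftrightarrow> part_iso u v P"
| "back_forth (Suc k) u v P \<longleftrightarrow> part_iso u v P \<and>
     (\<forall>p\<in>positions u. \<exists>q\<in>positions v. back_forth k u v (insert (p, q) P)) \<and>
     (\<forall>q\<in>positions v. \<exists>p\<in>positions u. back_forth k u v (insert (p, q) P))"

lemma part_isoI:
  assumes "\<And>p q. (p, q) \<in> P \<Longrightarrow> p \<in> positions u \<and> q \<in> positions v \<and> label u p = label v q"
    and "\<And>p q p' q'. (p, q) \<in> P \<Longrightarrow> (p', q') \<in> P \<Longrightarrow>
      (p = p' \<longleftrightarrow> q = q') \<and> ((p, p') \<in> leq u \<longleftrightarrow> (q, q') \<in> leq v)"
  shows "part_iso u v P"
  unfolding part_iso_def using assms by fast

lemma part_isoD: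
  assumes "part_iso u v P"
  shows "(p, q) \<in> P \<Longrightarrow> p \<in> positions u" "(p, q) \<in> P \<Longrightarrow> q \<in> positions v"
    and "(p, q) \<in> P \<Longrightarrow> label u p = label v q"
    and "(p, q) \<in> P \<Longrightarrow> (p', q') \<in> P \<Longrightarrow> p = p' \<longleftrightarrow> q = q'"
    and "(p, q) \<in> P \<Longrightarrow> (p', q') \<in> P \<Longrightarrow> (p, p') \<in> leq u \<longleftrightarrow> (q, q') \<in> leq v"
proof -
  have "P \<subseteq> positions u \<times> positions v" using assms by (simp add: part_iso_def)
  then show "p \<in> positions u" "q \<in> positions v" if "(p, q) \<in> P"
    using that by auto
  have P: "label u p = label v q \<and>
      (\<forall>(p', q')\<in>P. (p = p' \<longleftrightarrow> q = q') \<and> ((p, p') \<in> leq u \<longleftrightarrow> (q, q') \<in> leq v))"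
    if "(p, q) \<in> P" for p q
    using bspec[OF conjunct2[OF assms[unfolded part_iso_def]] that] by simp
  then show "label u p = label v q" if "(p, q) \<in> P"
    using that by simp
  show "p = p' \<longleftrightarrow> q = q'" "(p, p') \<in> leq u \<longleftrightarrow> (q, q') \<in> leq v" if "(p, q) \<in> P" "(p', q') \<in> P"
    using P[OF that(1)] that(2) by auto
qed

lemma part_iso_subset: "part_iso u v P \<Longrightarrow> Q \<subseteq> P \<Longrightarrow> part_iso u v Q"
  by (rule part_isoI) (auto dest: part_isoD(1-3) part_isoD(4,5))

lemma back_forth_part_iso: "back_forth k u v P \<Longrightarrow> part_iso u v P"
  by (cases k) auto

text \<open>Fewer recorded pairs constrain Duplicator less. This discards the surplus pairs that
  insertions and compositions of relations leave behind.\<close>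

lemma back_forth_subset: "back_forth k u v P \<Longrightarrow> Q \<subseteq> P \<Longrightarrow> back_forth k u v Q"
proof (induction k arbitrary: P Q)
  case (Suc k)
  have *: "back_forth k u v (insert x P) \<Longrightarrow> back_forth k u v (insert x Q)" for x
    using Suc.IH Suc.prems(2) by blast
  show ?case
    using Suc.prems part_iso_subset[of u v P Q] * by simp meson
qed (auto intro: part_iso_subset)

lemma back_forth_Suc_D: "back_forth (Suc k) u v P \<Longrightarrow> back_forth k u v P"
proof (induction k arbitrary: P)
  case (Suc k)
  then show ?case unfolding back_forth.simps(2)[of "Suc k"] back_forth.simps(2)[of k u v P] by blast
qed simp

lemma back_forth_mono: "back_forth k u v P \<Longrightarrow> l \<le> k \<Longrightarrow> back_forth l u v P"
  by (induction k) (auto simp: le_Suc_eq dest: back_forth_Suc_D simp del: back_forth.simps)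

lemma back_forth_sym: "back_forth k u v P \<Longrightarrow> back_forth k v u (P\<inverse>)"
proof (induction k arbitrary: P)
  case 0
  then show ?case by (auto intro!: part_isoI dest: part_isoD)
next
  case (Suc k)
  have "part_iso v u (P\<inverse>)"
    using Suc.prems by (auto intro!: part_isoI dest: part_isoD)
  moreover have "back_forth k v u (insert (q, p) (P\<inverse>))" if "back_forth k u v (insert (p, q) P)" for p q
    using back_forth_subset[OF Suc.IH[OF that], of "insert (q, p) (P\<inverse>)"] by auto
  ultimately show ?case using Suc.prems by simp meson
qed

lemma part_iso_relcomp:
  assumes "part_iso u v P" "part_iso v w Q" shows "part_iso u w (P O Q)"
proof (rule part_isoI)
  show "p \<in> positions u \<and> r \<in> positions w \<and> label u p = label w r" if "(p, r) \<in> P O Q" for p r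
    using that part_isoD(1-3)[OF assms(1)] part_isoD(1-3)[OF assms(2)] by (metis relcompE prod.inject)
  show "(p = p' \<longleftrightarrow> r = r') \<and> ((p, p') \<in> leq u \<longleftrightarrow> (r, r') \<in> leq w)"
    if "(p, r) \<in> P O Q" "(p', r') \<in> P O Q" for p r p' r'
  proof -
    from that obtain q q' where "(p, q) \<in> P" "(q, r) \<in> Q" "(p', q') \<in> P" "(q', r') \<in> Q" by blast
    then show ?thesis using part_isoD(4,5)[OF assms(1)] part_isoD(4,5)[OF assms(2)] by blast
  qed
qed

lemma back_forth_trans:
  "back_forth k u v P \<Longrightarrow> back_forth k v w Q \<Longrightarrow> back_forth k u w (P O Q)"
proof (induction k arbitrary: P Q)
  case 0
  then show ?case using part_iso_relcomp by simp
next
  case (Suc k)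
  have *: "back_forth k u w (insert (p, r) (P O Q))"
    if "back_forth k u v (insert (p, q) P)" "back_forth k v w (insert (q, r) Q)" for p q r
    by (rule back_forth_subset[OF Suc.IH[OF that]]) blast
  have "part_iso u w (P O Q)"
    by (rule part_iso_relcomp[OF Suc.prems[THEN back_forth_part_iso]])
  then show ?case using Suc.prems * unfolding back_forth.simps(2) by meson
qed

text \<open>Answering along \<open>f\<close> keeps all played pairs on its graph, for any number of
  rounds.\<close>

lemma is_iso_back_forth:
  assumes "is_iso f u v" "A \<subseteq> positions u"
  shows "back_forth k u v ((\<lambda>p. (p, f p)) ` A)"
proof -
  have piso: "part_iso u v ((\<lambda>p. (p, f p)) ` A)" if "A \<subseteq> positions u" for A
  proof (rule part_isoI)
    show "p \<in> positions u \<and> q \<in> positions v \<and> label u p = label v q"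
      if "(p, q) \<in> (\<lambda>p. (p, f p)) ` A" for p q
      using that \<open>A \<subseteq> _\<close> assms(1) by (auto simp: is_iso_def bij_betw_def)
    show "(p = p' \<longleftrightarrow> q = q') \<and> ((p, p') \<in> leq u \<longleftrightarrow> (q, q') \<in> leq v)"
      if "(p, q) \<in> (\<lambda>p. (p, f p)) ` A" "(p', q') \<in> (\<lambda>p. (p, f p)) ` A" for p q p' q'
    proof -
      from that \<open>A \<subseteq> _\<close> have "p \<in> positions u" "p' \<in> positions u" "q = f p" "q' = f p'" by auto
      then show ?thesis using assms(1) unfolding is_iso_def bij_betw_def inj_on_def by blast
    qed
  qed
  show ?thesis using assms(2)
  proof (induction k arbitrary: A)
    case 0
    then show ?case using piso by simp
  next
    case (Suc k)
    have "part_iso u v ((\<lambda>p. (p, f p)) ` A)" using piso Suc.prems by simp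
    moreover have "back_forth k u v (insert (p, f p) ((\<lambda>p. (p, f p)) ` A))" if "p \<in> positions u" for p
      using Suc.IH[of "insert p A"] Suc.prems that by simp
    moreover have "positions v = f ` positions u"
      using assms(1) by (simp add: is_iso_def bij_betw_def)
    ultimately show ?case by auto
  qed
qed

lemma is_iso_back_forth_empty: "is_iso f u v \<Longrightarrow> back_forth k u v {}"
  using is_iso_back_forth[of f u v "{}"] by simp

lemma back_forth_Id_on:
  assumes "A \<subseteq> positions u" shows "back_forth k u u (Id_on A)"
proof -
  have "(\<lambda>p. (p, id p)) ` A = Id_on A" by (auto simp: Id_on_def)
  then show ?thesis using is_iso_back_forth[OF is_iso_id assms, of k] by simp
qed

lemma back_forth_refl: "back_forth k u u {}"
  using back_forth_Id_on[of "{}"] by simp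

lemma back_forth_empty_trans:
  "back_forth k u v {} \<Longrightarrow> back_forth k v w {} \<Longrightarrow> back_forth k u w {}"
  using back_forth_trans by fastforce

lemma back_forth_empty_sym: "back_forth k u v {} \<Longrightarrow> back_forth k v u {}"
  using back_forth_sym by fastforce

section \<open>Formulas of bounded quantifier depth\<close>

primrec qdepth :: "('a, 'v) fm \<Rightarrow> nat" where
  "qdepth Top = 0" | "qdepth Bot = 0" | "qdepth IsEmpty = 0"
| "qdepth (Equal x y) = 0" | "qdepth (Label x a) = 0"
| "qdepth (Less x y) = 0" | "qdepth (LessEq x y) = 0" | "qdepth (Succ x y) = 0"
| "qdepth (IsMin x) = 0" | "qdepth (IsMax x) = 0"
| "qdepth (Neg \<phi>) = qdepth \<phi>"
| "qdepth (Disj \<phi> \<psi>) = max (qdepth \<phi>) (qdepth \<psi>)"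
| "qdepth (Conj \<phi> \<psi>) = max (qdepth \<phi>) (qdepth \<psi>)"
| "qdepth (Exists x \<phi>) = Suc (qdepth \<phi>)" | "qdepth (Forall x \<phi>) = Suc (qdepth \<phi>)"

text \<open>With successor, extremal and emptiness atoms excluded, every atom is decided by
  \<open>part_iso\<close>, so rounds are spent on quantifiers only. Just the values of free
  variables have to be paired: when a quantifier resets a variable, its former value merely stays
  behind in \<open>P\<close>.\<close>

lemma back_forth_sat:
  assumes "back_forth k u v P" "qdepth \<phi> \<le> k" "no_suc_min_max_empty \<phi>"
    and "\<And>x. x \<in> FV \<phi> \<Longrightarrow> (the (\<alpha> x), the (\<beta> x)) \<in> P"
  shows "sat u \<alpha> \<phi> \<longleftrightarrow> sat v \<beta> \<phi>"
  using assms
proof (induction \<phi> arbitrary: k P \<alpha> \<beta>)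
  case (Exists x \<phi>)
  then obtain l where k: "k = Suc l" "qdepth \<phi> \<le> l" by (cases k) auto
  have "sat u (\<alpha>(x \<mapsto> p)) \<phi> \<longleftrightarrow> sat v (\<beta>(x \<mapsto> q)) \<phi>"
    if "back_forth l u v (insert (p, q) P)" for p q
    by (rule Exists.IH[OF that k(2)]) (use Exists.prems in auto)
  then show ?case using Exists.prems(1) unfolding k(1) by simp meson
next
  case (Forall x \<phi>)
  then obtain l where k: "k = Suc l" "qdepth \<phi> \<le> l" by (cases k) auto
  have "sat u (\<alpha>(x \<mapsto> p)) \<phi> \<longleftrightarrow> sat v (\<beta>(x \<mapsto> q)) \<phi>"
    if "back_forth l u v (insert (p, q) P)" for p q
    by (rule Forall.IH[OF that k(2)]) (use Forall.prems in auto)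
  then show ?case using Forall.prems(1) unfolding k(1) by simp meson
next
  case (Disj \<phi>1 \<phi>2)
  have "sat u \<alpha> \<phi>1 \<longleftrightarrow> sat v \<beta> \<phi>1" "sat u \<alpha> \<phi>2 \<longleftrightarrow> sat v \<beta> \<phi>2"
    by (rule Disj.IH[OF Disj.prems(1)]; use Disj.prems in simp)+
  then show ?case by simp
next
  case (Conj \<phi>1 \<phi>2)
  have "sat u \<alpha> \<phi>1 \<longleftrightarrow> sat v \<beta> \<phi>1" "sat u \<alpha> \<phi>2 \<longleftrightarrow> sat v \<beta> \<phi>2"
    by (rule Conj.IH[OF Conj.prems(1)]; use Conj.prems in simp)+
  then show ?case by simp
next
  case (Neg \<phi>)
  have "sat u \<alpha> \<phi> \<longleftrightarrow> sat v \<beta> \<phi>"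
    by (rule Neg.IH[OF Neg.prems(1)]; use Neg.prems in simp)
  then show ?case by simp
next
  case (Equal x y)
  then show ?case using part_isoD(4)[OF back_forth_part_iso[OF Equal.prems(1)]] by simp
next
  case (Less x y)
  then show ?case using part_isoD(4,5)[OF back_forth_part_iso[OF Less.prems(1)],
      of "the (\<alpha> x)" "the (\<beta> x)" "the (\<alpha> y)" "the (\<beta> y)"] by simp
next
  case (LessEq x y)
  then show ?case using part_isoD(5)[OF back_forth_part_iso[OF LessEq.prems(1)]] by simp
next
  case (Label x a)
  then show ?case using part_isoD(3)[OF back_forth_part_iso[OF Label.prems(1)]] by simp
qed auto

lemma back_forth_sat_sentence:
  assumes "back_forth k u v {}" "qdepth \<phi> \<le> k" "no_suc_min_max_empty \<phi>" "sentence \<phi>"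
  shows "sat u Map.empty \<phi> \<longleftrightarrow> sat v Map.empty \<phi>"
  using back_forth_sat[OF assms(1-3)] assms(4) by (simp add: sentence_def)

section \<open>Composition along sums and concatenations\<close>

definition lsum :: "('t \<Rightarrow> ('p, 'a) lword) \<Rightarrow> ('t, 'b) lword \<Rightarrow> ('p \<times> 't, 'a) lword" where
  "lsum B I = \<lparr>positions = {(p, t). t \<in> positions I \<and> p \<in> positions (B t)},
     leq = {((p, t), (p', t')). t \<in> positions I \<and> t' \<in> positions I \<and>
              p \<in> positions (B t) \<and> p' \<in> positions (B t') \<and>
              ((t, t') \<in> leq I \<and> t \<noteq> t' \<or> t = t' \<and> (p, p') \<in> leq (B t))},
     label = (\<lambda>(p, t). label (B t) p)\<rparr>"

lemma lsum_sel:
  "(p, t) \<in> positions (lsum B I) \<longleftrightarrow> t \<in> positions I \<and> p \<in> positions (B t)"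
  "((p, t), (p', t')) \<in> leq (lsum B I) \<longleftrightarrow> t \<in> positions I \<and> t' \<in> positions I \<and>
     p \<in> positions (B t) \<and> p' \<in> positions (B t') \<and>
     ((t, t') \<in> leq I \<and> t \<noteq> t' \<or> t = t' \<and> (p, p') \<in> leq (B t))"
  "label (lsum B I) (p, t) = label (B t) p"
  by (auto simp: lsum_def)

lemma lpower_eq_lsum:
  assumes "wf_lword w" shows "lpower u w = lsum (\<lambda>_. u) w"
  unfolding lpower_def lsum_def using wf_lwordD(1,2)[OF assms] by (auto simp: fun_eq_iff)

lemma part_iso_lsum:
  assumes IJ: "part_iso I J R"
    and PR: "\<And>x i y j. ((x, i), (y, j)) \<in> P \<Longrightarrow> (i, j) \<in> R"
    and fib: "\<And>i j. (i, j) \<in> R \<Longrightarrow> part_iso (B i) (C j) {(x, y). ((x, i), (y, j)) \<in> P}"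
  shows "part_iso (lsum B I) (lsum C J) P"
proof (rule part_isoI)
  have base: "i \<in> positions I \<and> j \<in> positions J \<and> x \<in> positions (B i) \<and> y \<in> positions (C j) \<and>
      label (B i) x = label (C j) y" if "((x, i), (y, j)) \<in> P" for x i y j
    using part_isoD(1-3)[OF fib[OF PR[OF that]], of x y] part_isoD(1,2)[OF IJ PR[OF that]] that
    by simp
  fix p q assume pq: "(p, q) \<in> P"
  obtain x i y j where p: "p = (x, i)" "q = (y, j)" by (cases p, cases q)
  show "p \<in> positions (lsum B I) \<and> q \<in> positions (lsum C J) \<and>
      label (lsum B I) p = label (lsum C J) q"
    using base pq unfolding p lsum_sel by blast
  fix p' q' assume pq': "(p', q') \<in> P"
  obtain x' i' y' j' where p': "p' = (x', i')" "q' = (y', j')" by (cases p', cases q')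
  note R = PR[OF pq[unfolded p]] PR[OF pq'[unfolded p']]
  note idx = part_isoD(4,5)[OF IJ R]
  note b = base[OF pq[unfolded p]] base[OF pq'[unfolded p']]
  show "(p = p' \<longleftrightarrow> q = q') \<and> ((p, p') \<in> leq (lsum B I) \<longleftrightarrow> (q, q') \<in> leq (lsum C J))"
  proof (cases "i = i'")
    case True
    then have j: "j = j'" using idx by blast
    have "(x = x' \<longleftrightarrow> y = y') \<and> ((x, x') \<in> leq (B i) \<longleftrightarrow> (y, y') \<in> leq (C j))"
      using part_isoD(4,5)[OF fib[OF R(1)], of x y x' y'] pq pq' unfolding p p' True j by blast
    then show ?thesis using b True j unfolding p p' lsum_sel by blast
  next
    case False
    then show ?thesis using b idx unfolding p p' lsum_sel by blast
  qed
qed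

text \<open>Duplicator answers the index in the game on \<open>I\<close> and \<open>J\<close> and
  the offset in the game of the two blocks; a round of the sum costs each of them at most one round.
  \<open>R\<close> holds the indices paired so far, and the fibres of \<open>P\<close> are the
  positions of the block games. A fresh pair of indices carries equal labels, so the last assumption
  starts its block game from the empty position. Blocks varying with the index cover powers and
  substitutions alike.\<close>

lemma back_forth_lsum:
  assumes "back_forth k I J R"
    and "\<And>x i y j. ((x, i), (y, j)) \<in> P \<Longrightarrow> (i, j) \<in> R"
    and "\<And>i j. (i, j) \<in> R \<Longrightarrow> back_forth k (B i) (C j) {(x, y). ((x, i), (y, j)) \<in> P}"
    and "\<And>i j. i \<in> positions I \<Longrightarrow> j \<in> positions J \<Longrightarrow> label I i = label J j \<Longrightarrow>
      back_forth k (B i) (C j) {}"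
  shows "back_forth k (lsum B I) (lsum C J) P"
  using assms
proof (induction k arbitrary: P R)
  case 0
  then show ?case using part_iso_lsum[of I J R P B C] by simp
next
  case (Suc k)
  let ?fib = "\<lambda>P i j. {(x, y). ((x, i), (y, j)) \<in> P}"
  have piso: "part_iso (lsum B I) (lsum C J) P"
    by (rule part_iso_lsum[OF back_forth_part_iso[OF Suc.prems(1)]])
      (use Suc.prems(2,3) back_forth_part_iso in blast)+
  have block: "back_forth (Suc k) (B i) (C j) (?fib P i j)"
    if "back_forth k I J (insert (i, j) R)" for i j
  proof (cases "(i, j) \<in> R")
    case False
    then have "?fib P i j = {}" using Suc.prems(2) by blast
    then show ?thesis
      using Suc.prems(4)[of i j] part_isoD(1-3)[OF back_forth_part_iso[OF that], of i j] by simp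
  qed (use Suc.prems(3) in blast)
  have step: "back_forth k (lsum B I) (lsum C J) (insert ((x, i), (y, j)) P)"
    if ij: "back_forth k I J (insert (i, j) R)"
      and xy: "back_forth k (B i) (C j) (insert (x, y) (?fib P i j))" for x i y j
  proof (rule Suc.IH[OF ij])
    fix i' j' assume *: "(i', j') \<in> insert (i, j) R"
    show "back_forth k (B i') (C j') (?fib (insert ((x, i), (y, j)) P) i' j')"
    proof (cases "i' = i \<and> j' = j")
      case True
      then have "?fib (insert ((x, i), (y, j)) P) i' j' = insert (x, y) (?fib P i j)" by auto
      then show ?thesis using xy True by simp
    next
      case False
      then have "?fib (insert ((x, i), (y, j)) P) i' j' = ?fib P i' j'" by auto
      then show ?thesis using back_forth_Suc_D[OF Suc.prems(3)] * False by auto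
    qed
  qed (use Suc.prems(2,4) back_forth_Suc_D in blast)+
  show ?case unfolding back_forth.simps(2)
  proof (intro conjI ballI piso)
    fix p assume p: "p \<in> positions (lsum B I)"
    obtain x i where px: "p = (x, i)" by (cases p)
    from p have x: "i \<in> positions I" "x \<in> positions (B i)" by (simp_all add: px lsum_sel)
    then obtain j where j: "j \<in> positions J" "back_forth k I J (insert (i, j) R)"
      using Suc.prems(1) by auto
    with x block[OF j(2)] obtain y where y: "y \<in> positions (C j)"
      "back_forth k (B i) (C j) (insert (x, y) (?fib P i j))" by auto
    then show "\<exists>q\<in>positions (lsum C J). back_forth k (lsum B I) (lsum C J) (insert (p, q) P)"
      using step[OF j(2)] j(1) unfolding px by (intro bexI[of _ "(y, j)"]) (simp_all add: lsum_sel)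
  next
    fix q assume q: "q \<in> positions (lsum C J)"
    obtain y j where qy: "q = (y, j)" by (cases q)
    from q have y: "j \<in> positions J" "y \<in> positions (C j)" by (simp_all add: qy lsum_sel)
    then obtain i where i: "i \<in> positions I" "back_forth k I J (insert (i, j) R)"
      using Suc.prems(1) by auto
    with y block[OF i(2)] obtain x where x: "x \<in> positions (B i)"
      "back_forth k (B i) (C j) (insert (x, y) (?fib P i j))" by auto
    then show "\<exists>p\<in>positions (lsum B I). back_forth k (lsum B I) (lsum C J) (insert (p, q) P)"
      using step[OF i(2)] i(1) unfolding qy by (intro bexI[of _ "(x, i)"]) (simp_all add: lsum_sel)
  qed
qed

lemma back_forth_lconcat:
  assumes "back_forth k u u' P" "back_forth k v v' Q"
  shows "back_forth k (lconcat u v) (lconcat u' v')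
    (map_prod Inl Inl ` P \<union> map_prod Inr Inr ` Q)"
  using assms
proof (induction k arbitrary: P Q)
  case 0
  then show ?case
    by (intro part_isoI[THEN back_forth.simps(1)[THEN iffD2]])
      (auto simp: lconcat_sel dest: part_isoD)
next
  case (Suc k)
  note bs = back_forth_part_iso[OF Suc.prems(1)] back_forth_part_iso[OF Suc.prems(2)]
  have "part_iso (lconcat u v) (lconcat u' v') (map_prod Inl Inl ` P \<union> map_prod Inr Inr ` Q)"
    using bs by (intro part_isoI) (auto simp: lconcat_sel dest: part_isoD)
  moreover have "back_forth k (lconcat u v) (lconcat u' v')
      (insert (Inl x, Inl y) (map_prod Inl Inl ` P \<union> map_prod Inr Inr ` Q))"
    if "back_forth k u u' (insert (x, y) P)" for x y
    using Suc.IH[OF that back_forth_Suc_D[OF Suc.prems(2)]] by simp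
  moreover have "back_forth k (lconcat u v) (lconcat u' v')
      (insert (Inr x, Inr y) (map_prod Inl Inl ` P \<union> map_prod Inr Inr ` Q))"
    if "back_forth k v v' (insert (x, y) Q)" for x y
    using Suc.IH[OF back_forth_Suc_D[OF Suc.prems(1)] that] by simp
  moreover have pos: "positions (lconcat a b) = Inl ` positions a \<union> Inr ` positions b"
    for a :: "('x, 'z) lword" and b :: "('y, 'z) lword" by (auto simp: lconcat_def)
  ultimately show ?case
    using Suc.prems unfolding back_forth.simps(2) pos ball_Un bex_Un ball_simps bex_simps by meson
qed

lemma back_forth_lconcat_empty:
  "back_forth k u u' {} \<Longrightarrow> back_forth k v v' {} \<Longrightarrow> back_forth k (lconcat u v) (lconcat u' v') {}"
  using back_forth_lconcat[of k u u' "{}" v v' "{}"] by simp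

lemma back_forth_lsum_empty:
  assumes "back_forth k I J {}"
    and "\<And>i j. i \<in> positions I \<Longrightarrow> j \<in> positions J \<Longrightarrow> label I i = label J j \<Longrightarrow>
      back_forth k (B i) (C j) {}"
  shows "back_forth k (lsum B I) (lsum C J) {}"
  by (rule back_forth_lsum[OF assms(1)]) (use assms(2) in auto)

section \<open>Lexicographic intervals of rationals and integers\<close>

text \<open>The signed distance from \<open>p\<close> to \<open>q\<close>, cut off at
  \<open>m\<close>. Points with different first components are infinitely far apart, which the
  cut-off turns into \<open>m\<close> or \<open>-m\<close>. For \<open>m \<ge> 1\<close> this one
  integer carries order, equality and distance.\<close>

definition gap :: "int \<Rightarrow> rat \<times> int \<Rightarrow> rat \<times> int \<Rightarrow> int" where
  "gap m p q = (if fst p < fst q then m else if fst q < fst p then - m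
     else max (- m) (min m (snd q - snd p)))"

lemma less_iff_gap: "1 \<le> m \<Longrightarrow> p < q \<longleftrightarrow> 0 < gap m p q"
  by (auto simp: gap_def less_prod_def' split: if_splits)

lemma le_iff_gap: "1 \<le> m \<Longrightarrow> p \<le> q \<longleftrightarrow> 0 \<le> gap m p q"
  by (auto simp: gap_def less_eq_prod_def split: if_splits)

lemma eq_iff_gap: "1 \<le> m \<Longrightarrow> p = q \<longleftrightarrow> gap m p q = 0"
  by (auto simp: gap_def prod_eq_iff)

lemma gap_swap: "0 \<le> m \<Longrightarrow> gap m q p = - gap m p q"
  by (auto simp: gap_def)

lemma gap_self: "0 \<le> m \<Longrightarrow> gap m p p = 0"
  by (simp add: gap_def)

lemma gap_clamp: "0 \<le> m \<Longrightarrow> m \<le> n \<Longrightarrow> gap m p q = max (- m) (min m (gap n p q))"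
  by (auto simp: gap_def)

lemma gap_add: "0 \<le> m \<Longrightarrow> p \<le> q \<Longrightarrow> q \<le> r \<Longrightarrow> gap m p r = min m (gap m p q + gap m q r)"
  by (auto simp: gap_def less_eq_prod_def)

lemma gap_less:
  assumes "1 \<le> m" "p < q"
  shows "gap m p q = (if fst p < fst q then m else min m (snd q - snd p))"
  using assms by (auto simp: gap_def less_prod_def')

text \<open>If \<open>x\<close> is close to one end, its distance to that end is copied; if it is
  far from both, the gap has size at least \<open>2 * m\<close>, and a point \<open>m\<close> above
  \<open>p'\<close> is far from both ends as well.\<close>

lemma gap_between:
  assumes "1 \<le> m" "p < x" "x < q" and eq: "gap (2 * m) p q = gap (2 * m) p' q'"
  obtains y where "p' < y" "y < q'" "gap m p' y = gap m p x" "gap m y q' = gap m x q"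
proof -
  have pos: "0 < gap (2 * m) p' q'" "0 < gap m p x" "0 < gap m x q"
    using assms less_iff_gap[of "2 * m" p q] less_iff_gap[of m p x] less_iff_gap[of m x q]
      less_trans[of p x q] by simp_all
  then have p'q': "fst p' < fst q' \<or> fst p' = fst q' \<and> snd p' < snd q'"
    using less_iff_gap[of "2 * m" p' q'] assms(1) by (simp add: less_prod_def')
  have bound: "gap m p x \<le> m" "gap m x q \<le> m" using assms(1) by (auto simp: gap_def)
  have add: "gap m p q = min m (gap m p x + gap m x q)"
    using assms by (intro gap_add) auto
  define y where "y = (if gap m p x < m then (fst p', snd p' + gap m p x)
    else if gap m x q < m then (fst q', snd q' - gap m x q) else (fst p', snd p' + m))"
  \<comment> \<open>If \<open>x\<close> is close to both ends, the gap is the exact sum, so copying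
    the distance to \<open>p'\<close> also gives the right distance to \<open>q'\<close>; otherwise
    the inequality leaves enough room.\<close>
  have total: "gap m p x + gap m x q \<le> gap (2 * m) p' q'"
    "gap m p x < m \<Longrightarrow> gap m x q < m \<Longrightarrow> gap (2 * m) p' q' = gap m p x + gap m x q"
  proof -
    have less: "fst p \<le> fst x" "fst x \<le> fst q" and pq: "p < q"
      using assms(2,3) by (auto simp: less_prod_def')
    note gaps = gap_less[OF assms(1,2)] gap_less[OF assms(1,3)]
    have "gap m p x + gap m x q \<le> gap (2 * m) p q \<and>
        (gap m p x < m \<and> gap m x q < m \<longrightarrow> gap (2 * m) p q = gap m p x + gap m x q)"
    proof (cases "fst p < fst q")
      case True
      then have "gap (2 * m) p q = 2 * m" by (simp add: gap_def)
      moreover have "gap m p x = m \<or> gap m x q = m" using True less gaps by auto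
      ultimately show ?thesis using bound by linarith
    next
      case False
      then have "fst p = fst x" "fst x = fst q" using less by auto
      then have "gap m p x = min m (snd x - snd p)" "gap m x q = min m (snd q - snd x)"
        "gap (2 * m) p q = min (2 * m) (snd q - snd p)"
        using gaps gap_less[OF _ pq, of "2 * m"] assms(1) by simp_all
      then show ?thesis by linarith
    qed
    then show "gap m p x + gap m x q \<le> gap (2 * m) p' q'"
      "gap m p x < m \<Longrightarrow> gap m x q < m \<Longrightarrow> gap (2 * m) p' q' = gap m p x + gap m x q"
      unfolding eq by simp_all
  qed
  have "gap m p' y = gap m p x \<and> gap m y q' = gap m x q"
  proof (cases "fst p' < fst q'")
    case True
    then have "gap (2 * m) p' q' = 2 * m" by (simp add: gap_def)
    moreover from this have "gap m p x = m \<or> gap m x q = m" using total(2) bound by linarith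
    ultimately show ?thesis using True pos bound assms(1) unfolding y_def
      by (auto simp: gap_def[of m p' "(_, _)"] gap_def[of m "(_, _)" q'])
  next
    case False
    then have f: "fst p' = fst q'" using p'q' by simp
    then have "gap (2 * m) p' q' = min (2 * m) (snd q' - snd p')"
      using p'q' assms(1) by (simp add: gap_def)
    then show ?thesis using f p'q' pos bound total assms(1) unfolding y_def
      by (auto simp: gap_def[of m p' "(_, _)"] gap_def[of m "(_, _)" q'])
  qed
  moreover from this have "p' < y" "y < q'" using pos less_iff_gap[OF assms(1)] by auto
  ultimately show thesis using that by blast
qed

section \<open>The game on lexicographic intervals\<close>

definition same_gaps :: "int \<Rightarrow> ((rat \<times> int) \<times> (rat \<times> int)) set \<Rightarrow> bool" where
  "same_gaps m P \<longleftrightarrow> (\<forall>(p, q)\<in>P. \<forall>(p', q')\<in>P. gap m p p' = gap m q q')"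

lemma same_gapsI:
  "(\<And>p q p' q'. (p, q) \<in> P \<Longrightarrow> (p', q') \<in> P \<Longrightarrow> gap m p p' = gap m q q') \<Longrightarrow> same_gaps m P"
  unfolding same_gaps_def by blast

lemma same_gapsD:
  assumes "same_gaps m P" "(p, q) \<in> P" "(p', q') \<in> P" shows "gap m p p' = gap m q q'"
  using assms unfolding same_gaps_def by fastforce

lemma same_gaps_smaller:
  assumes "same_gaps n P" "0 \<le> m" "m \<le> n" shows "same_gaps m P"
  by (rule same_gapsI) (metis assms same_gapsD gap_clamp)

lemma same_gaps_converse: "same_gaps m P \<Longrightarrow> same_gaps m (P\<inverse>)"
  by (rule same_gapsI) (metis converseD same_gapsD)

lemma same_gaps_insert:
  assumes "0 \<le> m" "same_gaps m P" "\<And>p q. (p, q) \<in> P \<Longrightarrow> gap m p x = gap m q y"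
  shows "same_gaps m (insert (x, y) P)"
proof (rule same_gapsI)
  fix p q p' q' assume "(p, q) \<in> insert (x, y) P" "(p', q') \<in> insert (x, y) P"
  moreover have "gap m z z = 0" for z using assms(1) by (rule gap_self)
  moreover have "gap m x p = gap m y q" if "(p, q) \<in> P" for p q
    using assms(3)[OF that] gap_swap[OF assms(1)] by metis
  ultimately show "gap m p p' = gap m q q'"
    using assms(3) same_gapsD[OF assms(2)] unfolding insert_iff prod.inject by metis
qed

text \<open>Only the nearest parameters on either side of \<open>x\<close> matter:
  \<open>gap_between\<close> copies \<open>x\<close> between their partners, and additivity of
  truncated gaps extends the agreement to all other parameters. The ends belong to \<open>P\<close>,
  so both neighbours exist and \<open>y\<close> stays inside the target interval.\<close>

lemma same_gaps_extend:
  assumes m: "1 \<le> m" and fin: "finite P" and same: "same_gaps (2 * m) P"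
    and ends: "(a, c) \<in> P" "(b, d) \<in> P" and x: "a < x" "x < b"
  obtains y where "c < y" "y < d" "same_gaps m (insert (x, y) P)"
proof -
  have same_m: "same_gaps m P" using same_gaps_smaller[OF same] m by simp
  have ends': "a \<in> {p \<in> fst ` P. p \<le> x}" "b \<in> {q \<in> fst ` P. x \<le> q}"
    using ends x by (auto intro: rev_image_eqI)
  define p where "p = Max {p \<in> fst ` P. p \<le> x}"
  have "p \<in> {p \<in> fst ` P. p \<le> x}" unfolding p_def
    by (rule Max_in) (use fin in simp, use ends' in blast)
  then obtain p' where p: "(p, p') \<in> P" "p \<le> x" by auto
  have p_max: "z \<le> p" if "(z, z') \<in> P" "z \<le> x" for z z'
    unfolding p_def by (rule Max_ge) (use fin that in force)+
  define q where "q = Min {q \<in> fst ` P. x \<le> q}"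
  have "q \<in> {q \<in> fst ` P. x \<le> q}" unfolding q_def
    by (rule Min_in) (use fin in simp, use ends' in blast)
  then obtain q' where q: "(q, q') \<in> P" "x \<le> q" by auto
  have q_min: "q \<le> z" if "(z, z') \<in> P" "x \<le> z" for z z'
    unfolding q_def by (rule Min_le) (use fin that in force)+
  have le: "z \<le> w \<longleftrightarrow> z' \<le> w'" "z < w \<longleftrightarrow> z' < w'" if "(z, z') \<in> P" "(w, w') \<in> P" for z z' w w'
    using same_gapsD[OF same_m that] le_iff_gap[OF m] less_iff_gap[OF m] by auto
  obtain y where y: "p' \<le> y" "y \<le> q'" "gap m p' y = gap m p x" "gap m y q' = gap m x q"
    "c < y" "y < d"
  \<comment> \<open>If \<open>x\<close> is itself a parameter, its partner is the answer; otherwise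
    both neighbours are strict and \<open>gap_between\<close> applies.\<close>
  proof (cases "(\<exists>x'. (x, x') \<in> P)")
    case True
    then obtain x' where x': "(x, x') \<in> P" ..
    then have "p = x" "q = x" using p q p_max[OF x'] q_min[OF x'] by auto
    then have "p' = x'" "q' = x'"
      using le(1)[OF p(1) x'] le(1)[OF x' p(1)] le(1)[OF q(1) x'] le(1)[OF x' q(1)] by auto
    moreover have "gap m p' x' = gap m p x" "gap m x' q' = gap m x q"
      using same_gapsD[OF same_m p(1) x'] same_gapsD[OF same_m x' q(1)] by simp_all
    moreover have "c < x'" "x' < d" using le(2)[OF ends(1) x'] le(2)[OF x' ends(2)] x by simp_all
    ultimately show thesis using that[of x'] by simp
  next
    case False
    then have "p \<noteq> x" "q \<noteq> x" using p q by blast+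
    then have "p < x" "x < q" using p(2) q(2) by simp_all
    from gap_between[OF m this same_gapsD[OF same p(1) q(1)]]
    obtain y where y: "p' < y" "y < q'" "gap m p' y = gap m p x" "gap m y q' = gap m x q" .
    have "c \<le> p'" "q' \<le> d"
      using p_max[OF ends(1)] q_min[OF ends(2)] x le(1)[OF ends(1) p(1)] le(1)[OF q(1) ends(2)]
      by simp_all
    then show thesis using that[OF _ _ y(3,4)] y(1,2) by auto
  qed
  have "gap m z x = gap m z' y" if z: "(z, z') \<in> P" for z z'
  proof (cases "z \<le> x")
    case True
    then have "z \<le> p" "z' \<le> p'" using p_max[OF z] le[OF z p(1)] by auto
    then have "gap m z x = min m (gap m z p + gap m p x)" "gap m z' y = min m (gap m z' p' + gap m p' y)"
      using m p(2) y(1) by (auto intro!: gap_add)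
    then show ?thesis using y(3) same_gapsD[OF same_m z p(1)] by simp
  next
    case False
    then have "q \<le> z" "q' \<le> z'" using q_min[OF z] le[OF q(1) z] by auto
    then have "gap m x z = min m (gap m x q + gap m q z)" "gap m y z' = min m (gap m y q' + gap m q' z')"
      using m q(2) y(2) by (auto intro!: gap_add)
    then show ?thesis using y(4) same_gapsD[OF same_m q(1) z] gap_swap[of m x z] gap_swap[of m y z'] m
      by simp
  qed
  then have "same_gaps m (insert (x, y) P)" using m same_m by (intro same_gaps_insert) simp_all
  then show thesis using that y by blast
qed

definition lex_interval :: "rat \<times> int \<Rightarrow> rat \<times> int \<Rightarrow> (rat \<times> int, unit) lword" where
  "lex_interval a b = \<lparr>positions = {a<..<b}, leq = {(p, q). p \<in> {a<..<b} \<and> q \<in> {a<..<b} \<and> p \<le> q},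
     label = (\<lambda>_. ())\<rparr>"

text \<open>With \<open>k\<close> rounds left the invariant is agreement of gaps up to
  \<open>2 ^ k\<close>. The ends, which are no positions, act as permanent parameters, so that
  distances to the borders are respected too.\<close>

lemma back_forth_lex_interval:
  assumes "finite P" "P \<subseteq> {a<..<b} \<times> {c<..<d}"
    and "same_gaps (2 ^ k) (insert (a, c) (insert (b, d) P))"
  shows "back_forth k (lex_interval a b) (lex_interval c d) P"
  using assms
proof (induction k arbitrary: P)
  have piso: "part_iso (lex_interval a b) (lex_interval c d) P"
    if "P \<subseteq> {a<..<b} \<times> {c<..<d}" "same_gaps (2 ^ k) (insert (a, c) (insert (b, d) P))" for k P
  proof (rule part_isoI)
    have m: "(1::int) \<le> 2 ^ k" by simp
    fix p q assume *: "(p, q) \<in> P"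
    then show "p \<in> positions (lex_interval a b) \<and> q \<in> positions (lex_interval c d) \<and>
        label (lex_interval a b) p = label (lex_interval c d) q"
      using that(1) by (auto simp: lex_interval_def)
    fix p' q' assume **: "(p', q') \<in> P"
    then have "gap (2 ^ k) p p' = gap (2 ^ k) q q'"
      using same_gapsD[OF that(2)] * by blast
    then have "p = p' \<longleftrightarrow> q = q'" "p \<le> p' \<longleftrightarrow> q \<le> q'"
      using le_iff_gap[OF m] eq_iff_gap[OF m] by metis+
    then show "(p = p' \<longleftrightarrow> q = q') \<and>
        ((p, p') \<in> leq (lex_interval a b) \<longleftrightarrow> (q, q') \<in> leq (lex_interval c d))"
      using that(1) * ** by (auto simp: lex_interval_def)
  qed
  {
    case 0
    then show ?case using piso[of P 0] by simp
  next
    case (Suc k)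
    let ?P = "insert (a, c) (insert (b, d) P)"
    have fin: "finite ?P" using Suc.prems by simp
    have same: "same_gaps (2 * 2 ^ k) ?P" using Suc.prems(3) by simp
    have "\<exists>q\<in>positions (lex_interval c d). back_forth k (lex_interval a b) (lex_interval c d) (insert (x, q) P)"
      if "x \<in> positions (lex_interval a b)" for x
    proof -
      have x: "a < x" "x < b" using that by (auto simp: lex_interval_def)
      obtain y where y: "c < y" "y < d" "same_gaps (2 ^ k) (insert (x, y) ?P)"
        by (rule same_gaps_extend[OF _ fin same _ _ x]) auto
      have "back_forth k (lex_interval a b) (lex_interval c d) (insert (x, y) P)"
        by (rule Suc.IH) (use y x Suc.prems in \<open>simp_all add: insert_commute\<close>)
      then show ?thesis using y by (auto simp: lex_interval_def)
    qed
    moreover have "\<exists>p\<in>positions (lex_interval a b). back_forth k (lex_interval a b) (lex_interval c d) (insert (p, y) P)"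
      if "y \<in> positions (lex_interval c d)" for y
    proof -
      have y: "c < y" "y < d" using that by (auto simp: lex_interval_def)
      obtain x where x: "a < x" "x < b" "same_gaps (2 ^ k) (insert (y, x) (?P\<inverse>))"
        by (rule same_gaps_extend[OF _ _ same_gaps_converse[OF same], of c a d b, OF _ _ _ _ y])
          (use fin in auto)
      have "(insert (y, x) (?P\<inverse>))\<inverse> = insert (x, y) ?P" by auto
      then have "same_gaps (2 ^ k) (insert (x, y) ?P)" using same_gaps_converse[OF x(3)] by simp
      then have "back_forth k (lex_interval a b) (lex_interval c d) (insert (x, y) P)"
        by (intro Suc.IH) (use x y Suc.prems in \<open>simp_all add: insert_commute\<close>)
      then show ?thesis using x by (auto simp: lex_interval_def)
    qed
    ultimately show ?case unfolding back_forth.simps(2) using piso[OF Suc.prems(2,3)] by simp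
  }
qed

lemma back_forth_lex_interval_empty:
  assumes "gap (2 ^ k) a b = gap (2 ^ k) c d"
  shows "back_forth k (lex_interval a b) (lex_interval c d) {}"
proof (rule back_forth_lex_interval)
  have "gap (2 ^ k) b a = gap (2 ^ k) d c" using assms gap_swap[of "2 ^ k" a b] gap_swap[of "2 ^ k" c d] by simp
  then show "same_gaps (2 ^ k) {(a, c), (b, d)}"
    using assms by (intro same_gapsI) (auto simp: gap_self)
qed auto

section \<open>Finite orders compared with rho\<close>

definition unary_word :: "nat \<Rightarrow> (nat, unit) lword" where
  "unary_word n = of_list (replicate n ())"

text \<open>The open interval from \<open>0\<close> to \<open>n + 1\<close> in one copy of the
  integers consists of \<open>1..n\<close>, just as \<open>of_list\<close> numbers positions. The
  ends are at distance \<open>n + 1\<close>, the quantity in all later bounds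
  \<open>2 ^ k \<le> n + 1\<close>.\<close>

lemma unary_word_iso: "is_iso (\<lambda>i. (0, int i)) (unary_word n) (lex_interval (0, 0) (0, int n + 1))"
proof -
  have "bij_betw (\<lambda>i. (0, int i)) {1..n} {(0::rat, 0::int)<..<(0, int n + 1)}"
    by (rule bij_betw_byWitness[where f' = "\<lambda>p. nat (snd p)"]) (auto simp: less_prod_def')
  moreover have "((i, j) \<in> leq (unary_word n)) =
      (((0, int i), (0, int j)) \<in> leq (lex_interval (0, 0) (0, int n + 1)))"
    if "i \<in> {1..n}" "j \<in> {1..n}" for i j
    using that by (simp add: unary_word_def of_list_def lex_interval_def less_prod_def')
  ultimately show ?thesis
    unfolding is_iso_def by (simp add: unary_word_def of_list_def lex_interval_def)
qed

text \<open>First component \<open>-1\<close> contributes omega, the first components strictly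
  between contribute eta copies of zeta, and first component \<open>1\<close> contributes omega
  reversed. The ends are infinitely far apart.\<close>

abbreviation rho_word :: "(rat \<times> int, unit) lword" where
  "rho_word \<equiv> lex_interval (-1, 0) (1, 0)"

lemma back_forth_unary_rho:
  assumes "2 ^ k \<le> n + 1" shows "back_forth k (unary_word n) rho_word {}"
proof (rule back_forth_empty_trans[OF is_iso_back_forth_empty[OF unary_word_iso]])
  have "(2::int) ^ k \<le> int n + 1" using assms by (simp flip: of_nat_le_iff[where 'a = int])
  then show "back_forth k (lex_interval (0, 0) (0, int n + 1)) rho_word {}"
    by (intro back_forth_lex_interval_empty) (simp add: gap_def)
qed

lemma back_forth_unary:
  assumes "2 ^ k \<le> n + 1" "2 ^ k \<le> n' + 1" shows "back_forth k (unary_word n) (unary_word n') {}"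
  using assms back_forth_unary_rho back_forth_empty_sym back_forth_empty_trans by metis

section \<open>Saturation\<close>

lemma infinite_diagonal:
  assumes "\<And>k::nat. infinite {j::nat. P k j}"
  obtains r :: "nat \<Rightarrow> nat" where "strict_mono r" "\<And>k. P k (r k)"
proof -
  have "\<exists>r. \<forall>k. P k (r k) \<and> r k < r (Suc k)"
  proof (rule dependent_nat_choice)
    show "\<exists>j. P 0 j" using not_finite_existsD[OF assms[of 0]] by blast
    show "\<exists>j. P (Suc k) j \<and> i < j" for i k
      using assms[of "Suc k"] by (auto simp: infinite_nat_iff_unbounded)
  qed
  then show thesis using that by (auto simp: strict_mono_Suc_iff)
qed

text \<open>A single \<open>x\<close> serves every depth. As \<open>r\<close> is strictly
  increasing, \<open>k \<le> r k\<close>: a property holding from some stage of the sequence on is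
  available at the depth where it is compared, and limits can be nested.\<close>

definition saturated :: "('p, 'a) lword \<Rightarrow> bool" where
  "saturated u \<longleftrightarrow> (\<forall>A (p :: nat \<Rightarrow> 'p). finite A \<longrightarrow> A \<subseteq> positions u \<longrightarrow> range p \<subseteq> positions u \<longrightarrow>
     (\<exists>x r. strict_mono r \<and> (\<forall>k. back_forth k u u (insert (x, p (r k)) (Id_on A)))))"

lemma saturatedI:
  assumes "\<And>A p. finite A \<Longrightarrow> A \<subseteq> positions u \<Longrightarrow> (\<And>j::nat. p j \<in> positions u) \<Longrightarrow>
     \<exists>x r. strict_mono r \<and> (\<forall>k. back_forth k u u (insert (x, p (r k)) (Id_on A)))"
  shows "saturated u"
  unfolding saturated_def by (intro allI impI assms) (simp_all add: image_subset_iff)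

lemma saturatedE:
  assumes "saturated u" "finite A" "A \<subseteq> positions u" "\<And>j::nat. p j \<in> positions u"
  obtains x r where "strict_mono r" "x \<in> positions u"
    "\<And>k. back_forth k u u (insert (x, p (r k)) (Id_on A))"
proof -
  obtain x r where *: "strict_mono r" "\<And>k. back_forth k u u (insert (x, p (r k)) (Id_on A))"
    using assms(1)[unfolded saturated_def, rule_format, OF assms(2,3), of p] assms(4) by auto
  moreover have "x \<in> positions u" using part_isoD(1)[OF back_forth_part_iso[OF *(2)[of 0]]] by blast
  ultimately show thesis using that by blast
qed

lemma is_iso_inverse:
  assumes "is_iso f u v"
  obtains g where "is_iso g v u" "\<And>q. q \<in> positions v \<Longrightarrow> f (g q) = q"
    "\<And>p. p \<in> positions u \<Longrightarrow> g (f p) = p"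
proof -
  have "bij_betw f (positions u) (positions v)" using assms by (simp add: is_iso_def)
  then show thesis using that[OF is_iso_inv[OF assms]]
    by (metis bij_betw_imp_inj_on f_the_inv_into_f_bij_betw the_inv_into_f_f)
qed

text \<open>Types are moved by composing three relations: the graph of \<open>g\<close> into the
  original word, the equivalence found there, and the graph of \<open>f\<close> back.\<close>

lemma saturated_iso:
  assumes "is_iso f u v" "saturated u" shows "saturated v"
proof (rule saturatedI)
  obtain g where g: "is_iso g v u" "\<And>q. q \<in> positions v \<Longrightarrow> f (g q) = q"
    "\<And>p. p \<in> positions u \<Longrightarrow> g (f p) = p"
    by (rule is_iso_inverse[OF assms(1)]) (rule that)
  fix A p assume A: "finite A" "A \<subseteq> positions v" "\<And>j::nat. p j \<in> positions v"
  have gpos: "g q \<in> positions u" if "q \<in> positions v" for q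
    using g(1) that by (auto simp: is_iso_def dest: bij_betw_apply)
  have fpos: "f x \<in> positions v" if "x \<in> positions u" for x
    using assms(1) that by (auto simp: is_iso_def dest: bij_betw_apply)
  have gA: "g ` A \<subseteq> positions u" using gpos A(2) by blast
  obtain x r where r: "strict_mono r" "x \<in> positions u"
    "\<And>k. back_forth k u u (insert (x, g (p (r k))) (Id_on (g ` A)))"
    using saturatedE[OF assms(2) finite_imageI[OF A(1)] gA, of "\<lambda>j. g (p j)"] gpos A(3) by metis
  have "back_forth k v v (insert (f x, p (r k)) (Id_on A))" for k
  proof -
    let ?P = "(\<lambda>q. (q, g q)) ` insert (f x) A"
    let ?Q = "insert (x, g (p (r k))) (Id_on (g ` A))"
    let ?R = "(\<lambda>q. (q, f q)) ` insert (g (p (r k))) (g ` A)"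
    have "back_forth k v u ?P"
      by (rule is_iso_back_forth[OF g(1)]) (use A fpos r(2) in auto)
    moreover have "back_forth k u v ?R"
      by (rule is_iso_back_forth[OF assms(1)]) (use A gpos in auto)
    ultimately have "back_forth k v v (?P O ?Q O ?R)"
      using r(3)[of k] by (blast intro: back_forth_trans)
    moreover have "(f x, p (r k)) \<in> ?P O ?Q O ?R"
      by (rule relcompI[of _ x], use g(3) r(2) in simp, rule relcompI[of _ "g (p (r k))"])
        (use g(2) A in simp_all)
    moreover have "(a, a) \<in> ?P O ?Q O ?R" if "a \<in> A" for a
      by (rule relcompI[of _ "g a"], use that in simp, rule relcompI[of _ "g a"])
        (use g(2)[of a] A(2) that in \<open>auto simp: image_iff\<close>)
    ultimately show ?thesis by (elim back_forth_subset) auto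
  qed
  then show "\<exists>x r. strict_mono r \<and> (\<forall>k. back_forth k v v (insert (x, p (r k)) (Id_on A)))"
    using r(1) by blast
qed

lemma saturated_singleton:
  assumes "positions u = {a}" shows "saturated u"
proof (rule saturatedI)
  fix A p assume A: "finite A" "A \<subseteq> positions u" "\<And>j::nat. p j \<in> positions u"
  have "insert (a, p (id k)) (Id_on A) = Id_on {a}" for k
    using A assms by (auto simp: Id_on_def)
  then have "back_forth k u u (insert (a, p (id k)) (Id_on A))" for k
    using assms by (simp add: back_forth_Id_on)
  then show "\<exists>x r. strict_mono r \<and> (\<forall>k. back_forth k u u (insert (x, p (r k)) (Id_on A)))"
    using strict_mono_id by blast
qed

text \<open>One summand contains infinitely many terms of the sequence. The limit is taken there,
  while parameters of the other summand are answered by themselves.\<close>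

lemma saturated_lconcat:
  assumes "saturated u" "saturated v" shows "saturated (lconcat u v)"
proof (rule saturatedI)
  fix A and p :: "nat \<Rightarrow> 'a + 'c"
  assume A: "finite A" "A \<subseteq> positions (lconcat u v)" and p: "\<And>j. p j \<in> positions (lconcat u v)"
  define L where "L = Inl -` A"
  define R where "R = Inr -` A"
  have LR: "finite L" "finite R" "L \<subseteq> positions u" "R \<subseteq> positions v"
    using A by (auto simp: L_def R_def finite_vimageI lconcat_def)
  have Id: "Id_on A = map_prod Inl Inl ` Id_on L \<union> map_prod Inr Inr ` Id_on R"
  proof -
    have "A = Inl ` L \<union> Inr ` R" unfolding L_def R_def
      by (simp add: image_vimage_eq flip: Int_Un_distrib UNIV_sum)
    then show ?thesis by (auto simp: Id_on_def)
  qed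
  let ?goal = "\<exists>x r. strict_mono r \<and> (\<forall>k. back_forth k (lconcat u v) (lconcat u v)
      (insert (x, p (r k)) (Id_on A)))"
  have "infinite {j. \<exists>a. p j = Inl a} \<or> infinite {j. \<exists>b. p j = Inr b}"
  proof -
    have "{j. \<exists>a. p j = Inl a} \<union> {j. \<exists>b. p j = Inr b} = UNIV"
      by (auto intro: sum.exhaust)
    then show ?thesis by (metis finite_UnI infinite_UNIV_nat)
  qed
  then show ?goal
  proof
    assume "infinite {j. \<exists>a. p j = Inl a}"
    from infinite_enumerate[OF this] obtain s :: "nat \<Rightarrow> nat"
      where s: "strict_mono s" "\<And>j. \<exists>a. p (s j) = Inl a" by auto
    then obtain q where q: "\<And>j. p (s j) = Inl (q j)" by metis
    then have "q j \<in> positions u" for j using p[of "s j"] by (simp add: lconcat_sel)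
    then obtain x r where r: "strict_mono r"
      "\<And>k. back_forth k u u (insert (x, q (r k)) (Id_on L))"
      using saturatedE[OF assms(1) LR(1,3)] by metis
    have "back_forth k (lconcat u v) (lconcat u v) (insert (Inl x, p ((s \<circ> r) k)) (Id_on A))" for k
      using back_forth_lconcat[OF r(2) back_forth_Id_on[OF LR(4)]] by (simp add: q Id)
    then show ?goal using strict_mono_o[OF s(1) r(1)] by blast
  next
    assume "infinite {j. \<exists>a. p j = Inr a}"
    from infinite_enumerate[OF this] obtain s :: "nat \<Rightarrow> nat"
      where s: "strict_mono s" "\<And>j. \<exists>a. p (s j) = Inr a" by auto
    then obtain q where q: "\<And>j. p (s j) = Inr (q j)" by metis
    then have "q j \<in> positions v" for j using p[of "s j"] by (simp add: lconcat_sel)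
    then obtain x r where r: "strict_mono r"
      "\<And>k. back_forth k v v (insert (x, q (r k)) (Id_on R))"
      using saturatedE[OF assms(2) LR(2,4)] by metis
    have "back_forth k (lconcat u v) (lconcat u v) (insert (Inr x, p ((s \<circ> r) k)) (Id_on A))" for k
      using back_forth_lconcat[OF back_forth_Id_on[OF LR(3)] r(2)] by (simp add: q Id)
    then show ?goal using strict_mono_o[OF s(1) r(1)] by blast
  qed
qed

text \<open>Two nested limits: \<open>t\<close> for the indices, over the indices of all parameters,
  and then, along that subsequence, \<open>x\<close> for the offsets, over the parameters in the
  block of \<open>t\<close>.\<close>

lemma saturated_lsum:
  assumes "saturated u" "saturated w" shows "saturated (lsum (\<lambda>_. u) w)"
proof (rule saturatedI)
  fix A and p :: "nat \<Rightarrow> 'a \<times> 'c"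
  assume A: "finite A" "A \<subseteq> positions (lsum (\<lambda>_. u) w)"
    and p: "\<And>j. p j \<in> positions (lsum (\<lambda>_. u) w)"
  let ?fib = "\<lambda>t. {x. (x, t) \<in> A}"
  have pos: "fst (p j) \<in> positions u" "snd (p j) \<in> positions w" for j
    using p[of j] by (cases "p j"; simp add: lsum_sel)+
  have Apos: "?fib t \<subseteq> positions u" "snd ` A \<subseteq> positions w" for t
    using A(2) by (auto simp: lsum_def)
  obtain t s where s: "strict_mono s"
    "\<And>k. back_forth k w w (insert (t, snd (p (s k))) (Id_on (snd ` A)))"
    using saturatedE[OF assms(2) finite_imageI[OF A(1)] Apos(2), of "\<lambda>j. snd (p j)"] pos(2) by metis
  have "finite (?fib t)"
    by (rule finite_subset[OF _ finite_imageI[OF A(1), of fst]]) force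
  then obtain x r where r: "strict_mono r"
    "\<And>k. back_forth k u u (insert (x, fst (p (s (r k)))) (Id_on (?fib t)))"
    using saturatedE[OF assms(1) _ Apos(1), of t "\<lambda>j. fst (p (s j))"] pos(1) by metis
  have "back_forth k (lsum (\<lambda>_. u) w) (lsum (\<lambda>_. u) w) (insert ((x, t), p ((s \<circ> r) k)) (Id_on A))" for k
  proof -
    let ?t = "snd (p (s (r k)))" and ?x = "fst (p (s (r k)))"
    let ?P = "insert ((x, t), p ((s \<circ> r) k)) (Id_on A)"
    let ?R = "insert (t, ?t) (Id_on (snd ` A))"
    \<comment> \<open>The second extraction uses stage \<open>r k\<close> of the first, where the
      indices agree to depth \<open>r k\<close>; this suffices since
      \<open>k \<le> r k\<close>.\<close>
    have bf: "back_forth k w w ?R"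
      using back_forth_mono[OF s(2)[of "r k"]] strict_mono_imp_increasing[OF r(1), of k] by blast
    show ?thesis
    proof (rule back_forth_lsum[OF bf])
      fix y i z j assume "((y, i), (z, j)) \<in> ?P"
      then show "(i, j) \<in> ?R"
        using image_eqI[of i snd "(y, i)" A] by (auto simp: prod_eq_iff)
    next
      fix i j assume ij: "(i, j) \<in> ?R"
      have "{(y, z). ((y, i), (z, j)) \<in> ?P} \<subseteq> insert (x, ?x) (Id_on (?fib t))"
        if "i = t" "j = ?t"
        using that by (auto simp: prod_eq_iff)
      moreover have "{(y, z). ((y, i), (z, j)) \<in> ?P} \<subseteq> Id_on (?fib i)"
        if "(i, j) \<noteq> (t, ?t)"
        using that by (auto simp: prod_eq_iff)
      ultimately show "back_forth k u u {(y, z). ((y, i), (z, j)) \<in> ?P}"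
        using back_forth_subset[OF r(2)] back_forth_subset[OF back_forth_Id_on[OF Apos(1)]]
        by blast
    qed (simp add: back_forth_refl)
  qed
  then show "\<exists>x r. strict_mono r \<and> (\<forall>k. back_forth k (lsum (\<lambda>_. u) w) (lsum (\<lambda>_. u) w)
      (insert (x, p (r k)) (Id_on A)))"
    using strict_mono_o[OF s(1) r(1)] by blast
qed

section \<open>Saturation of lexicographic intervals\<close>

lemma abs_gap_le: "0 \<le> m \<Longrightarrow> \<bar>gap m p q\<bar> \<le> m"
  by (auto simp: gap_def)

lemma finite_near:
  assumes "finite Q" shows "finite {x. \<exists>c\<in>Q. \<bar>gap m c x\<bar> < m}"
proof -
  have "{x. \<bar>gap m c x\<bar> < m} \<subseteq> Pair (fst c) ` {snd c - m..snd c + m}" for c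
  proof
    fix x assume "x \<in> {x. \<bar>gap m c x\<bar> < m}"
    then have "fst x = fst c" "snd c - m \<le> snd x" "snd x \<le> snd c + m"
      by (auto simp: gap_def split: if_splits)
    then show "x \<in> Pair (fst c) ` {snd c - m..snd c + m}" by (intro image_eqI[of _ _ "snd x"]) (auto simp: prod_eq_iff)
  qed
  then have "finite {x. \<bar>gap m c x\<bar> < m}" for c by (rule finite_subset) simp
  then have "finite (\<Union>c\<in>Q. {x. \<bar>gap m c x\<bar> < m})" using assms by blast
  moreover have "(\<Union>c\<in>Q. {x. \<bar>gap m c x\<bar> < m}) = {x. \<exists>c\<in>Q. \<bar>gap m c x\<bar> < m}" by auto
  ultimately show ?thesis by simp
qed

lemma finite_between: "fst c = fst d \<Longrightarrow> finite {c<..<d :: rat \<times> int}"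
  by (rule finite_subset[of _ "Pair (fst c) ` {snd c..snd d}"])
    (auto simp: less_prod_def' intro!: image_eqI)

text \<open>A value taken infinitely often is its own limit. Otherwise the sequence leaves every
  finite set, so some cut of the parameters contains, for each bound, infinitely many terms farther
  than that from all parameters. Such a cut cannot lie within one copy of the integers; hence a
  rational fits strictly inside it, and a point over this rational is infinitely far from every
  parameter.\<close>

lemma saturated_lex_interval: "saturated (lex_interval a b)"
proof (rule saturatedI)
  fix A p assume A: "finite A" "A \<subseteq> positions (lex_interval a b)"
    and p: "\<And>j::nat. p j \<in> positions (lex_interval a b)"
  let ?goal = "\<exists>x r. strict_mono r \<and> (\<forall>k. back_forth k (lex_interval a b) (lex_interval a b)
      (insert (x, p (r k)) (Id_on A)))"
  have pab: "a < p j" "p j < b" for j using p[of j] by (auto simp: lex_interval_def)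
  show ?goal
  proof (cases "\<exists>x. infinite {j. p j = x}")
    case True
    then obtain x where "infinite {j. p j = x}" ..
    from infinite_enumerate[OF this] obtain r :: "nat \<Rightarrow> nat"
      where r: "strict_mono r" "\<And>k. p (r k) = x" by auto
    have "back_forth k (lex_interval a b) (lex_interval a b) (insert (x, p (r k)) (Id_on A))" for k
    proof -
      have "insert (x, p (r k)) (Id_on A) = Id_on (insert x A)" using r(2) by (auto simp: Id_on_def)
      then show ?thesis using back_forth_Id_on[of "insert x A" "lex_interval a b"] A(2) p[of "r k"] r(2)[of k] by simp
    qed
    then show ?goal using r(1) by blast
  next
    case False
    then have fin_pre: "finite {j. p j \<in> X}" if "finite X" for X
    proof -
      have "{j. p j \<in> X} = (\<Union>x\<in>X. {j. p j = x})" by auto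
      moreover have "finite (\<Union>x\<in>X. {j. p j = x})"
        by (rule finite_UN_I[OF that]) (use False in blast)
      ultimately show ?thesis by simp
    qed
    \<comment> \<open>The ends count as parameters, which makes both sides of every cut
      nonempty.\<close>
    define Q where "Q = insert a (insert b A)"
    have Q: "finite Q" "a \<in> Q" "b \<in> Q" using A(1) by (auto simp: Q_def)
    have "finite ((\<lambda>j. {c \<in> Q. c < p j}) ` UNIV)"
      by (rule finite_subset[of _ "Pow Q"]) (use Q in auto)
    then obtain i where "infinite {j. {c \<in> Q. c < p j} = {c \<in> Q. c < p i}}"
      using pigeonhole_infinite[OF infinite_UNIV_nat, of "\<lambda>j. {c \<in> Q. c < p j}"] by auto
    moreover define L where "L = {c \<in> Q. c < p i}"
    ultimately have L: "infinite {j. {c \<in> Q. c < p j} = L}" by simp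
    have LQ: "L \<subseteq> Q" "finite L" "finite (Q - L)" "a \<in> L" "b \<in> Q - L"
      using Q pab[of i] by (auto simp: L_def)
    have far: "infinite {j. {c \<in> Q. c < p j} = L \<and> (\<forall>c\<in>Q. \<not> \<bar>gap m c (p j)\<bar> < m)}" for m
    proof -
      have "infinite ({j. {c \<in> Q. c < p j} = L} - {j. p j \<in> {x. \<exists>c\<in>Q. \<bar>gap m c x\<bar> < m}})"
        by (rule Diff_infinite_finite[OF fin_pre[OF finite_near[OF Q(1)]] L])
      then show ?thesis by (rule infinite_super[rotated]) blast
    qed
    \<comment> \<open>With cut-off \<open>1\<close>, being far only says that \<open>p j\<close> is
      no parameter, so the terms of the cut lie strictly between \<open>c\<close> and
      \<open>d\<close>. Within one copy of the integers only finitely many points do.\<close>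
    have sep: "fst c < fst d" if cd: "c \<in> L" "d \<in> Q - L" for c d
    proof (rule ccontr)
      assume *: "\<not> fst c < fst d"
      have sub: "{j. {c \<in> Q. c < p j} = L \<and> (\<forall>c\<in>Q. \<not> \<bar>gap 1 c (p j)\<bar> < 1)} \<subseteq> {j. p j \<in> {c<..<d}}"
      proof safe
        fix j assume "\<forall>c\<in>Q. \<not> \<bar>gap 1 c (p j)\<bar> < 1" "L = {c \<in> Q. c < p j}"
        moreover have "d \<noteq> p j" using calculation(1) cd(2) gap_self[of 1 d] by auto
        ultimately show "p j \<in> {c<..<d}" using cd LQ(1) by auto
      qed
      obtain j where "c < p j" "p j < d"
        using sub far[of 1] not_finite_existsD[OF far[of 1]] by fastforce
      then have "fst c = fst d" using * by (auto simp: less_prod_def')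
      then have "finite {j. p j \<in> {c<..<d}}" by (intro fin_pre finite_between)
      then show False using finite_subset[OF sub] far[of 1] by blast
    qed
    have "Max (fst ` L) \<in> fst ` L" "Min (fst ` (Q - L)) \<in> fst ` (Q - L)"
      by (rule Max_in Min_in; use LQ in auto)+
    then obtain c d where "c \<in> L" "Max (fst ` L) = fst c" "d \<in> Q - L" "Min (fst ` (Q - L)) = fst d"
      by (elim imageE)
    then have "Max (fst ` L) < Min (fst ` (Q - L))" using sep by simp
    then obtain z where z: "Max (fst ` L) < z" "z < Min (fst ` (Q - L))" using dense by blast
    have zL: "fst c < z" if "c \<in> L" for c
      using Max_ge[OF finite_imageI[OF LQ(2)] imageI[OF that]] z(1) by (rule order.strict_trans1)
    have zQ: "z < fst c" if "c \<in> Q - L" for c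
      using z(2) Min_le[OF finite_imageI[OF LQ(3)] imageI[OF that]] by (rule order.strict_trans2)
    \<comment> \<open>The integer part is arbitrary; the first component alone makes all distances
      infinite.\<close>
    define x where "x = (z, 0::int)"
    \<comment> \<open>At stage \<open>k\<close> the chosen term is at distance at least
      \<open>2 ^ k\<close> from every parameter, so \<open>gap (2 ^ k)\<close> cannot tell it from
      the infinitely distant \<open>x\<close>.\<close>
    obtain r where r: "strict_mono r"
      "\<And>k. {c \<in> Q. c < p (r k)} = L \<and> (\<forall>c\<in>Q. \<not> \<bar>gap (2 ^ k) c (p (r k))\<bar> < 2 ^ k)"
      using infinite_diagonal[of "\<lambda>k j. {c \<in> Q. c < p j} = L \<and> (\<forall>c\<in>Q. \<not> \<bar>gap (2 ^ k) c (p j)\<bar> < 2 ^ k)"]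
        far by blast
    have "back_forth k (lex_interval a b) (lex_interval a b) (insert (x, p (r k)) (Id_on A))" for k
    proof (rule back_forth_lex_interval)
      show "finite (insert (x, p (r k)) (Id_on A))" using A(1) by (simp add: Id_on_def)
      have "a < x" "x < b" using zL[OF LQ(4)] zQ[OF LQ(5)] by (auto simp: x_def less_prod_def')
      then show "insert (x, p (r k)) (Id_on A) \<subseteq> {a<..<b} \<times> {a<..<b}"
        using A(2) pab by (auto simp: lex_interval_def)
      have gap: "gap (2 ^ k) c x = gap (2 ^ k) c (p (r k))" if c: "c \<in> Q" for c
      proof -
        have m: "(1::int) \<le> 2 ^ k" by simp
        have b: "\<bar>gap (2 ^ k) c (p (r k))\<bar> = 2 ^ k"
          using r(2)[of k] c abs_gap_le[of "2 ^ k" c "p (r k)"] by force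
        show ?thesis
        proof (cases "c \<in> L")
          case True
          then have "0 < gap (2 ^ k) c (p (r k))" using r(2)[of k] less_iff_gap[OF m] by blast
          then show ?thesis using b zL[OF True] by (simp add: gap_def[of _ c "(z, 0)"] x_def)
        next
          case False
          then have "\<not> 0 < gap (2 ^ k) c (p (r k))" using r(2)[of k] less_iff_gap[OF m] c by blast
          then show ?thesis using b zQ[of c] False c by (simp add: gap_def[of _ c "(z, 0)"] x_def)
        qed
      qed
      have "same_gaps (2 ^ k) (Id_on Q)" by (rule same_gapsI) auto
      then have "same_gaps (2 ^ k) (insert (x, p (r k)) (Id_on Q))"
        using gap by (intro same_gaps_insert) (simp_all add: Id_on_iff)
      moreover have "insert (a, a) (insert (b, b) (insert (x, p (r k)) (Id_on A))) =
          insert (x, p (r k)) (Id_on Q)" by (auto simp: Q_def Id_on_def)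
      ultimately show "same_gaps (2 ^ k) (insert (a, a) (insert (b, b) (insert (x, p (r k)) (Id_on A))))"
        by simp
    qed
    then show ?goal using r(1) by blast
  qed
qed

section \<open>Structured representatives of abstract words\<close>

definition represents :: "('p, 'a) lword \<Rightarrow> 'a gword \<Rightarrow> bool" where
  "represents u g \<longleftrightarrow> word_iso u (rep_gword g)"

lemma represents_wf: "represents u g \<Longrightarrow> wf_lword u"
  unfolding represents_def by (rule word_iso_wf(1))

lemma represents_rep: "represents (rep_gword g) g"
  unfolding represents_def using Quotient3_rep_reflp[OF Quotient3_gword] .

lemma represents_cong: "word_iso v u \<Longrightarrow> represents u g \<Longrightarrow> represents v g"
  unfolding represents_def by (rule word_iso_trans)

lemma represents_abs: "wf_lword u \<Longrightarrow> represents u (abs_gword u)"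
  unfolding represents_def
  by (rule word_iso_sym, rule Quotient3_rep_abs[OF Quotient3_gword]) (rule word_iso_refl)

lemma represents_abs_encode: "wf_lword u \<Longrightarrow> represents u (abs_gword (encode u))"
  using represents_cong[OF word_iso_encode represents_abs[OF encode_wf]] .

lemma represents_wconcat:
  assumes "represents u g" "represents v h" shows "represents (lconcat u v) (wconcat g h)"
proof -
  have "word_iso (rep_gword g) (rep_gword g)" "word_iso (rep_gword h) (rep_gword h)"
    using represents_rep unfolding represents_def by blast+
  from wconcat.abs_eq[OF this]
  have "wconcat g h = abs_gword (encode (lconcat (rep_gword g) (rep_gword h)))"
    by (simp add: Quotient3_abs_rep[OF Quotient3_gword])
  moreover have "represents (lconcat (rep_gword g) (rep_gword h)) \<dots>"
    by (intro represents_abs_encode lconcat_wf represents_wf[OF represents_rep])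
  ultimately show ?thesis
    using represents_cong[OF lconcat_cong] assms unfolding represents_def[of u] represents_def[of v] by metis
qed

lemma represents_wpower:
  assumes "represents u g" "represents v h" shows "represents (lpower u v) (wpower g h)"
proof -
  have "word_iso (rep_gword g) (rep_gword g)" "word_iso (rep_gword h) (rep_gword h)"
    using represents_rep unfolding represents_def by blast+
  from wpower.abs_eq[OF this]
  have "wpower g h = abs_gword (encode (lpower (rep_gword g) (rep_gword h)))"
    by (simp add: Quotient3_abs_rep[OF Quotient3_gword])
  moreover have "represents (lpower (rep_gword g) (rep_gword h)) \<dots>"
    by (intro represents_abs_encode lpower_wf represents_wf[OF represents_rep])
  ultimately show ?thesis
    using represents_cong[OF lpower_cong] assms unfolding represents_def[of u] represents_def[of v] by metis
qed

definition order_word :: "'t::linorder set \<Rightarrow> ('t, unit) lword" where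
  "order_word S = \<lparr>positions = S, leq = {(p, q). p \<in> S \<and> q \<in> S \<and> p \<le> q}, label = (\<lambda>_. ())\<rparr>"

lemma represents_order_type_of: "represents (order_word S) (order_type_of S)"
proof -
  have "wf_lword (order_word S)" by (rule wf_lwordI) (auto simp: order_word_def)
  from represents_abs_encode[OF this] show ?thesis
    by (simp add: order_type_of_def order_word_def)
qed

text \<open>The map \<open>q / (1 + |q|)\<close> squeezes the rationals increasingly onto the open
  interval from \<open>-1\<close> to \<open>1\<close>, which frees the two outer fibres for omega
  and its reverse. \<open>lpower\<close> puts the copy index second, while the lexicographic order
  compares first components first; hence the swap of coordinates.\<close>

lemma represents_rho: "represents rho_word rho"
proof (rule represents_cong)
  let ?N = "order_word (UNIV :: nat set)" and ?Z = "order_word (UNIV :: int set)"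
  let ?Q = "order_word (UNIV :: rat set)" and ?M = "order_word {..<0 :: int}"
  let ?w = "lconcat (lconcat ?N (lpower ?Z ?Q)) ?M"
  show *: "represents ?w rho" unfolding rho_def
    by (intro represents_wconcat represents_wpower represents_order_type_of)
  define h :: "rat \<Rightarrow> rat" where "h q = q / (1 + \<bar>q\<bar>)" for q
  define h' :: "rat \<Rightarrow> rat" where "h' q = q / (1 - \<bar>q\<bar>)" for q
  have h: "- 1 < h q" "h q < 1" "h' (h q) = q" for q
  proof -
    show "- 1 < h q" "h q < 1" by (auto simp: h_def field_simps abs_if)
    have "1 - \<bar>h q\<bar> = 1 / (1 + \<bar>q\<bar>)" by (simp add: h_def abs_divide field_simps)
    then have "h' (h q) = h q * (1 + \<bar>q\<bar>)" by (simp add: h'_def)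
    then show "h' (h q) = q" by (simp add: h_def add_eq_0_iff)
  qed
  have h': "h (h' q) = q" if "- 1 < q" "q < 1" for q
  proof -
    have pos: "0 < 1 - \<bar>q\<bar>" using that by auto
    then have "1 + \<bar>h' q\<bar> = 1 / (1 - \<bar>q\<bar>)" by (simp add: h'_def abs_divide field_simps)
    then have "h (h' q) = h' q * (1 - \<bar>q\<bar>)" by (simp add: h_def)
    then show "h (h' q) = q" using pos by (simp add: h'_def)
  qed
  have mono: "h q < h q' \<longleftrightarrow> q < q'" for q q'
  proof -
    have less: "h q < h q'" if "q < q'" for q q'
    proof -
      \<comment> \<open>With equal signs the two products coincide; with different signs the left
        one is at most 0 and the right one at least 0.\<close>
      have "q * \<bar>q'\<bar> \<le> q' * \<bar>q\<bar>" using that by (auto simp: abs_if mult_le_0_iff intro: order.trans[of _ 0])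
      then have "q * (1 + \<bar>q'\<bar>) < q' * (1 + \<bar>q\<bar>)" using that by (simp add: distrib_left)
      moreover have "0 < 1 + \<bar>z\<bar>" for z :: rat by simp
      ultimately show ?thesis unfolding h_def
        by (intro mult_imp_div_pos_less) (simp_all add: mult_imp_less_div_pos)
    qed
    show ?thesis using less[of q q'] less[of q' q] by (cases q q' rule: linorder_cases) auto
  qed
  have mono_le: "h q \<le> h q' \<longleftrightarrow> q \<le> q'" for q q' using mono[of q' q] by (simp flip: linorder_not_less)
  have h_neq: "\<not> h q < - 1" "\<not> 1 < h q" "\<not> h q \<le> - 1" "\<not> 1 \<le> h q" "- 1 \<le> h q" "h q \<le> 1" for q
    using h(1,2)[of q] by simp_all
  \<comment> \<open>The interval is open at \<open>(-1, 0)\<close>, so its first point is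
    \<open>(-1, 1)\<close> and \<open>n\<close> goes to \<open>n + 1\<close>.\<close>
  define f where "f x = (case x of Inl (Inl n) \<Rightarrow> (- 1, int n + 1) | Inl (Inr (i, q)) \<Rightarrow> (h q, i)
     | Inr i \<Rightarrow> (1, i))" for x :: "(nat + int \<times> rat) + int"
  define g where "g p = (if fst p = - 1 then Inl (Inl (nat (snd p - 1))) else
     if fst p = 1 then Inr (snd p) else Inl (Inr (snd p, h' (fst p))))" for p :: "rat \<times> int"
  have pos: "positions rho_word = {(-1, 0)<..<(1, 0)}" by (simp add: lex_interval_def)
  have posw: "positions ?w = {x. case x of Inl _ \<Rightarrow> True | Inr i \<Rightarrow> i < 0}"
  proof (rule Set.set_eqI)
    show "x \<in> positions ?w \<longleftrightarrow> x \<in> {x. case x of Inl _ \<Rightarrow> True | Inr i \<Rightarrow> i < 0}" for x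
      by (cases x) (auto simp: lconcat_def lpower_def order_word_def)
  qed
  have bij: "bij_betw f (positions ?w) (positions rho_word)"
  proof (rule bij_betw_byWitness[where f' = g])
    show "\<forall>x\<in>positions ?w. g (f x) = x"
      unfolding posw using h by (auto simp: f_def g_def split: sum.splits)
        (metis less_irrefl)+
    show "\<forall>p\<in>positions rho_word. f (g p) = p"
      unfolding pos using h' by (auto simp: f_def g_def less_prod_def' split: sum.splits)
    show "f ` positions ?w \<subseteq> positions rho_word"
      unfolding posw pos using h by (auto simp: f_def less_prod_def' split: sum.splits)
    show "g ` positions rho_word \<subseteq> positions ?w"
      unfolding posw pos by (auto simp: g_def less_prod_def')
  qed
  have ord: "\<forall>x y. x \<in> positions ?w \<longrightarrow> y \<in> positions ?w \<longrightarrow> (f x \<le> f y \<longleftrightarrow> (x, y) \<in> leq ?w)"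
    unfolding posw split_sum_all f_def
    by (simp add: lconcat_sel lpower_sel order_word_def less_eq_prod_def mono mono_le h_neq h(1,2))
      auto
  have leq: "(x, y) \<in> leq ?w \<longleftrightarrow> (f x, f y) \<in> leq rho_word"
    if xy: "x \<in> positions ?w" "y \<in> positions ?w" for x y
  proof -
    have "f x \<in> {(-1, 0)<..<(1, 0)}" "f y \<in> {(-1, 0)<..<(1, 0)}"
      using bij_betw_apply[OF bij] xy unfolding pos by blast+
    then have "(f x, f y) \<in> leq rho_word \<longleftrightarrow> f x \<le> f y" by (simp add: lex_interval_def)
    also have "\<dots> \<longleftrightarrow> (x, y) \<in> leq ?w" using ord xy by blast
    finally show ?thesis ..
  qed
  have "is_iso f ?w rho_word" unfolding is_iso_def by (intro conjI ballI bij leq) simp_all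
  moreover have "wf_lword rho_word" by (rule wf_lwordI) (auto simp: lex_interval_def)
  ultimately show "word_iso rho_word ?w"
    using represents_wf[OF *] by (intro word_iso_sym[OF word_isoI])
qed

section \<open>Words of terms\<close>

text \<open>The value of a term with pi read as \<open>n\<close>-th power. As a list it is both an
  approximation of the infinite word and a word whose class lives in a syntactic monoid.\<close>

lift_definition finite_word :: "nat \<Rightarrow> 'a piterm \<Rightarrow> 'a list" is
  "\<lambda>n. raw_ext (@) (\<lambda>w. concat (replicate n w)) (\<lambda>a. [a])"
  subgoal for n s t by (induction rule: assoc_eq.induct) simp_all
  done

lemma finite_word_simps [simp]:
  "finite_word n (Letter a) = [a]"
  "finite_word n (Mult s t) = finite_word n s @ finite_word n t"
  "finite_word n (Pi_pow t) = concat (replicate n (finite_word n t))"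
  by (transfer, simp)+

lemma concat_replicate_in_lists: "w \<in> lists A \<Longrightarrow> concat (replicate n w) \<in> lists A"
  by (induction n) auto

lemma finite_word_letters: "\<exists>A. finite A \<and> (\<forall>n. finite_word n t \<in> lists A)"
proof (induction t)
  case (Letter a)
  then show ?case by (intro exI[of _ "{a}"]) simp
next
  case (Mult s t)
  then obtain A B where "finite A" "\<And>n. finite_word n s \<in> lists A"
    "finite B" "\<And>n. finite_word n t \<in> lists B" by blast
  moreover have "lists A \<subseteq> lists (A \<union> B)" "lists B \<subseteq> lists (A \<union> B)" by (simp_all add: lists_mono)
  ultimately show ?case
    by (intro exI[of _ "A \<union> B"]) (simp add: subset_iff)
next
  case (Pi_pow t)
  then show ?case by (metis concat_replicate_in_lists finite_word_simps(3))
qed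

lemma of_list_append_iso:
  "is_iso (case_sum id (\<lambda>j. length xs + j)) (lconcat (of_list xs) (of_list ys)) (of_list (xs @ ys))"
proof -
  let ?f = "case_sum id (\<lambda>j. length xs + j)"
  have "bij_betw ?f (positions (lconcat (of_list xs) (of_list ys))) (positions (of_list (xs @ ys)))"
    by (rule bij_betw_byWitness[where f' = "\<lambda>i. if i \<le> length xs then Inl i else Inr (i - length xs)"])
      (auto simp: lconcat_def of_list_def split: sum.splits)
  moreover have "(p, q) \<in> leq (lconcat (of_list xs) (of_list ys)) \<longleftrightarrow> (?f p, ?f q) \<in> leq (of_list (xs @ ys))"
    if "p \<in> positions (lconcat (of_list xs) (of_list ys))" "q \<in> positions (lconcat (of_list xs) (of_list ys))"
    for p q
    using that by (cases p; cases q) (auto simp: lconcat_sel of_list_def)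
  moreover have "label (of_list (xs @ ys)) (?f p) = label (lconcat (of_list xs) (of_list ys)) p"
    if "p \<in> positions (lconcat (of_list xs) (of_list ys))" for p
    using that by (cases p) (auto simp: lconcat_sel of_list_def nth_append)
  ultimately show ?thesis unfolding is_iso_def by blast
qed

lemma back_forth_append:
  assumes "back_forth k (of_list xs) u {}" "back_forth k (of_list ys) v {}"
  shows "back_forth k (of_list (xs @ ys)) (lconcat u v) {}"
  using back_forth_empty_trans[OF back_forth_empty_sym[OF is_iso_back_forth_empty[OF of_list_append_iso]]
      back_forth_lconcat_empty[OF assms]] .

section \<open>Substituting finite words for letters\<close>

definition subst_word :: "('a \<Rightarrow> 'b list) \<Rightarrow> ('p, 'a) lword \<Rightarrow> (nat \<times> 'p, 'b) lword" where
  "subst_word f w = lsum (\<lambda>p. of_list (f (label w p))) w"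

text \<open>Positions of \<open>of_list\<close> start at 1, so the new first block has index 1 and
  the old blocks move up by one.\<close>

lemma subst_word_Cons_iso:
  "is_iso (case_sum (\<lambda>p. (p, 1)) (\<lambda>(p, t). (p, Suc t)))
     (lconcat (of_list (f x)) (subst_word f (of_list xs))) (subst_word f (of_list (x # xs)))"
proof -
  let ?f = "case_sum (\<lambda>p. (p, 1)) (\<lambda>(p, t). (p, Suc t))"
  let ?u = "lconcat (of_list (f x)) (subst_word f (of_list xs))"
  let ?v = "subst_word f (of_list (x # xs))"
  have sel: "Inl p \<in> positions ?u \<longleftrightarrow> p \<in> {1..length (f x)}"
    "Inr (p, t) \<in> positions ?u \<longleftrightarrow> t \<in> {1..length xs} \<and> p \<in> {1..length (f (xs ! (t - 1)))}" for p t
    by (simp_all add: lconcat_sel subst_word_def lsum_sel of_list_def)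
  have sel': "(p, t) \<in> positions ?v \<longleftrightarrow> t \<in> {1..Suc (length xs)} \<and> p \<in> {1..length (f ((x # xs) ! (t - 1)))}"
    for p t by (simp add: subst_word_def lsum_sel of_list_def)
  have nth: "(x # xs) ! t = xs ! (t - 1)" if "1 \<le> t" for t using that by (cases t) auto
  have "bij_betw ?f (positions ?u) (positions ?v)"
  proof (rule bij_betw_byWitness[where f' = "\<lambda>(p, t). if t = 1 then Inl p else Inr (p, t - 1)"])
    show "\<forall>a\<in>positions ?u. (\<lambda>(p, t). if t = 1 then Inl p else Inr (p, t - 1)) (?f a) = a"
    proof
      fix a assume "a \<in> positions ?u"
      then show "(\<lambda>(p, t). if t = 1 then Inl p else Inr (p, t - 1)) (?f a) = a"
        by (cases a) (auto simp: sel)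
    qed
    show "\<forall>a\<in>positions ?v. ?f ((\<lambda>(p, t). if t = 1 then Inl p else Inr (p, t - 1)) a) = a"
      by (auto simp: sel')
    show "?f ` positions ?u \<subseteq> positions ?v"
    proof
      fix b assume "b \<in> ?f ` positions ?u"
      then obtain a where "a \<in> positions ?u" "b = ?f a" by blast
      then show "b \<in> positions ?v" by (cases a) (auto simp: sel sel' nth)
    qed
    show "(\<lambda>(p, t). if t = 1 then Inl p else Inr (p, t - 1)) ` positions ?v \<subseteq> positions ?u"
      by (auto simp: sel sel' nth)
  qed
  moreover have "(p, q) \<in> leq ?u \<longleftrightarrow> (?f p, ?f q) \<in> leq ?v"
    if "p \<in> positions ?u" "q \<in> positions ?u" for p q
    using that by (cases p; cases q)
      (auto simp: lconcat_sel subst_word_def lsum_sel of_list_def nth)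
  moreover have "label ?v (?f p) = label ?u p" if "p \<in> positions ?u" for p
    using that by (cases p) (auto simp: lconcat_sel subst_word_def lsum_sel of_list_def nth)
  ultimately show ?thesis unfolding is_iso_def by blast
qed

text \<open>Links concatenation of lists, in which syntactic monoids compute, with indexed sums, to
  which the composition lemma applies.\<close>

lemma back_forth_concat_map: "back_forth k (of_list (concat (map f xs))) (subst_word f (of_list xs)) {}"
proof (induction xs)
  case Nil
  have "is_iso (\<lambda>_. undefined) (of_list (concat (map f []))) (subst_word f (of_list []))"
    by (auto simp: is_iso_def subst_word_def lsum_def of_list_def bij_betw_def)
  then show ?case by (rule is_iso_back_forth_empty)
next
  case (Cons x xs)
  have "back_forth k (of_list (concat (map f (x # xs)))) (lconcat (of_list (f x)) (subst_word f (of_list xs))) {}"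
    using back_forth_append[OF back_forth_refl Cons] by simp
  then show ?case by (rule back_forth_empty_trans[OF _ is_iso_back_forth_empty[OF subst_word_Cons_iso]])
qed

lemma back_forth_subst_word:
  "back_forth k u v {} \<Longrightarrow> back_forth k (subst_word f u) (subst_word f v) {}"
  unfolding subst_word_def by (rule back_forth_lsum_empty) (auto intro: back_forth_refl)

text \<open>A power is the substitution of \<open>w\<close> for the only letter of a unary word, so
  that exponents can be exchanged as index orders.\<close>

lemma back_forth_replicate:
  assumes "back_forth k (of_list w) u {}" "back_forth k (unary_word n) v {}"
  shows "back_forth k (of_list (concat (replicate n w))) (lsum (\<lambda>_. u) v) {}"
proof -
  have "back_forth k (of_list (concat (replicate n w))) (lsum (\<lambda>_. of_list w) (unary_word n)) {}"
    using back_forth_concat_map[of k "\<lambda>_. w" "replicate n ()"]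
    by (simp add: subst_word_def unary_word_def)
  moreover have "back_forth k (lsum (\<lambda>_. of_list w) (unary_word n)) (lsum (\<lambda>_. u) v) {}"
    by (rule back_forth_lsum_empty[OF assms(2)]) (rule assms(1))
  ultimately show ?thesis by (rule back_forth_empty_trans)
qed

lemma back_forth_replicate_replicate:
  assumes "2 ^ k \<le> m + 1" "2 ^ k \<le> n + 1"
  shows "back_forth k (of_list (concat (replicate m w))) (of_list (concat (replicate n w))) {}"
  using back_forth_empty_trans[OF back_forth_replicate[OF back_forth_refl back_forth_unary[OF assms]]
      back_forth_empty_sym[OF back_forth_replicate[OF back_forth_refl back_forth_refl]]] .

lemma represents_iso:
  assumes "represents u g" obtains f where "is_iso f u (rep_gword g)"
  using assms unfolding represents_def word_iso_def by blast

lemma back_forth_represents: "represents u g \<Longrightarrow> back_forth k u (rep_gword g) {}"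
  by (meson represents_iso is_iso_back_forth_empty)

lemma represents_wsingle: "represents (of_list [a]) (wsingle a)"
proof (rule represents_cong)
  let ?u = "\<lparr>positions = {0::nat}, leq = {(0, 0)}, label = \<lambda>_. a\<rparr>"
  have wf: "wf_lword ?u" "wf_lword (of_list [a])" by (rule wf_lwordI; force simp: of_list_def)+
  then show "represents ?u (wsingle a)"
    using represents_abs by (simp add: wsingle.abs_eq)
  have "is_iso (\<lambda>_. 0) (of_list [a]) ?u" by (auto simp: is_iso_def of_list_def)
  then show "word_iso (of_list [a]) ?u" using wf by (intro word_isoI)
qed

section \<open>The words of terms at rho\<close>

abbreviation rho_rep :: "'a piterm \<Rightarrow> (nat, 'a) lword" where
  "rho_rep t \<equiv> rep_gword (word_of rho t)"

lemma word_of_simps [simp]: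
  "word_of \<tau> (Letter a) = wsingle a"
  "word_of \<tau> (Mult s t) = wconcat (word_of \<tau> s) (word_of \<tau> t)"
  "word_of \<tau> (Pi_pow t) = wpower (word_of \<tau> t) \<tau>"
  using word_of_morphism[of \<tau>] by (auto simp: pi_morphism_def)

lemma represents_rho_rep:
  "represents (of_list [a]) (word_of rho (Letter a))"
  "represents (lconcat (rho_rep s) (rho_rep t)) (word_of rho (Mult s t))"
  "represents (lsum (\<lambda>_. rho_rep t) rho_word) (word_of rho (Pi_pow t))"
  using represents_wpower[OF represents_rep represents_rho, of "word_of rho t"]
  unfolding lpower_eq_lsum[OF represents_wf[OF represents_rho]]
  by (simp_all add: represents_wsingle represents_wconcat represents_rep)

text \<open>One \<open>n\<close> works for every nesting of powers: composition costs no depth, so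
  each power only needs the orders \<open>n\<close> and rho to agree up to depth
  \<open>k\<close>.\<close>

lemma back_forth_finite_word:
  assumes "2 ^ k \<le> n + 1" shows "back_forth k (of_list (finite_word n t)) (rho_rep t) {}"
proof (induction t)
  case (Letter a)
  show ?case using back_forth_represents[OF represents_rho_rep(1)] by simp
next
  case (Mult s t)
  show ?case
    using back_forth_empty_trans[OF back_forth_append[OF Mult] back_forth_represents[OF represents_rho_rep(2)]]
    by simp
next
  case (Pi_pow t)
  show ?case
    using back_forth_empty_trans[OF back_forth_replicate[OF Pi_pow back_forth_unary_rho[OF assms]]
        back_forth_represents[OF represents_rho_rep(3)]]
    by simp
qed

lemma saturated_represents: "represents u g \<Longrightarrow> saturated u \<Longrightarrow> saturated (rep_gword g)"
  by (meson represents_iso saturated_iso)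

lemma saturated_rho_rep: "saturated (rho_rep t)"
proof (induction t)
  case (Letter a)
  have "saturated (of_list [a])" by (rule saturated_singleton[of _ 1]) (auto simp: of_list_def)
  then show ?case by (rule saturated_represents[OF represents_rho_rep(1)])
next
  case (Mult s t)
  then show ?case by (intro saturated_represents[OF represents_rho_rep(2)] saturated_lconcat)
next
  case (Pi_pow t)
  then show ?case
    by (intro saturated_represents[OF represents_rho_rep(3)] saturated_lsum saturated_lex_interval)
qed

text \<open>Positions of a surrounding word lie in no block. When strategies are lifted they are
  assigned an arbitrary block, so one has to exist.\<close>

lemma rho_rep_nonempty: "positions (rho_rep t) \<noteq> {}"
proof -
  have *: "positions u \<noteq> {} \<Longrightarrow> represents u g \<Longrightarrow> positions (rep_gword g) \<noteq> {}"
    for u :: "('p, 'a) lword" and g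
    by (elim represents_iso) (auto simp: is_iso_def bij_betw_def)
  have "(0, 0) \<in> positions rho_word" by (simp add: lex_interval_def)
  then have **: "positions rho_word \<noteq> {}" by blast
  show ?thesis
  proof (induction t)
    case (Letter a)
    show ?case by (rule *[OF _ represents_rho_rep(1)]) (simp add: of_list_def)
  next
    case (Mult s t)
    then show ?case by (intro *[OF _ represents_rho_rep(2)]) (auto simp: lconcat_def)
  next
    case (Pi_pow t)
    then show ?case using ** by (intro *[OF _ represents_rho_rep(3)]) (auto simp: lsum_def)
  qed
qed

instance fm :: (countable, countable) countable
  by countable_datatype

section \<open>Fragments and saturated words\<close>

lemma fragment_nonempty: "fragment G \<Longrightarrow> G \<noteq> {}"
  unfolding fragment_def by blast

lemma fragment_fill:
  assumes "fragment G" "fill \<mu> \<phi> \<in> G"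
  shows "fill \<mu> Top \<in> G" "fill \<mu> Bot \<in> G" "fill \<mu> (Label x a) \<in> G"
  using assms(1)[unfolded fragment_def, THEN conjunct2, THEN conjunct1, rule_format, OF assms(2)]
  by simp_all

lemma fragment_atoms:
  assumes "fragment G" shows "Top \<in> G" "Bot \<in> G" "Label x a \<in> G"
proof -
  obtain \<phi> where "fill Hole \<phi> \<in> G" using fragment_nonempty[OF assms] by auto
  from fragment_fill[OF assms this] show "Top \<in> G" "Bot \<in> G" "Label x a \<in> G" by auto
qed

lemma fragment_Disj_Conj:
  assumes "fragment G"
  shows "fill \<mu> (Disj \<phi> \<psi>) \<in> G \<longleftrightarrow> fill \<mu> \<phi> \<in> G \<and> fill \<mu> \<psi> \<in> G"
    "fill \<mu> (Conj \<phi> \<psi>) \<in> G \<longleftrightarrow> fill \<mu> \<phi> \<in> G \<and> fill \<mu> \<psi> \<in> G"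
  using assms unfolding fragment_def by blast+

lemmas fragment_Disj_Conj_Hole = fragment_Disj_Conj[where \<mu> = Hole, simplified]
lemmas fragment_Disj_Conj_Neg = fragment_Disj_Conj[where \<mu> = "CNeg Hole", simplified]

lemma fragment_Neg_Neg: "fragment G \<Longrightarrow> Neg (Neg \<phi>) \<in> G \<Longrightarrow> \<phi> \<in> G"
  unfolding fragment_def by (metis fill.simps(1))

lemma order_stable_iff:
  assumes "order_stable G"
  shows "Less x y \<in> G \<longleftrightarrow> LessEq x y \<in> G" "Neg (Less x y) \<in> G \<longleftrightarrow> Neg (LessEq x y) \<in> G"
  using assms[unfolded order_stable_def, rule_format, of Hole x y]
    assms[unfolded order_stable_def, rule_format, of "CNeg Hole" x y] by simp_all

lemma quantify_fill: "\<exists>\<nu>. \<forall>\<phi>. quantify Q x (fill \<mu> \<phi>) = fill \<nu> \<phi>"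
proof (cases Q)
  case QExists
  then show ?thesis by (intro exI[of _ "CExists x \<mu>"]) simp
next
  case QForall
  then show ?thesis by (intro exI[of _ "CForall x \<mu>"]) simp
next
  case QNegExists
  then show ?thesis by (intro exI[of _ "CNeg (CExists x \<mu>)"]) simp
next
  case QNegForall
  then show ?thesis by (intro exI[of _ "CNeg (CForall x \<mu>)"]) simp
qed

text \<open>A context prefixed by a quantifier is a context again. With the closure conditions
  isolated at a single context, those of the reduct at \<open>\<mu>\<close> become literally those
  of \<open>G\<close> at \<open>\<nu>\<close>.\<close>

lemma fragment_reduct:
  assumes "fragment G" "reduct G Q x \<noteq> {}" shows "fragment (reduct G Q x)"
proof -
  define clauses :: "('a, 'b) fm set \<Rightarrow> ('a, 'b) ctxt \<Rightarrow> bool" where "clauses F \<mu> \<longleftrightarrow>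
     (\<forall>\<phi>. fill \<mu> \<phi> \<in> F \<longrightarrow>
        fill \<mu> Top \<in> F \<and> fill \<mu> Bot \<in> F \<and> (\<forall>x a. fill \<mu> (Label x a) \<in> F)) \<and>
     (\<forall>\<phi> \<psi>. fill \<mu> (Disj \<phi> \<psi>) \<in> F \<longleftrightarrow> fill \<mu> \<phi> \<in> F \<and> fill \<mu> \<psi> \<in> F) \<and>
     (\<forall>\<phi> \<psi>. fill \<mu> (Conj \<phi> \<psi>) \<in> F \<longleftrightarrow> fill \<mu> \<phi> \<in> F \<and> fill \<mu> \<psi> \<in> F) \<and>
     (\<forall>\<phi>. fill \<mu> (Neg (Neg \<phi>)) \<in> F \<longrightarrow> fill \<mu> \<phi> \<in> F) \<and>
     (\<forall>x \<phi>. fill \<mu> (Exists x \<phi>) \<in> F \<longrightarrow> x \<notin> FV \<phi> \<longrightarrow> fill \<mu> \<phi> \<in> F) \<and>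
     (\<forall>x \<phi>. fill \<mu> (Forall x \<phi>) \<in> F \<longrightarrow> x \<notin> FV \<phi> \<longrightarrow> fill \<mu> \<phi> \<in> F)" for F \<mu>
  have clauses: "fragment F \<longleftrightarrow> F \<noteq> {} \<and> (\<forall>\<mu>. clauses F \<mu>)" for F
    by (simp only: fragment_def clauses_def all_conj_distrib)
  have "clauses (reduct G Q x) \<mu>" for \<mu>
  proof -
    obtain \<nu> where "\<And>\<phi>. quantify Q x (fill \<mu> \<phi>) = fill \<nu> \<phi>" using quantify_fill by metis
    then have "fill \<mu> \<phi> \<in> reduct G Q x \<longleftrightarrow> fill \<nu> \<phi> \<in> G" for \<phi> by (simp add: reduct_def)
    then have "clauses (reduct G Q x) \<mu> \<longleftrightarrow> clauses G \<nu>" unfolding clauses_def by (simp only:)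
    then show ?thesis using assms(1) clauses by blast
  qed
  then show ?thesis using assms(2) clauses by blast
qed

lemma order_stable_reduct:
  fixes G :: "('a, 'v) fm set"
  assumes "order_stable G" shows "order_stable (reduct G Q x)"
  unfolding order_stable_def
proof (intro allI)
  fix \<mu> :: "('a, 'v) ctxt" and y z
  obtain \<nu> where "\<And>\<phi>. quantify Q x (fill \<mu> \<phi>) = fill \<nu> \<phi>" using quantify_fill by metis
  then show "fill \<mu> (Less y z) \<in> reduct G Q x \<longleftrightarrow> fill \<mu> (LessEq y z) \<in> reduct G Q x"
    using assms by (simp add: reduct_def order_stable_def)
qed

lemma no_suc_min_max_empty_reduct:
  assumes "\<And>\<phi>. \<phi> \<in> G \<Longrightarrow> no_suc_min_max_empty \<phi>" "\<phi> \<in> reduct G Q x"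
  shows "no_suc_min_max_empty \<phi>"
  using assms(1)[of "quantify Q x \<phi>"] assms(2) by (cases Q) (simp_all add: reduct_def)

section \<open>Compactness in saturated words and Duplicator's answers\<close>

lemma fragment_Conj_finite:
  fixes G :: "('a, 'v) fm set"
  assumes "fragment G" "finite \<Psi>" "\<Psi> \<subseteq> G"
  obtains \<phi> where "\<phi> \<in> G" "FV \<phi> = \<Union> (FV ` \<Psi>)"
    "\<And>(u :: ('p, 'a) lword) \<alpha>. sat u \<alpha> \<phi> \<longleftrightarrow> (\<forall>\<psi>\<in>\<Psi>. sat u \<alpha> \<psi>)"
proof -
  have "\<exists>\<phi>\<in>G. FV \<phi> = \<Union> (FV ` \<Psi>) \<and> (\<forall>(u :: ('p, 'a) lword) \<alpha>. sat u \<alpha> \<phi> \<longleftrightarrow> (\<forall>\<psi>\<in>\<Psi>. sat u \<alpha> \<psi>))"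
    using assms(2,3)
  proof (induction rule: finite_induct)
    case empty
    show ?case using fragment_atoms(1)[OF assms(1)] by (intro bexI[of _ Top]) auto
  next
    case (insert \<psi> \<Psi>)
    then obtain \<phi> where "\<phi> \<in> G" "FV \<phi> = \<Union> (FV ` \<Psi>)"
      "\<forall>(u :: ('p, 'a) lword) \<alpha>. sat u \<alpha> \<phi> \<longleftrightarrow> (\<forall>\<psi>\<in>\<Psi>. sat u \<alpha> \<psi>)" by auto
    then show ?case using insert.prems fragment_Disj_Conj_Hole(2)[OF assms(1)]
      by (intro bexI[of _ "Conj \<psi> \<phi>"]) auto
  qed
  then show thesis using that by blast
qed

lemma fragment_Disj_finite:
  fixes G :: "('a, 'v) fm set"
  assumes "fragment G" "finite \<Psi>" "\<Psi> \<subseteq> G"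
  obtains \<phi> where "\<phi> \<in> G" "FV \<phi> = \<Union> (FV ` \<Psi>)"
    "\<And>(u :: ('p, 'a) lword) \<alpha>. sat u \<alpha> \<phi> \<longleftrightarrow> (\<exists>\<psi>\<in>\<Psi>. sat u \<alpha> \<psi>)"
proof -
  have "\<exists>\<phi>\<in>G. FV \<phi> = \<Union> (FV ` \<Psi>) \<and> (\<forall>(u :: ('p, 'a) lword) \<alpha>. sat u \<alpha> \<phi> \<longleftrightarrow> (\<exists>\<psi>\<in>\<Psi>. sat u \<alpha> \<psi>))"
    using assms(2,3)
  proof (induction rule: finite_induct)
    case empty
    show ?case using fragment_atoms(2)[OF assms(1)] by (intro bexI[of _ Bot]) auto
  next
    case (insert \<psi> \<Psi>)
    then obtain \<phi> where "\<phi> \<in> G" "FV \<phi> = \<Union> (FV ` \<Psi>)"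
      "\<forall>(u :: ('p, 'a) lword) \<alpha>. sat u \<alpha> \<phi> \<longleftrightarrow> (\<exists>\<psi>\<in>\<Psi>. sat u \<alpha> \<psi>)" by auto
    then show ?case using insert.prems fragment_Disj_Conj_Hole(1)[OF assms(1)]
      by (intro bexI[of _ "Disj \<psi> \<phi>"]) auto
  qed
  then show thesis using that by blast
qed

text \<open>Compactness for the formulas about one new position over finitely many parameters. The
  position \<open>q j\<close> satisfies the formulas with code at most \<open>j\<close>, and a limit
  point satisfies all of them: a formula is transferred at a level \<open>k\<close> bounding both
  its code and its depth. \<open>\<Phi>\<close> is an arbitrary set of formulas, because negations
  that may lie outside the fragment are realized as well.\<close>

lemma saturated_realizes:
  fixes v :: "('p, 'a::countable) lword" and \<Phi> :: "('a, 'v::countable) fm set"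
  assumes "saturated v" "finite (dom \<beta>)" "ran \<beta> \<subseteq> positions v"
    and \<Phi>: "\<And>\<phi>. \<phi> \<in> \<Phi> \<Longrightarrow> no_suc_min_max_empty \<phi> \<and> FV \<phi> \<subseteq> insert x (dom \<beta>)"
    and fin: "\<And>\<Psi>. finite \<Psi> \<Longrightarrow> \<Psi> \<subseteq> \<Phi> \<Longrightarrow> \<exists>q\<in>positions v. \<forall>\<phi>\<in>\<Psi>. sat v (\<beta>(x \<mapsto> q)) \<phi>"
  shows "\<exists>q\<in>positions v. \<forall>\<phi>\<in>\<Phi>. sat v (\<beta>(x \<mapsto> q)) \<phi>"
proof -
  have "finite {\<phi> \<in> \<Phi>. to_nat \<phi> \<le> j}" for j
    by (rule finite_subset[OF _ finite_vimageI[OF finite_atMost[of j] inj_to_nat]]) auto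
  then have "\<exists>q\<in>positions v. \<forall>\<phi>\<in>{\<phi> \<in> \<Phi>. to_nat \<phi> \<le> j}. sat v (\<beta>(x \<mapsto> q)) \<phi>" for j
    by (intro fin) auto
  then obtain q where q: "\<And>j. q j \<in> positions v"
    "\<And>j \<phi>. \<phi> \<in> \<Phi> \<Longrightarrow> to_nat \<phi> \<le> j \<Longrightarrow> sat v (\<beta>(x \<mapsto> q j)) \<phi>"
    by (metis (mono_tags, lifting) mem_Collect_eq)
  have "finite (ran \<beta>)" using assms(2) by (rule finite_ran)
  from saturatedE[OF assms(1) this assms(3), of q, OF q(1)] obtain a r where
    r: "strict_mono r" "a \<in> positions v"
    "\<And>k. back_forth k v v (insert (a, q (r k)) (Id_on (ran \<beta>)))"
    by metis
  have "sat v (\<beta>(x \<mapsto> a)) \<phi>" if \<phi>: "\<phi> \<in> \<Phi>" for \<phi>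
  proof -
    define k where "k = max (to_nat \<phi>) (qdepth \<phi>)"
    have "to_nat \<phi> \<le> r k"
      using strict_mono_imp_increasing[OF r(1), of k] by (simp add: k_def)
    then have "sat v (\<beta>(x \<mapsto> q (r k))) \<phi>" using q(2) \<phi> by blast
    moreover have "sat v (\<beta>(x \<mapsto> a)) \<phi> \<longleftrightarrow> sat v (\<beta>(x \<mapsto> q (r k))) \<phi>"
    proof (rule back_forth_sat[OF r(3)])
      show "qdepth \<phi> \<le> k" by (simp add: k_def)
      show "no_suc_min_max_empty \<phi>" using \<Phi>[OF \<phi>] by simp
      fix y assume "y \<in> FV \<phi>"
      then have "y = x \<or> (\<exists>b. \<beta> y = Some b)" using \<Phi>[OF \<phi>] by auto
      then show "(the ((\<beta>(x \<mapsto> a)) y), the ((\<beta>(x \<mapsto> q (r k))) y))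
          \<in> insert (a, q (r k)) (Id_on (ran \<beta>))"
        by (auto simp: ranI)
    qed
    ultimately show ?thesis by simp
  qed
  then show ?thesis using r(2) by blast
qed

text \<open>For moves whose answer must satisfy everything true at the chosen position.
  \<open>H\<close> is closed under conjunction, so \<open>ex\<close>, which speaks of single
  formulas, already yields finite satisfiability.\<close>

lemma saturated_answer_Conj:
  fixes u v :: "('p, 'a::countable) lword" and H :: "('a, 'v::countable) fm set"
  assumes "fragment H" "\<And>\<phi>. \<phi> \<in> H \<Longrightarrow> no_suc_min_max_empty \<phi>"
    and "saturated v" "finite (dom \<beta>)" "ran \<beta> \<subseteq> positions v"
    and ex: "\<And>\<phi>. \<phi> \<in> H \<Longrightarrow> FV \<phi> \<subseteq> insert x (dom \<beta>) \<Longrightarrow> sat u \<alpha> \<phi> \<Longrightarrow>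
      \<exists>q\<in>positions v. sat v (\<beta>(x \<mapsto> q)) \<phi>"
  shows "\<exists>q\<in>positions v. \<forall>\<phi>\<in>H. FV \<phi> \<subseteq> insert x (dom \<beta>) \<longrightarrow> sat u \<alpha> \<phi> \<longrightarrow> sat v (\<beta>(x \<mapsto> q)) \<phi>"
proof -
  define \<Phi> where "\<Phi> = {\<phi> \<in> H. FV \<phi> \<subseteq> insert x (dom \<beta>) \<and> sat u \<alpha> \<phi>}"
  have "\<exists>q\<in>positions v. \<forall>\<phi>\<in>\<Phi>. sat v (\<beta>(x \<mapsto> q)) \<phi>"
  proof (rule saturated_realizes[OF assms(3-5)])
    fix \<Psi> assume \<Psi>: "finite \<Psi>" "\<Psi> \<subseteq> \<Phi>"
    then have "\<Psi> \<subseteq> H" by (auto simp: \<Phi>_def)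
    from fragment_Conj_finite[OF assms(1) \<Psi>(1) this] obtain \<phi> where \<phi>: "\<phi> \<in> H" "FV \<phi> = \<Union> (FV ` \<Psi>)"
      "\<And>(u :: ('p, 'a) lword) \<alpha>. sat u \<alpha> \<phi> \<longleftrightarrow> (\<forall>\<psi>\<in>\<Psi>. sat u \<alpha> \<psi>)"
      by metis
    have "FV \<phi> \<subseteq> insert x (dom \<beta>)" "sat u \<alpha> \<phi>"
      unfolding \<phi>(2,3) using \<Psi>(2) by (auto simp: \<Phi>_def)
    from ex[OF \<phi>(1) this] show "\<exists>q\<in>positions v. \<forall>\<phi>\<in>\<Psi>. sat v (\<beta>(x \<mapsto> q)) \<phi>"
      unfolding \<phi>(3) .
  qed (use assms(2) in \<open>auto simp: \<Phi>_def\<close>)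
  then show ?thesis by (auto simp: \<Phi>_def)
qed

text \<open>For moves whose answer must refute everything false at the chosen position. The formulas
  to realize are negations and may leave \<open>H\<close>; finite satisfiability comes from refuting
  a disjunction, which stays in \<open>H\<close>.\<close>

lemma saturated_answer_Disj:
  fixes u v :: "('p, 'a::countable) lword" and H :: "('a, 'v::countable) fm set"
  assumes "fragment H" "\<And>\<phi>. \<phi> \<in> H \<Longrightarrow> no_suc_min_max_empty \<phi>"
    and "saturated v" "finite (dom \<beta>)" "ran \<beta> \<subseteq> positions v"
    and ex: "\<And>\<phi>. \<phi> \<in> H \<Longrightarrow> FV \<phi> \<subseteq> insert x (dom \<beta>) \<Longrightarrow> \<not> sat u \<alpha> \<phi> \<Longrightarrow>
      \<exists>q\<in>positions v. \<not> sat v (\<beta>(x \<mapsto> q)) \<phi>"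
  shows "\<exists>q\<in>positions v. \<forall>\<phi>\<in>H. FV \<phi> \<subseteq> insert x (dom \<beta>) \<longrightarrow> sat v (\<beta>(x \<mapsto> q)) \<phi> \<longrightarrow> sat u \<alpha> \<phi>"
proof -
  define \<Phi> where "\<Phi> = {\<phi> \<in> H. FV \<phi> \<subseteq> insert x (dom \<beta>) \<and> \<not> sat u \<alpha> \<phi>}"
  have "\<exists>q\<in>positions v. \<forall>\<phi>\<in>Neg ` \<Phi>. sat v (\<beta>(x \<mapsto> q)) \<phi>"
  proof (rule saturated_realizes[OF assms(3-5)])
    fix \<Psi>' assume "finite \<Psi>'" "\<Psi>' \<subseteq> Neg ` \<Phi>"
    then obtain \<Psi> where \<Psi>: "finite \<Psi>" "\<Psi> \<subseteq> \<Phi>" "\<Psi>' = Neg ` \<Psi>" by (meson finite_subset_image)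
    then have "\<Psi> \<subseteq> H" by (auto simp: \<Phi>_def)
    from fragment_Disj_finite[OF assms(1) \<Psi>(1) this] obtain \<phi> where \<phi>: "\<phi> \<in> H" "FV \<phi> = \<Union> (FV ` \<Psi>)"
      "\<And>(u :: ('p, 'a) lword) \<alpha>. sat u \<alpha> \<phi> \<longleftrightarrow> (\<exists>\<psi>\<in>\<Psi>. sat u \<alpha> \<psi>)"
      by metis
    have "FV \<phi> \<subseteq> insert x (dom \<beta>)" "\<not> sat u \<alpha> \<phi>"
      unfolding \<phi>(2,3) using \<Psi>(2) by (auto simp: \<Phi>_def)
    from ex[OF \<phi>(1) this] show "\<exists>q\<in>positions v. \<forall>\<phi>\<in>\<Psi>'. sat v (\<beta>(x \<mapsto> q)) \<phi>"
      unfolding \<phi>(3) \<Psi>(3) by simp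
  qed (use assms(2) in \<open>auto simp: \<Phi>_def\<close>)
  then show ?thesis by (auto simp: \<Phi>_def)
qed

text \<open>The invariant is preservation, from left to right, of all formulas of the current
  fragment over the assigned variables, whatever their depth. Applied to a quantified formula, it
  gives the single-formula hypothesis needed for the next answer; applied to literals, it keeps
  Spoiler from winning at once.\<close>

lemma duplicator_wins_saturated:
  fixes F :: "('a::countable, 'v::countable) fm set" and u v :: "('p, 'a) lword"
  assumes "fragment F" "\<And>\<phi>. \<phi> \<in> F \<Longrightarrow> no_suc_min_max_empty \<phi>" "saturated u" "saturated v"
    and "\<And>\<phi>. \<phi> \<in> F \<Longrightarrow> sentence \<phi> \<Longrightarrow> sat u Map.empty \<phi> \<Longrightarrow> sat v Map.empty \<phi>"
  shows "duplicator_wins (F, (u, Map.empty), (v, Map.empty))"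
proof -
  define W :: "('p, 'a, 'v) config set" where "W = {(G, (a, \<alpha>), (b, \<beta>)) | G a \<alpha> b \<beta>.
    fragment G \<and> (\<forall>\<phi>\<in>G. no_suc_min_max_empty \<phi>) \<and> saturated a \<and> saturated b \<and>
    dom \<alpha> = dom \<beta> \<and> finite (dom \<beta>) \<and> ran \<alpha> \<subseteq> positions a \<and> ran \<beta> \<subseteq> positions b \<and>
    (\<forall>\<phi>\<in>G. FV \<phi> \<subseteq> dom \<beta> \<longrightarrow> sat a \<alpha> \<phi> \<longrightarrow> sat b \<beta> \<phi>)}"
  have "(F, (u, Map.empty), (v, Map.empty)) \<in> W"
    using assms by (auto simp: W_def sentence_def)
  moreover have "\<not> spoiler_wins_now c \<and>
      (\<forall>m. spoiler_move c m \<longrightarrow> (\<exists>r. duplicator_move c m r \<and> next_config c m r \<in> W))" if "c \<in> W" for c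
  proof -
    from that obtain G a \<alpha> b \<beta> where c: "c = (G, (a, \<alpha>), (b, \<beta>))" and *: "fragment G"
      "\<forall>\<phi>\<in>G. no_suc_min_max_empty \<phi>" and ab: "saturated a" "saturated b"
      and dom: "dom \<alpha> = dom \<beta>" "finite (dom \<beta>)" and ran: "ran \<alpha> \<subseteq> positions a" "ran \<beta> \<subseteq> positions b"
      and **: "\<forall>\<phi>\<in>G. FV \<phi> \<subseteq> dom \<beta> \<longrightarrow> sat a \<alpha> \<phi> \<longrightarrow> sat b \<beta> \<phi>"
      unfolding W_def by blast
    have G: "fragment G" "\<And>\<phi>. \<phi> \<in> G \<Longrightarrow> no_suc_min_max_empty \<phi>" using * by blast+
    have pres: "\<And>\<phi>. \<phi> \<in> G \<Longrightarrow> FV \<phi> \<subseteq> dom \<beta> \<Longrightarrow> sat a \<alpha> \<phi> \<Longrightarrow> sat b \<beta> \<phi>"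
      using ** by blast
    have fin: "finite (dom \<alpha>)" using dom by simp
    have "\<not> spoiler_wins_now c" using pres by (auto simp: c)
    moreover have "\<exists>r. duplicator_move c m r \<and> next_config c m r \<in> W" if "spoiler_move c m" for m
    proof -
      obtain Q x q where m: "m = (Q, x, q)" by (cases m)
      define H where "H = reduct G Q x"
      have q: "H \<noteq> {}" "q \<in> (if Q \<in> {QExists, QNegForall} then positions a else positions b)"
        using that by (simp_all add: c m H_def)
      have H: "fragment H" "\<And>\<phi>. \<phi> \<in> H \<Longrightarrow> no_suc_min_max_empty \<phi>"
        using fragment_reduct[OF G(1)] no_suc_min_max_empty_reduct[OF G(2)] q(1) by (auto simp: H_def)
      have ran': "ran (\<gamma>(x \<mapsto> p)) \<subseteq> S" if "ran \<gamma> \<subseteq> S" "p \<in> S" for p S and \<gamma> :: "'v \<rightharpoonup> 'p"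
        using that by (auto simp: ran_def)
      have W1: "(H, (a, \<alpha>(x \<mapsto> p)), (b, \<beta>(x \<mapsto> r))) \<in> W"
        if "p \<in> positions a" "r \<in> positions b" "\<And>\<phi>. \<phi> \<in> H \<Longrightarrow> FV \<phi> \<subseteq> insert x (dom \<beta>) \<Longrightarrow>
          sat a (\<alpha>(x \<mapsto> p)) \<phi> \<Longrightarrow> sat b (\<beta>(x \<mapsto> r)) \<phi>" for p r
        unfolding W_def using that H ab dom ran'[OF ran(1)] ran'[OF ran(2)] by simp
      have W2: "(H, (b, \<beta>(x \<mapsto> r)), (a, \<alpha>(x \<mapsto> p))) \<in> W"
        if "p \<in> positions a" "r \<in> positions b" "\<And>\<phi>. \<phi> \<in> H \<Longrightarrow> FV \<phi> \<subseteq> insert x (dom \<beta>) \<Longrightarrow>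
          sat b (\<beta>(x \<mapsto> r)) \<phi> \<Longrightarrow> sat a (\<alpha>(x \<mapsto> p)) \<phi>" for p r
        unfolding W_def using that H ab dom ran'[OF ran(1)] ran'[OF ran(2)] by simp
      show ?thesis
      proof (cases Q)
        case QExists
        have "\<exists>r\<in>positions b. \<forall>\<phi>\<in>H. FV \<phi> \<subseteq> insert x (dom \<beta>) \<longrightarrow>
            sat a (\<alpha>(x \<mapsto> q)) \<phi> \<longrightarrow> sat b (\<beta>(x \<mapsto> r)) \<phi>"
        proof (rule saturated_answer_Conj[OF H ab(2) dom(2) ran(2)])
          fix \<phi> assume "\<phi> \<in> H" "FV \<phi> \<subseteq> insert x (dom \<beta>)" "sat a (\<alpha>(x \<mapsto> q)) \<phi>"
          then show "\<exists>r\<in>positions b. sat b (\<beta>(x \<mapsto> r)) \<phi>"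
            using pres[of "Exists x \<phi>"] q(2) by (auto simp: H_def reduct_def QExists)
        qed
        then show ?thesis using W1 q(2) by (auto simp: c m QExists H_def)
      next
        case QNegForall
        have "\<exists>r\<in>positions b. \<forall>\<phi>\<in>H. FV \<phi> \<subseteq> insert x (dom \<beta>) \<longrightarrow>
            sat b (\<beta>(x \<mapsto> r)) \<phi> \<longrightarrow> sat a (\<alpha>(x \<mapsto> q)) \<phi>"
        proof (rule saturated_answer_Disj[OF H ab(2) dom(2) ran(2)])
          fix \<phi> assume "\<phi> \<in> H" "FV \<phi> \<subseteq> insert x (dom \<beta>)" "\<not> sat a (\<alpha>(x \<mapsto> q)) \<phi>"
          then show "\<exists>r\<in>positions b. \<not> sat b (\<beta>(x \<mapsto> r)) \<phi>"
            using pres[of "Neg (Forall x \<phi>)"] q(2) by (auto simp: H_def reduct_def QNegForall)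
        qed
        then show ?thesis using W2 q(2) by (auto simp: c m QNegForall H_def)
      next
        \<comment> \<open>Read contrapositively: a body false at \<open>q\<close> makes the
          universal formula false on the right, hence also on the left.\<close>
        case QForall
        have "\<exists>r\<in>positions a. \<forall>\<phi>\<in>H. FV \<phi> \<subseteq> insert x (dom \<alpha>) \<longrightarrow>
            sat a (\<alpha>(x \<mapsto> r)) \<phi> \<longrightarrow> sat b (\<beta>(x \<mapsto> q)) \<phi>"
        proof (rule saturated_answer_Disj[OF H ab(1) fin ran(1)])
          fix \<phi> assume "\<phi> \<in> H" "FV \<phi> \<subseteq> insert x (dom \<alpha>)" "\<not> sat b (\<beta>(x \<mapsto> q)) \<phi>"
          then show "\<exists>r\<in>positions a. \<not> sat a (\<alpha>(x \<mapsto> r)) \<phi>"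
            using pres[of "Forall x \<phi>"] q(2) dom(1) by (auto simp: H_def reduct_def QForall)
        qed
        then show ?thesis using W1 q(2) dom(1) by (auto simp: c m QForall H_def)
      next
        \<comment> \<open>Preserving a negated formula means carrying the formula itself from right
          to left, which matches the exchange of the two words in the next configuration.\<close>
        case QNegExists
        have "\<exists>r\<in>positions a. \<forall>\<phi>\<in>H. FV \<phi> \<subseteq> insert x (dom \<alpha>) \<longrightarrow>
            sat b (\<beta>(x \<mapsto> q)) \<phi> \<longrightarrow> sat a (\<alpha>(x \<mapsto> r)) \<phi>"
        proof (rule saturated_answer_Conj[OF H ab(1) fin ran(1)])
          fix \<phi> assume "\<phi> \<in> H" "FV \<phi> \<subseteq> insert x (dom \<alpha>)" "sat b (\<beta>(x \<mapsto> q)) \<phi>"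
          then show "\<exists>r\<in>positions a. sat a (\<alpha>(x \<mapsto> r)) \<phi>"
            using pres[of "Neg (Exists x \<phi>)"] q(2) dom(1) by (auto simp: H_def reduct_def QNegExists)
        qed
        then show ?thesis using W2 q(2) dom(1) by (auto simp: c m QNegExists H_def)
      qed
    qed
    ultimately show ?thesis by blast
  qed
  ultimately show ?thesis unfolding duplicator_wins_iff by blast
qed

section \<open>Powers in syntactic monoids\<close>

definition synt_class :: "'a set \<Rightarrow> 'a list set \<Rightarrow> 'a list \<Rightarrow> 'a list set" where
  "synt_class A L w = synt_eq A L `` {w}"

lemma synt_class_eq_iff:
  assumes "u \<in> lists A" "v \<in> lists A"
  shows "synt_class A L u = synt_class A L v \<longleftrightarrow>
    (\<forall>x\<in>lists A. \<forall>y\<in>lists A. x @ u @ y \<in> L \<longleftrightarrow> x @ v @ y \<in> L)"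
  using eq_equiv_class_iff[OF synt_eq_equiv assms] assms by (simp add: synt_class_def synt_eq_def)

lemma synt_class_mult:
  "u \<in> lists A \<Longrightarrow> v \<in> lists A \<Longrightarrow>
   synt_class A L u \<otimes>\<^bsub>synt_monoid A L\<^esub> synt_class A L v = synt_class A L (u @ v)"
  unfolding synt_class_def by (rule synt_mult_class)

lemma synt_class_pow:
  "w \<in> lists A \<Longrightarrow>
   synt_class A L w [^]\<^bsub>synt_monoid A L\<^esub> (m::nat) = synt_class A L (concat (replicate m w))"
proof (induction m)
  case 0
  then show ?case by (simp add: synt_class_def synt_monoid_def)
next
  case (Suc m)
  have "concat (replicate m w) @ w = concat (replicate (Suc m) w)"
    by (metis concat.simps concat_append append_Nil2 replicate_Suc replicate_append_same)
  then show ?case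
    using Suc synt_class_mult[OF concat_replicate_in_lists[OF Suc.prems] Suc.prems, of L m]
    by simp
qed

lemma carrier_synt_monoid: "U \<in> carrier (synt_monoid A L) \<longleftrightarrow> (\<exists>u\<in>lists A. U = synt_class A L u)"
  by (auto simp: synt_monoid_def quotient_def synt_class_def)

lemma sat_of_list_append3_cong:
  assumes "back_forth (qdepth \<phi>) (of_list u) (of_list v) {}" "no_suc_min_max_empty \<phi>" "sentence \<phi>"
  shows "sat (of_list (x @ u @ y)) Map.empty \<phi> \<longleftrightarrow> sat (of_list (x @ v @ y)) Map.empty \<phi>"
proof (rule back_forth_sat_sentence[OF _ order_refl assms(2,3)])
  have "back_forth (qdepth \<phi>) (of_list (x @ u @ y)) (lconcat (of_list x) (lconcat (of_list w) (of_list y))) {}"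
    if "back_forth (qdepth \<phi>) (of_list u) (of_list w) {}" for u w
    by (intro back_forth_append back_forth_refl that)
  from back_forth_empty_trans[OF this[OF assms(1)] back_forth_empty_sym[OF this[OF back_forth_refl]]]
  show "back_forth (qdepth \<phi>) (of_list (x @ u @ y)) (of_list (x @ v @ y)) {}" .
qed

context
  fixes A :: "'a set" and \<phi> :: "('a, 'v) fm"
  assumes \<phi>: "no_suc_min_max_empty \<phi>" "sentence \<phi>"
begin

abbreviation "cls \<equiv> synt_class A (lang A \<phi>)"

lemma synt_class_eqI:
  assumes "u \<in> lists A" "v \<in> lists A"
    and "\<And>x y. x \<in> lists A \<Longrightarrow> y \<in> lists A \<Longrightarrow>
      sat (of_list (x @ u @ y)) Map.empty \<phi> \<longleftrightarrow> sat (of_list (x @ v @ y)) Map.empty \<phi>"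
  shows "cls u = cls v"
  using assms unfolding synt_class_eq_iff[OF assms(1,2)] lang_def by (simp del: append_assoc)

text \<open>In no context can \<open>\<phi>\<close> distinguish exponents from
  \<open>2 ^ qdepth \<phi> - 1\<close> on, so the powers of a class become constant and not merely
  periodic.\<close>

lemma aperiodic:
  assumes "w \<in> lists A" "2 ^ qdepth \<phi> \<le> m + 1" "2 ^ qdepth \<phi> \<le> n + 1"
  shows "cls (concat (replicate m w)) = cls (concat (replicate n w))"
  using assms \<phi>
  by (intro synt_class_eqI sat_of_list_append3_cong back_forth_replicate_replicate concat_replicate_in_lists)

text \<open>The exponent \<open>2 ^ qdepth \<phi>\<close> lies in the range where powers are
  constant. This replaces the description of the idempotent by plain repetition of a list.\<close>

lemma idem_power_class:
  assumes w: "w \<in> lists A"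
  shows "idem_power (synt_monoid A (lang A \<phi>)) (cls w) = cls (concat (replicate (2 ^ qdepth \<phi>) w))"
proof -
  let ?M = "synt_monoid A (lang A \<phi>)" and ?n = "2 ^ qdepth \<phi> :: nat"
  interpret monoid ?M by (rule synt_monoid_monoid)
  have C: "cls w \<in> carrier ?M" using w carrier_synt_monoid by blast
  have pow: "cls w [^]\<^bsub>?M\<^esub> m = cls (concat (replicate m w))" for m :: nat
    by (rule synt_class_pow[OF w])
  have stable: "cls w [^]\<^bsub>?M\<^esub> m = cls w [^]\<^bsub>?M\<^esub> ?n" if "?n \<le> m" for m
    unfolding pow using that by (intro aperiodic w) simp_all
  have idem: "e [^]\<^bsub>?M\<^esub> Suc m = e" if "e \<in> carrier ?M" "e \<otimes>\<^bsub>?M\<^esub> e = e" for e and m :: nat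
    using that by (induction m) simp_all
  have "idem_power ?M (cls w) = cls w [^]\<^bsub>?M\<^esub> ?n"
    unfolding idem_power_def
  proof (rule the_equality, intro conjI)
    show "cls w [^]\<^bsub>?M\<^esub> ?n \<in> {cls w [^]\<^bsub>?M\<^esub> k | k :: nat. 1 \<le> k}" by force
    show "cls w [^]\<^bsub>?M\<^esub> ?n \<otimes>\<^bsub>?M\<^esub> cls w [^]\<^bsub>?M\<^esub> ?n = cls w [^]\<^bsub>?M\<^esub> ?n"
      using stable[of "?n + ?n"] by (simp add: nat_pow_mult C)
    fix e assume e: "e \<in> {cls w [^]\<^bsub>?M\<^esub> k | k :: nat. 1 \<le> k} \<and> e \<otimes>\<^bsub>?M\<^esub> e = e"
    then obtain k :: nat where k: "1 \<le> k" "e = cls w [^]\<^bsub>?M\<^esub> k" by blast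
    \<comment> \<open>Uniqueness: an idempotent equals its own positive powers, and
      \<open>k * Suc ?n\<close> reaches the constant range for every
      \<open>k \<ge> 1\<close>.\<close>
    have "e = e [^]\<^bsub>?M\<^esub> Suc ?n" using idem[of e ?n] e k C by simp
    also have "\<dots> = cls w [^]\<^bsub>?M\<^esub> (k * Suc ?n)" by (simp only: k(2) nat_pow_pow[OF C])
    also have "\<dots> = cls w [^]\<^bsub>?M\<^esub> ?n"
      by (rule stable) (use k(1) in \<open>metis le_SucI mult_le_mono nat_mult_1 order_refl\<close>)
    finally show "e = cls w [^]\<^bsub>?M\<^esub> ?n" .
  qed
  then show ?thesis by (simp add: pow)
qed

text \<open>Every morphism into the syntactic monoid is a substitution of words for letters applied
  to the finite approximation, so an identity becomes a statement about finite words.\<close>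

lemma pi_morphism_class:
  assumes "pi_morphism (carrier (synt_monoid A (lang A \<phi>))) (mult (synt_monoid A (lang A \<phi>)))
      (idem_power (synt_monoid A (lang A \<phi>))) h"
    and w: "\<And>a. w a \<in> lists A" "\<And>a. h (Letter a) = cls (w a)"
  shows "concat (map w (finite_word (2 ^ qdepth \<phi>) t)) \<in> lists A \<and>
    h t = cls (concat (map w (finite_word (2 ^ qdepth \<phi>) t)))"
proof (induction t)
  case (Letter a)
  then show ?case using w by simp
next
  case (Mult s t)
  then show ?case using assms(1) by (auto simp: pi_morphism_def synt_class_mult simp del: in_lists_conv_set)
next
  case (Pi_pow t)
  have *: "concat (map w (concat (replicate n x))) = concat (replicate n (concat (map w x)))" for n x
    by (induction n) simp_all
  have "h (Pi_pow t) = idem_power (synt_monoid A (lang A \<phi>)) (h t)"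
    using assms(1) by (simp add: pi_morphism_def)
  then show ?case
    using Pi_pow idem_power_class concat_replicate_in_lists by (metis * finite_word_simps(3))
qed

lemma pi_morphism_exists:
  assumes "\<And>a. w a \<in> lists A"
  obtains h where "pi_morphism (carrier (synt_monoid A (lang A \<phi>))) (mult (synt_monoid A (lang A \<phi>)))
      (idem_power (synt_monoid A (lang A \<phi>))) h" "\<And>a. h (Letter a) = cls (w a)"
proof -
  let ?M = "synt_monoid A (lang A \<phi>)"
  interpret monoid ?M by (rule synt_monoid_monoid)
  have "idem_power ?M U \<in> carrier ?M" if U: "U \<in> carrier ?M" for U
  proof -
    obtain u where u: "u \<in> lists A" "U = cls u" using U unfolding carrier_synt_monoid by blast
    show ?thesis unfolding carrier_synt_monoid u(2) idem_power_class[OF u(1)]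
      using concat_replicate_in_lists[OF u(1)] by blast
  qed
  then have "pi_algebra (carrier ?M) (mult ?M) (idem_power ?M)"
    by (simp add: pi_algebra_def m_assoc)
  moreover have "cls (w a) \<in> carrier ?M" for a
    unfolding carrier_synt_monoid using assms by blast
  ultimately have "\<exists>!h. pi_morphism (carrier ?M) (mult ?M) (idem_power ?M) h \<and>
      (\<forall>a. h (Letter a) = cls (w a))"
    by (rule piterm_free)
  then show thesis using that by auto
qed

end

section \<open>Lifting winning strategies to substitution instances\<close>

lemma of_list_sel:
  "i \<in> positions (of_list w) \<longleftrightarrow> i \<in> {1..length w}"
  "(i, j) \<in> leq (of_list w) \<longleftrightarrow> 1 \<le> i \<and> i \<le> j \<and> j \<le> length w"
  "label (of_list w) i = w ! (i - 1)"
  by (simp_all add: of_list_def)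

text \<open>Blocks stay visible: a middle position is an offset together with a position of
  \<open>u\<close>, on which the game for \<open>u\<close> can act.\<close>

definition context_word :: "'b list \<Rightarrow> ('a \<Rightarrow> 'b list) \<Rightarrow> 'b list \<Rightarrow> ('p, 'a) lword \<Rightarrow>
    (nat + (nat \<times> 'p) + nat, 'b) lword" where
  "context_word x f y u = lconcat (of_list x) (lconcat (subst_word f u) (of_list y))"

lemma context_word_positions:
  "Inl i \<in> positions (context_word x f y u) \<longleftrightarrow> i \<in> {1..length x}"
  "Inr (Inl (i, p)) \<in> positions (context_word x f y u) \<longleftrightarrow>
     p \<in> positions u \<and> i \<in> {1..length (f (label u p))}"
  "Inr (Inr i) \<in> positions (context_word x f y u) \<longleftrightarrow> i \<in> {1..length y}"
  by (simp_all add: context_word_def lconcat_sel subst_word_def lsum_sel of_list_sel)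

lemma context_word_label:
  "label (context_word x f y u) (Inl i) = x ! (i - 1)"
  "label (context_word x f y u) (Inr (Inl (i, p))) = f (label u p) ! (i - 1)"
  "label (context_word x f y u) (Inr (Inr i)) = y ! (i - 1)"
  by (simp_all add: context_word_def lconcat_sel subst_word_def lsum_sel of_list_sel)

fun context_leq :: "('p, 'a) lword \<Rightarrow> nat + (nat \<times> 'p) + nat \<Rightarrow> nat + (nat \<times> 'p) + nat \<Rightarrow> bool" where
  "context_leq u (Inl i) (Inl j) \<longleftrightarrow> i \<le> j"
| "context_leq u (Inl i) _ \<longleftrightarrow> True"
| "context_leq u (Inr (Inl (i, p))) (Inr (Inl (j, q))) \<longleftrightarrow> (p, q) \<in> leq u \<and> p \<noteq> q \<or> p = q \<and> i \<le> j"
| "context_leq u (Inr (Inl _)) (Inr (Inr _)) \<longleftrightarrow> True"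
| "context_leq u (Inr (Inr i)) (Inr (Inr j)) \<longleftrightarrow> i \<le> j"
| "context_leq u _ _ \<longleftrightarrow> False"

lemma context_word_leq:
  assumes "P \<in> positions (context_word x f y u)" "Q \<in> positions (context_word x f y u)"
  shows "(P, Q) \<in> leq (context_word x f y u) \<longleftrightarrow> context_leq u P Q"
  using assms by (cases "(u, P, Q)" rule: context_leq.cases)
    (auto simp: context_word_def lconcat_sel subst_word_def lsum_sel of_list_sel)

text \<open>A position \<open>P\<close> of the substituted word over \<open>u\<close> and \<open>Q\<close> of the one over \<open>v\<close> correspond if they
  lie at the same place of the block belonging to \<open>p\<close> and \<open>q\<close>, respectively, or are the same
  position of the surrounding words; in the latter case \<open>p\<close> and \<open>q\<close> are arbitrary.\<close>
fun same_place :: "nat + (nat \<times> 'p) + nat \<Rightarrow> nat + (nat \<times> 'p) + nat \<Rightarrow> 'p \<Rightarrow> 'p \<Rightarrow> bool" where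
  "same_place (Inl i) Q p q \<longleftrightarrow> Q = Inl i"
| "same_place (Inr (Inl (i, r))) Q p q \<longleftrightarrow> r = p \<and> Q = Inr (Inl (i, q))"
| "same_place (Inr (Inr i)) Q p q \<longleftrightarrow> Q = Inr (Inr i)"

lemma same_place_sym: "same_place P Q p q \<Longrightarrow> same_place Q P q p"
  by (cases "(P, Q, p, q)" rule: same_place.cases) auto

lemma same_place_positions:
  assumes "same_place P Q p q" "P \<in> positions (context_word x f y u)"
    and "q \<in> positions v" "label u p = label v q"
  shows "Q \<in> positions (context_word x f y v)"
    "label (context_word x f y u) P = label (context_word x f y v) Q"
  using assms by (cases "(P, Q, p, q)" rule: same_place.cases;
      auto simp: context_word_positions context_word_label)+

text \<open>A position inside a block determines \<open>p\<close>; a position of \<open>x\<close> or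
  \<open>y\<close> matches itself whatever the block, so any position of \<open>u\<close> will
  do.\<close>

lemma same_place_exists:
  assumes "P \<in> positions (context_word x f y u)" "positions u \<noteq> {}"
  obtains p where "p \<in> positions u" "\<And>q. \<exists>Q. same_place P Q p q"
proof -
  obtain r where r: "r \<in> positions u" using assms(2) by blast
  show thesis
    using assms(1) that r by (cases "(P, P, r, r)" rule: same_place.cases)
      (auto simp: context_word_positions)
qed

text \<open>Inside one block the offsets decide, and it is enough that equal blocks go to weakly
  ordered ones: if they stay equal the offsets still decide, if they separate the order holds
  anyway. Strict order of blocks overrides offsets and must stay strict.\<close>

lemma same_place_leq:
  assumes "same_place P Q p q" "same_place P' Q' p' q'"
    and "(p, p') \<in> leq u \<and> p \<noteq> p' \<Longrightarrow> (q, q') \<in> leq v \<and> q \<noteq> q'" "p = p' \<Longrightarrow> (q, q') \<in> leq v"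
    and "context_leq u P P'"
  shows "context_leq v Q Q'" "P \<noteq> P' \<Longrightarrow> Q \<noteq> Q'"
  using assms by (cases "(P, Q, p, q)" rule: same_place.cases;
      cases "(P', Q', p', q')" rule: same_place.cases; auto)+

lemma same_place_eq:
  assumes "same_place P Q p q" "same_place P' Q' p' q'" "p = p' \<Longrightarrow> q = q'" "P = P'"
  shows "Q = Q'"
  using assms by (cases "(P, Q, p, q)" rule: same_place.cases;
      cases "(P', Q', p', q')" rule: same_place.cases; auto)

text \<open>Ties a pair of positions of the substituted words to a pair \<open>p\<close>,
  \<open>q\<close> played in the game on \<open>u\<close> and \<open>v\<close>. Equal labels make
  the two blocks the same list, so an offset exists on both sides or on neither.\<close>

definition linked :: "'b list \<Rightarrow> ('a \<Rightarrow> 'b list) \<Rightarrow> 'b list \<Rightarrow> ('p, 'a) lword \<Rightarrow> ('p, 'a) lword \<Rightarrow>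
    nat + (nat \<times> 'p) + nat \<Rightarrow> nat + (nat \<times> 'p) + nat \<Rightarrow> 'p \<Rightarrow> 'p \<Rightarrow> bool" where
  "linked x f y u v P Q p q \<longleftrightarrow> same_place P Q p q \<and>
     P \<in> positions (context_word x f y u) \<and> Q \<in> positions (context_word x f y v) \<and>
     p \<in> positions u \<and> q \<in> positions v \<and> label u p = label v q"

lemma linked_sym: "linked x f y u v P Q p q \<Longrightarrow> linked x f y v u Q P q p"
  by (auto simp: linked_def same_place_sym)

lemma linked_label:
  "linked x f y u v P Q p q \<Longrightarrow> label (context_word x f y u) P = label (context_word x f y v) Q"
  unfolding linked_def using same_place_positions(2) by metis

lemma linked_order:
  assumes "linked x f y u v P Q p q" "linked x f y u v P' Q' p' q'" "wf_lword u"
    and less: "(p, p') \<in> leq u \<and> p \<noteq> p' \<Longrightarrow> (q, q') \<in> leq v \<and> q \<noteq> q'"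
    and le: "(p, p') \<in> leq u \<Longrightarrow> (q, q') \<in> leq v"
    and "(P, P') \<in> leq (context_word x f y u)"
  shows "(Q, Q') \<in> leq (context_word x f y v)" "P \<noteq> P' \<Longrightarrow> Q \<noteq> Q'"
proof -
  have pos: "same_place P Q p q" "same_place P' Q' p' q'" "p \<in> positions u"
    "P \<in> positions (context_word x f y u)" "P' \<in> positions (context_word x f y u)"
    "Q \<in> positions (context_word x f y v)" "Q' \<in> positions (context_word x f y v)"
    using assms(1,2) by (simp_all add: linked_def)
  have "p = p' \<Longrightarrow> (q, q') \<in> leq v" using le wf_lwordD(3)[OF assms(3) pos(3)] by simp
  from same_place_leq[OF pos(1,2) less this]
  show "(Q, Q') \<in> leq (context_word x f y v)" "P \<noteq> P' \<Longrightarrow> Q \<noteq> Q'"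
    using assms(6) context_word_leq[OF pos(4,5)] context_word_leq[OF pos(6,7)] by simp_all
qed

abbreviation winning_region :: "('p, 'a, 'v) config set \<Rightarrow> bool" where
  "winning_region W \<equiv> \<forall>c\<in>W. \<not> spoiler_wins_now c \<and>
     (\<forall>m. spoiler_move c m \<longrightarrow> (\<exists>r. duplicator_move c m r \<and> next_config c m r \<in> W))"

lemma winning_region_literal:
  assumes "winning_region W" "(G, (u, \<alpha>), (v, \<beta>)) \<in> W" "\<phi> \<in> G" "is_literal \<phi>"
    and "FV \<phi> \<subseteq> dom \<alpha>" "FV \<phi> \<subseteq> dom \<beta>" "sat u \<alpha> \<phi>"
  shows "sat v \<beta> \<phi>"
  using assms(1)[THEN bspec, OF assms(2)] assms(3-) by auto

lemma winning_region_label: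
  assumes "winning_region W" "(G, (u, \<alpha>), (v, \<beta>)) \<in> W" "fragment G" "\<alpha> x = Some p" "\<beta> x = Some q"
  shows "label u p = label v q"
proof -
  have "sat v \<beta> (Label x (label u p))"
    by (rule winning_region_literal[OF assms(1,2) fragment_atoms(3)[OF assms(3)]])
      (use assms(4,5) in \<open>auto simp: is_literal_def\<close>)
  then show ?thesis using assms(5) by simp
qed

text \<open>The block of \<open>P\<close> is played in the game on \<open>u\<close> and
  \<open>v\<close>, and Duplicator's answer is completed by the offset of \<open>P\<close>. Label
  atoms belong to every fragment, so an answer with another label would lose at once.\<close>

lemma linked_answer_left:
  assumes W: "winning_region W" "(G, (u, \<alpha>), (v, \<beta>)) \<in> W" and G: "fragment G" "reduct G Q z \<noteq> {}"
    and Q: "Q \<in> {QExists, QNegForall}"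
    and P: "P \<in> positions (context_word x f y u)" "positions u \<noteq> {}"
  obtains p q R where "next_config (G, (u, \<alpha>), (v, \<beta>)) (Q, z, p) q \<in> W" "linked x f y u v P R p q"
proof -
  obtain p where p: "p \<in> positions u" "\<And>q. \<exists>R. same_place P R p q"
    using same_place_exists[OF P] by metis
  have "spoiler_move (G, (u, \<alpha>), (v, \<beta>)) (Q, z, p)" using Q G p by simp
  then obtain q where "duplicator_move (G, (u, \<alpha>), (v, \<beta>)) (Q, z, p) q"
    and step: "next_config (G, (u, \<alpha>), (v, \<beta>)) (Q, z, p) q \<in> W"
    using W by blast
  then have q: "q \<in> positions v" using Q by auto
  have "label u p = label v q"
    using Q step winning_region_label[OF W(1) _ fragment_reduct[OF G], of _ _ _ _ z] by fastforce
  then have "linked x f y u v P R p q" if "same_place P R p q" for R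
    using same_place_positions(1)[OF that P(1) q] that P(1) p(1) q by (simp add: linked_def)
  then show thesis using that step p(2) by blast
qed

lemma linked_answer_right:
  assumes W: "winning_region W" "(G, (u, \<alpha>), (v, \<beta>)) \<in> W" and G: "fragment G" "reduct G Q z \<noteq> {}"
    and Q: "Q \<in> {QForall, QNegExists}"
    and R: "R \<in> positions (context_word x f y v)" "positions v \<noteq> {}"
  obtains p q P where "next_config (G, (u, \<alpha>), (v, \<beta>)) (Q, z, q) p \<in> W" "linked x f y u v P R p q"
proof -
  obtain q where q: "q \<in> positions v" "\<And>p. \<exists>P. same_place R P q p"
    using same_place_exists[OF R] by metis
  have "spoiler_move (G, (u, \<alpha>), (v, \<beta>)) (Q, z, q)" using Q G q by auto
  then obtain p where "duplicator_move (G, (u, \<alpha>), (v, \<beta>)) (Q, z, q) p"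
    and step: "next_config (G, (u, \<alpha>), (v, \<beta>)) (Q, z, q) p \<in> W"
    using W by blast
  then have p: "p \<in> positions u" using Q by auto
  have "label v q = label u p"
    using Q step winning_region_label[OF W(1) _ fragment_reduct[OF G], of _ _ _ _ z] by fastforce
  then have "linked x f y v u R P q p" if "same_place R P q p" for P
    using same_place_positions(1)[OF that R(1) p] that R(1) p q(1) by (simp add: linked_def)
  then show thesis using that step q(2) linked_sym by metis
qed

text \<open>A winning region evaluates a formula over the substituted words, one round per
  quantifier. Truth travels in one direction only, so negation cannot be treated by complement: it
  is pushed inwards to literals and to quantifiers, and negated quantifiers are the moves exchanging
  the two words. The induction is on size because \<open>Neg \<psi>1\<close> is no subformula of
  \<open>Neg (Disj \<psi>1 \<psi>2)\<close>.\<close>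

lemma winning_region_context:
  fixes \<phi> :: "('b, 'v) fm" and G :: "('b, 'v) fm set" and f :: "'b \<Rightarrow> 'b list"
  assumes W: "winning_region W"
  shows "(G, (u, \<alpha>), (v, \<beta>)) \<in> W \<Longrightarrow> fragment G \<Longrightarrow> order_stable G \<Longrightarrow>
    (\<And>\<psi>. \<psi> \<in> G \<Longrightarrow> no_suc_min_max_empty \<psi>) \<Longrightarrow> \<phi> \<in> G \<Longrightarrow>
    wf_lword u \<Longrightarrow> wf_lword v \<Longrightarrow> positions u \<noteq> {} \<Longrightarrow> positions v \<noteq> {} \<Longrightarrow>
    (\<And>z. z \<in> FV \<phi> \<Longrightarrow> \<exists>P R p q. \<alpha>' z = Some P \<and> \<beta>' z = Some R \<and> \<alpha> z = Some p \<and> \<beta> z = Some q \<and>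
      linked x f y u v P R p q) \<Longrightarrow>
    sat (context_word x f y u) \<alpha>' \<phi> \<Longrightarrow> sat (context_word x f y v) \<beta>' \<phi>"
proof (induction "size \<phi>" arbitrary: \<phi> G u \<alpha> v \<beta> \<alpha>' \<beta>' rule: less_induct)
  case less
  note G = less.prems(2-4) and wf = less.prems(6-7) and ne = less.prems(8-9)
    and links = less.prems(10)
  let ?u = "context_word x f y u" and ?v = "context_word x f y v"
  have IH: "sat ?u \<alpha>' \<psi> \<Longrightarrow> sat ?v \<beta>' \<psi>" if "size \<psi> < size \<phi>" "\<psi> \<in> G" "FV \<psi> \<subseteq> FV \<phi>" for \<psi>
    by (rule less.hyps[OF that(1) less.prems(1) G that(2) wf ne]) (use links that(3) in auto)
  have red: "fragment (reduct G Q z)" "order_stable (reduct G Q z)"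
    "\<And>\<psi>. \<psi> \<in> reduct G Q z \<Longrightarrow> no_suc_min_max_empty \<psi>" if "reduct G Q z \<noteq> {}" for Q z
    using fragment_reduct[OF G(1) that] order_stable_reduct[OF G(2)]
      no_suc_min_max_empty_reduct[OF G(3)] by blast+
  \<comment> \<open>For rounds after which the two words keep their sides.\<close>
  have IHu: "sat ?v (\<beta>'(z \<mapsto> R)) \<psi>"
    if "size \<psi> < size \<phi>" "FV \<psi> \<subseteq> insert z (FV \<phi>)" "\<psi> \<in> reduct G Q z" "linked x f y u v P R p q"
      "(reduct G Q z, (u, \<alpha>(z \<mapsto> p)), (v, \<beta>(z \<mapsto> q))) \<in> W"
      "sat ?u (\<alpha>'(z \<mapsto> P)) \<psi>" for \<psi> z P R p q Q
  proof (rule less.hyps[OF that(1,5) red _ wf ne _ that(6)])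
    show "\<exists>P' R' p' q'. (\<alpha>'(z \<mapsto> P)) w = Some P' \<and> (\<beta>'(z \<mapsto> R)) w = Some R' \<and>
        (\<alpha>(z \<mapsto> p)) w = Some p' \<and> (\<beta>(z \<mapsto> q)) w = Some q' \<and> linked x f y u v P' R' p' q'"
      if "w \<in> FV \<psi>" for w
      using links[of w] that \<open>FV \<psi> \<subseteq> _\<close> \<open>linked x f y u v P R p q\<close> by (cases "w = z") auto
  qed (use that(3) in auto)
  \<comment> \<open>For rounds with a negated quantifier: the configuration is swapped, so truth of
    the body is carried from right to left.\<close>
  have IHd: "sat ?u (\<alpha>'(z \<mapsto> P)) \<psi>"
    if "size \<psi> < size \<phi>" "FV \<psi> \<subseteq> insert z (FV \<phi>)" "\<psi> \<in> reduct G Q z" "linked x f y u v P R p q"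
      "(reduct G Q z, (v, \<beta>(z \<mapsto> q)), (u, \<alpha>(z \<mapsto> p))) \<in> W"
      "sat ?v (\<beta>'(z \<mapsto> R)) \<psi>" for \<psi> z P R p q Q
  proof (rule less.hyps[OF that(1,5) red _ wf(2,1) ne(2,1) _ that(6)])
    show "\<exists>R' P' q' p'. (\<beta>'(z \<mapsto> R)) w = Some R' \<and> (\<alpha>'(z \<mapsto> P)) w = Some P' \<and>
        (\<beta>(z \<mapsto> q)) w = Some q' \<and> (\<alpha>(z \<mapsto> p)) w = Some p' \<and> linked x f y v u R' P' q' p'"
      if "w \<in> FV \<psi>" for w
    proof (cases "w = z")
      case False
      then show ?thesis using links[of w] that \<open>FV \<psi> \<subseteq> _\<close> linked_sym by fastforce
    qed (use linked_sym[OF \<open>linked x f y u v P R p q\<close>] in simp)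
  qed (use that(3) in auto)
  have literal: "sat u \<alpha> \<psi> \<Longrightarrow> sat v \<beta> \<psi>" if "\<psi> \<in> G" "is_literal \<psi>" "FV \<psi> \<subseteq> FV \<phi>" for \<psi>
    by (rule winning_region_literal[OF W less.prems(1) that(1,2)]) (use links that(3) in fastforce)+
  have no_suc: "no_suc_min_max_empty \<phi>" using G(3) less.prems(5) by blast
  show ?case
  proof (cases \<phi>)
    case (Equal z w)
    obtain P R p q P' R' p' q' where 1: "\<alpha>' z = Some P" "\<beta>' z = Some R" "\<alpha> z = Some p" "\<beta> z = Some q"
      "linked x f y u v P R p q" "\<alpha>' w = Some P'" "\<beta>' w = Some R'" "\<alpha> w = Some p'" "\<beta> w = Some q'"
      "linked x f y u v P' R' p' q'"
      using links[of z] links[of w] by (auto simp: Equal)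
    have "p = p' \<Longrightarrow> q = q'" using literal[of \<phi>] 1 less.prems(5) by (simp add: Equal is_literal_def)
    then show ?thesis
      using same_place_eq[of P R p q P' R' p' q'] 1 less.prems(11) by (simp add: Equal linked_def)
  next
    case (Label z a)
    obtain P R p q where 1: "\<alpha>' z = Some P" "\<beta>' z = Some R" "linked x f y u v P R p q"
      using links[of z] by (auto simp: Label)
    then show ?thesis using less.prems(11) linked_label[OF 1(3)] by (simp add: Label)
  next
    case (Less z w)
    obtain P R p q P' R' p' q' where 1: "\<alpha>' z = Some P" "\<beta>' z = Some R" "\<alpha> z = Some p" "\<beta> z = Some q"
      "linked x f y u v P R p q" "\<alpha>' w = Some P'" "\<beta>' w = Some R'" "\<alpha> w = Some p'" "\<beta> w = Some q'"
      "linked x f y u v P' R' p' q'"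
      using links[of z] links[of w] by (auto simp: Less)
    \<comment> \<open>Even a strict atom needs both literals: the order of \<open>P\<close> and
      \<open>P'\<close> comes from distinct blocks or from offsets in one block, and the latter case
      requires the weak order of the answers.\<close>
    have "(p, p') \<in> leq u \<and> p \<noteq> p' \<Longrightarrow> (q, q') \<in> leq v \<and> q \<noteq> q'" "(p, p') \<in> leq u \<Longrightarrow> (q, q') \<in> leq v"
      using literal[of "Less z w"] literal[of "LessEq z w"] 1 less.prems(5) order_stable_iff(1)[OF G(2)]
      by (simp_all add: Less is_literal_def)
    from linked_order[OF 1(5,10) wf(1) this] show ?thesis
      using 1 less.prems(11) by (simp add: Less)
  next
    case (LessEq z w)
    obtain P R p q P' R' p' q' where 1: "\<alpha>' z = Some P" "\<beta>' z = Some R" "\<alpha> z = Some p" "\<beta> z = Some q"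
      "linked x f y u v P R p q" "\<alpha>' w = Some P'" "\<beta>' w = Some R'" "\<alpha> w = Some p'" "\<beta> w = Some q'"
      "linked x f y u v P' R' p' q'"
      using links[of z] links[of w] by (auto simp: LessEq)
    have "(p, p') \<in> leq u \<and> p \<noteq> p' \<Longrightarrow> (q, q') \<in> leq v \<and> q \<noteq> q'" "(p, p') \<in> leq u \<Longrightarrow> (q, q') \<in> leq v"
      using literal[of "Less z w"] literal[of "LessEq z w"] 1 less.prems(5) order_stable_iff(1)[OF G(2)]
      by (simp_all add: LessEq is_literal_def)
    from linked_order[OF 1(5,10) wf(1) this] show ?thesis
      using 1 less.prems(11) by (simp add: LessEq)
  next
    case (Disj \<psi>1 \<psi>2)
    then show ?thesis
      using IH[of \<psi>1] IH[of \<psi>2] less.prems(5,11) fragment_Disj_Conj_Hole(1)[OF G(1)] by auto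
  next
    case (Conj \<psi>1 \<psi>2)
    then show ?thesis
      using IH[of \<psi>1] IH[of \<psi>2] less.prems(5,11) fragment_Disj_Conj_Hole(2)[OF G(1)] by auto
  next
    case (Exists z \<psi>)
    then have \<psi>: "\<psi> \<in> reduct G QExists z" using less.prems(5) by (simp add: reduct_def)
    obtain P where P: "P \<in> positions ?u" "sat ?u (\<alpha>'(z \<mapsto> P)) \<psi>" using less.prems(11) Exists by auto
    obtain p q R where *: "next_config (G, (u, \<alpha>), (v, \<beta>)) (QExists, z, p) q \<in> W" "linked x f y u v P R p q"
      by (rule linked_answer_left[OF W less.prems(1) G(1) _ _ P(1) ne(1), of QExists z]) (use \<psi> in auto)
    have "sat ?v (\<beta>'(z \<mapsto> R)) \<psi>"
      by (rule IHu[OF _ _ \<psi> *(2)]) (use *(1) P(2) in \<open>auto simp: Exists\<close>)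
    moreover have "R \<in> positions ?v" using *(2) by (simp add: linked_def)
    ultimately show ?thesis by (auto simp: Exists)
  next
    case (Forall z \<psi>)
    then have \<psi>: "\<psi> \<in> reduct G QForall z" using less.prems(5) by (simp add: reduct_def)
    have "sat ?v (\<beta>'(z \<mapsto> R)) \<psi>" if R: "R \<in> positions ?v" for R
    proof -
      obtain p q P where *: "next_config (G, (u, \<alpha>), (v, \<beta>)) (QForall, z, q) p \<in> W" "linked x f y u v P R p q"
        by (rule linked_answer_right[OF W less.prems(1) G(1) _ _ R ne(2), of QForall z]) (use \<psi> in auto)
      have sat: "sat ?u (\<alpha>'(z \<mapsto> P)) \<psi>"
        using *(2) less.prems(11) by (simp add: Forall linked_def)
      show ?thesis by (rule IHu[OF _ _ \<psi> *(2) _ sat]) (use *(1) in \<open>auto simp: Forall\<close>)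
    qed
    then show ?thesis by (simp add: Forall)
  next
    case (Neg \<chi>)
    note neg = less.prems(5,11)[unfolded Neg]
    show ?thesis
    proof (cases \<chi>)
      case (Equal z w)
      obtain P R p q P' R' p' q' where 1: "\<alpha>' z = Some P" "\<beta>' z = Some R" "\<alpha> z = Some p" "\<beta> z = Some q"
        "linked x f y u v P R p q" "\<alpha>' w = Some P'" "\<beta>' w = Some R'" "\<alpha> w = Some p'" "\<beta> w = Some q'"
        "linked x f y u v P' R' p' q'"
        using links[of z] links[of w] by (auto simp: Neg Equal)
      have "q = q' \<Longrightarrow> p = p'" using literal[of \<phi>] 1 less.prems(5) by (auto simp: Neg Equal is_literal_def)
      then show ?thesis
        using same_place_eq[of R P q p R' P' q' p'] 1 less.prems(11)
        by (auto simp: Neg Equal linked_def same_place_sym)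
    next
      case (Label z a)
      obtain P R p q where 1: "\<alpha>' z = Some P" "\<beta>' z = Some R" "linked x f y u v P R p q"
        using links[of z] by (auto simp: Neg Label)
      then show ?thesis using less.prems(11) linked_label[OF 1(3)] by (simp add: Neg Label)
    next
      case (Less z w)
      obtain P R p q P' R' p' q' where 1: "\<alpha>' z = Some P" "\<beta>' z = Some R" "\<alpha> z = Some p" "\<beta> z = Some q"
        "linked x f y u v P R p q" "\<alpha>' w = Some P'" "\<beta>' w = Some R'" "\<alpha> w = Some p'" "\<beta> w = Some q'"
        "linked x f y u v P' R' p' q'"
        using links[of z] links[of w] by (auto simp: Neg Less)
      \<comment> \<open>Negated literals carry the order from right to left, so the links are used
        in reverse.\<close>
      have "(q, q') \<in> leq v \<and> q \<noteq> q' \<Longrightarrow> (p, p') \<in> leq u \<and> p \<noteq> p'" "(q, q') \<in> leq v \<Longrightarrow> (p, p') \<in> leq u"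
        using literal[of "Neg (Less z w)"] literal[of "Neg (LessEq z w)"] 1 less.prems(5)
          order_stable_iff(2)[OF G(2)]
        by (auto simp: Neg Less is_literal_def)
      from linked_order[OF linked_sym[OF 1(5)] linked_sym[OF 1(10)] wf(2) this] show ?thesis
        using 1 less.prems(11) by (auto simp: Neg Less)
    next
      case (LessEq z w)
      obtain P R p q P' R' p' q' where 1: "\<alpha>' z = Some P" "\<beta>' z = Some R" "\<alpha> z = Some p" "\<beta> z = Some q"
        "linked x f y u v P R p q" "\<alpha>' w = Some P'" "\<beta>' w = Some R'" "\<alpha> w = Some p'" "\<beta> w = Some q'"
        "linked x f y u v P' R' p' q'"
        using links[of z] links[of w] by (auto simp: Neg LessEq)
      have "(q, q') \<in> leq v \<and> q \<noteq> q' \<Longrightarrow> (p, p') \<in> leq u \<and> p \<noteq> p'" "(q, q') \<in> leq v \<Longrightarrow> (p, p') \<in> leq u"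
        using literal[of "Neg (Less z w)"] literal[of "Neg (LessEq z w)"] 1 less.prems(5)
          order_stable_iff(2)[OF G(2)]
        by (auto simp: Neg LessEq is_literal_def)
      from linked_order[OF linked_sym[OF 1(5)] linked_sym[OF 1(10)] wf(2) this] show ?thesis
        using 1 less.prems(11) by (auto simp: Neg LessEq)
    next
      case (Neg \<psi>)
      then show ?thesis
        using IH[of \<psi>] neg fragment_Neg_Neg[OF G(1)] \<open>\<phi> = Neg \<chi>\<close> by simp
    next
      case (Disj \<psi>1 \<psi>2)
      then show ?thesis
        using IH[of "Neg \<psi>1"] IH[of "Neg \<psi>2"] neg fragment_Disj_Conj_Neg(1)[OF G(1)] Neg by auto
    next
      case (Conj \<psi>1 \<psi>2)
      then show ?thesis
        using IH[of "Neg \<psi>1"] IH[of "Neg \<psi>2"] neg fragment_Disj_Conj_Neg(2)[OF G(1)] Neg by auto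
    next
      case (Exists z \<psi>)
      then have \<psi>: "\<psi> \<in> reduct G QNegExists z" using neg(1) by (simp add: reduct_def)
      have "\<not> sat ?v (\<beta>'(z \<mapsto> R)) \<psi>" if R: "R \<in> positions ?v" for R
      proof
        assume sat: "sat ?v (\<beta>'(z \<mapsto> R)) \<psi>"
        obtain p q P where *: "next_config (G, (u, \<alpha>), (v, \<beta>)) (QNegExists, z, q) p \<in> W"
          "linked x f y u v P R p q"
          by (rule linked_answer_right[OF W less.prems(1) G(1) _ _ R ne(2), of QNegExists z]) (use \<psi> in auto)
        have "sat ?u (\<alpha>'(z \<mapsto> P)) \<psi>"
          by (rule IHd[OF _ _ \<psi> *(2)]) (use *(1) sat in \<open>auto simp: Neg Exists\<close>)
        then show False using *(2) neg(2) by (simp add: Exists linked_def)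
      qed
      then show ?thesis by (simp add: Neg Exists)
    next
      case (Forall z \<psi>)
      then have \<psi>: "\<psi> \<in> reduct G QNegForall z" using neg(1) by (simp add: reduct_def)
      obtain P where P: "P \<in> positions ?u" "\<not> sat ?u (\<alpha>'(z \<mapsto> P)) \<psi>" using neg(2) Forall by auto
      obtain p q R where *: "next_config (G, (u, \<alpha>), (v, \<beta>)) (QNegForall, z, p) q \<in> W"
        "linked x f y u v P R p q"
        by (rule linked_answer_left[OF W less.prems(1) G(1) _ _ P(1) ne(1), of QNegForall z]) (use \<psi> in auto)
      have "sat ?u (\<alpha>'(z \<mapsto> P)) \<psi>" if "sat ?v (\<beta>'(z \<mapsto> R)) \<psi>"
        by (rule IHd[OF _ _ \<psi> *(2) _ that]) (use *(1) in \<open>auto simp: Neg Forall\<close>)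
      moreover have "R \<in> positions ?v" using *(2) by (simp add: linked_def)
      ultimately show ?thesis using P(2) by (auto simp: Neg Forall)
    qed (use neg no_suc Neg in auto)
  qed (use less.prems(11) no_suc in auto)
qed

lemma duplicator_wins_context:
  fixes F :: "('a, 'v) fm set"
  assumes "duplicator_wins (F, (u, Map.empty), (v, Map.empty))" "fragment F" "order_stable F"
    and "\<And>\<psi>. \<psi> \<in> F \<Longrightarrow> no_suc_min_max_empty \<psi>" "\<phi> \<in> F" "sentence \<phi>"
    and "wf_lword u" "wf_lword v" "positions u \<noteq> {}" "positions v \<noteq> {}"
    and "sat (context_word x f y u) Map.empty \<phi>"
  shows "sat (context_word x f y v) Map.empty \<phi>"
proof -
  obtain W where W: "winning_region W" "(F, (u, Map.empty), (v, Map.empty)) \<in> W"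
    using assms(1) unfolding duplicator_wins_iff by blast
  show ?thesis
    by (rule winning_region_context[OF W(1,2) assms(2-5,7-10) _ assms(11)])
      (use assms(6) in \<open>simp_all add: sentence_def\<close>)
qed

text \<open>The exponent dictated by the syntactic monoid is large enough for rho to replace it
  without effect on \<open>\<phi>\<close>, even after substitution and inside a context.\<close>

lemma sat_context_finite_word:
  assumes "no_suc_min_max_empty \<phi>" "sentence \<phi>"
  shows "sat (of_list (x @ concat (map f (finite_word (2 ^ qdepth \<phi>) t)) @ y)) Map.empty \<phi> \<longleftrightarrow>
    sat (context_word x f y (rho_rep t)) Map.empty \<phi>"
proof (rule back_forth_sat_sentence[OF _ order_refl assms])
  have "back_forth (qdepth \<phi>) (of_list (concat (map f (finite_word (2 ^ qdepth \<phi>) t))))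
      (subst_word f (rho_rep t)) {}"
    by (rule back_forth_empty_trans[OF back_forth_concat_map back_forth_subst_word])
      (rule back_forth_finite_word, simp)
  then show "back_forth (qdepth \<phi>) (of_list (x @ concat (map f (finite_word (2 ^ qdepth \<phi>) t)) @ y))
      (context_word x f y (rho_rep t)) {}"
    unfolding context_word_def by (intro back_forth_append back_forth_refl)
qed

section \<open>Identities in syntactic monoids and winning strategies\<close>

lemma duplicator_wins_game_iff:
  "duplicator_wins_game F g h \<longleftrightarrow>
    duplicator_wins (F, (rep_gword g, Map.empty), (rep_gword h, Map.empty))"
  by (rule duplicator_wins_game.rep_eq)

theorem theorem4p1:
  fixes F :: "('a::{countable, infinite}, 'v::{countable, infinite}) fm set"
    and s t :: "'a piterm"
  assumes "fragment F"
    and "order_stable F"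
    and "\<And>\<phi>. \<phi> \<in> F \<Longrightarrow> no_suc_min_max_empty \<phi>"
  shows "(\<forall>A \<phi>. finite A \<longrightarrow> \<phi> \<in> F \<longrightarrow> sentence \<phi> \<longrightarrow> holds_in (synt_monoid A (lang A \<phi>)) s t)
     \<longleftrightarrow> duplicator_wins_game F (word_of rho s) (word_of rho t) \<and>
         duplicator_wins_game F (word_of rho t) (word_of rho s)"
proof
  assume holds: "\<forall>A \<phi>. finite A \<longrightarrow> \<phi> \<in> F \<longrightarrow> sentence \<phi> \<longrightarrow> holds_in (synt_monoid A (lang A \<phi>)) s t"
  have agree: "sat (rho_rep s) Map.empty \<phi> \<longleftrightarrow> sat (rho_rep t) Map.empty \<phi>"
    if \<phi>: "\<phi> \<in> F" "sentence \<phi>" for \<phi>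
  proof -
    let ?n = "2 ^ qdepth \<phi>"
    obtain A where A: "finite A" "\<And>n. finite_word n s \<in> lists A" "\<And>n. finite_word n t \<in> lists A"
    proof -
      obtain B C where "finite B" "\<And>n. finite_word n s \<in> lists B"
        "finite C" "\<And>n. finite_word n t \<in> lists C" using finite_word_letters by metis
      moreover have "lists B \<subseteq> lists (B \<union> C)" "lists C \<subseteq> lists (B \<union> C)" by (simp_all add: lists_mono)
      ultimately show thesis by (intro that[of "B \<union> C"]) (simp_all add: subset_iff)
    qed
    \<comment> \<open>A morphism is defined on the whole infinite alphabet but takes classes of
      words over the finite \<open>A\<close> as values; letters outside \<open>A\<close>, which
      occur in neither term, go to the empty word.\<close>
    define w where "w a = (if a \<in> A then [a] else [])" for a
    have w: "w a \<in> lists A" for a by (simp add: w_def)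
    have map_w: "concat (map w xs) = xs" if "xs \<in> lists A" for xs
      using that by (induction xs) (simp_all add: w_def)
    note \<phi>' = assms(3)[OF \<phi>(1)] \<phi>(2)
    obtain h where h: "pi_morphism (carrier (synt_monoid A (lang A \<phi>))) (mult (synt_monoid A (lang A \<phi>)))
        (idem_power (synt_monoid A (lang A \<phi>))) h" "\<And>a. h (Letter a) = synt_class A (lang A \<phi>) (w a)"
      by (rule pi_morphism_exists[where A = A and w = w, OF \<phi>' w]) (rule that)
    have "h s = h t" using holds A(1) \<phi> h(1) unfolding holds_in_def by blast
    then have "synt_class A (lang A \<phi>) (finite_word ?n s) = synt_class A (lang A \<phi>) (finite_word ?n t)"
      using pi_morphism_class[OF \<phi>' h(1) w h(2)] map_w A(2,3) by metis
    then have "[] @ finite_word ?n s @ [] \<in> lang A \<phi> \<longleftrightarrow> [] @ finite_word ?n t @ [] \<in> lang A \<phi>"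
      unfolding synt_class_eq_iff[OF A(2,3)] by blast
    then have "sat (of_list (finite_word ?n s)) Map.empty \<phi> \<longleftrightarrow> sat (of_list (finite_word ?n t)) Map.empty \<phi>"
      using A(2)[of ?n] A(3)[of ?n] by (simp add: lang_def)
    moreover have "sat (of_list (finite_word ?n r)) Map.empty \<phi> \<longleftrightarrow> sat (rho_rep r) Map.empty \<phi>" for r
      by (rule back_forth_sat_sentence[OF back_forth_finite_word order_refl \<phi>']) simp
    ultimately show ?thesis by simp
  qed
  have "duplicator_wins_game F (word_of rho a) (word_of rho b)"
    if "\<And>\<phi>. \<phi> \<in> F \<Longrightarrow> sentence \<phi> \<Longrightarrow> sat (rho_rep a) Map.empty \<phi> \<Longrightarrow> sat (rho_rep b) Map.empty \<phi>" for a b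
    unfolding duplicator_wins_game_iff
    using duplicator_wins_saturated[OF assms(1,3) saturated_rho_rep saturated_rho_rep that] .
  then show "duplicator_wins_game F (word_of rho s) (word_of rho t) \<and>
      duplicator_wins_game F (word_of rho t) (word_of rho s)"
    using agree by blast
next
  assume game: "duplicator_wins_game F (word_of rho s) (word_of rho t) \<and>
      duplicator_wins_game F (word_of rho t) (word_of rho s)"
  show "\<forall>A \<phi>. finite A \<longrightarrow> \<phi> \<in> F \<longrightarrow> sentence \<phi> \<longrightarrow> holds_in (synt_monoid A (lang A \<phi>)) s t"
  proof (intro allI impI)
    fix A :: "'a set" and \<phi> assume \<phi>: "\<phi> \<in> F" "sentence \<phi>"
    note \<phi>' = assms(3)[OF \<phi>(1)] \<phi>(2)
    show "holds_in (synt_monoid A (lang A \<phi>)) s t"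
      unfolding holds_in_def
    proof (intro allI impI)
      fix h :: "'a piterm \<Rightarrow> 'a list set"
      assume h: "pi_morphism (carrier (synt_monoid A (lang A \<phi>))) (mult (synt_monoid A (lang A \<phi>)))
          (idem_power (synt_monoid A (lang A \<phi>))) h"
      have "\<exists>u\<in>lists A. h (Letter a) = synt_class A (lang A \<phi>) u" for a
        using h by (simp add: pi_morphism_def flip: carrier_synt_monoid)
      then obtain w where w: "\<And>a. w a \<in> lists A" "\<And>a. h (Letter a) = synt_class A (lang A \<phi>) (w a)"
        by metis
      let ?w = "\<lambda>r. concat (map w (finite_word (2 ^ qdepth \<phi>) r))"
      have wf: "wf_lword (rho_rep r)" for r :: "'a piterm" by (rule represents_wf[OF represents_rep])
      \<comment> \<open>Each of the two games gives one implication in all contexts; together they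
        give syntactic equivalence.\<close>
      have "sat (context_word x w y (rho_rep b)) Map.empty \<phi>"
        if "duplicator_wins_game F (word_of rho a) (word_of rho b)"
          "sat (context_word x w y (rho_rep a)) Map.empty \<phi>" for a b x y
        using duplicator_wins_context[OF that(1)[unfolded duplicator_wins_game_iff] assms \<phi> wf wf
            rho_rep_nonempty rho_rep_nonempty that(2)] .
      then have "sat (of_list (x @ ?w s @ y)) Map.empty \<phi> \<longleftrightarrow> sat (of_list (x @ ?w t @ y)) Map.empty \<phi>" for x y
        unfolding sat_context_finite_word[OF \<phi>'] using game by blast
      then have "synt_class A (lang A \<phi>) (?w s) = synt_class A (lang A \<phi>) (?w t)"
        using pi_morphism_class[OF \<phi>' h w] by (intro synt_class_eqI[OF \<phi>']) auto
      then show "h s = h t" using pi_morphism_class[OF \<phi>' h w] by simp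
    qed
  qed
qed

end
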